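(* Let $d\ge2$, $\mu\ge0$, $\gamma>-1$, $\beta\ge 0$, and $\alpha=\beta+\mu+\frac{d-1}{2}$. For $(x,t),(y,s)\in\mathbb V^{d+1}$ with $t,s>0$ and $u,z_1,z_2\in[-1,1]$ set $$ \xi_0(x,t,y,s;u)=\frac{1}{\sqrt{st}}\Big(\langle x,y\rangle+u\sqrt{t-\|x\|^2}\sqrt{s-\|y\|^2}\Big),\qquad \xi(x,t,y,s;z,u)=\tfrac{1-z_1}{2}\,\xi_0(x,t,y,s;u)+\tfrac{1+z_1}{2}\,z_2 . $$ Then, for every integer $n\ge0$: if $\beta>0$ and $\mu>0$, $$ \mathbf P_n\big(W_{\beta,\gamma,\mu};(x,t),(y,s)\big)=c\int_{[-1,1]^3}\mathbf P_n\Big(U_{\gamma,\alpha};\big(\sqrt t,t\big),\big(\sqrt s\,\xi(x,t,y,s;z,u),s\big)\Big)(1-z_1)^{\mu+\frac{d-1}{2}}(1+z_1)^{\beta-1}(1-z_2^2)^{\beta-\frac12}(1-u^2)^{\mu-1}\,dz_1\,dz_2\,du, $$ where $c>0$ is the constant for which $c\,(1-z_1)^{\mu+\frac{d-1}{2}}(1+z_1)^{\beta-1}(1-z_2^2)^{\beta-\frac12}(1-u^2)^{\mu-1}\,dz_1dz_2du$ is a probability measure on $[-1,1]^3$; and if $\beta=0$ and $\mu>0$, $$ \mathbf P_n\big(W_{0,\gamma,\mu};(x,t),(y,s)\big)=c'\int_{-1}^1\mathbf P_n\Big(U_{\gamma,\mu+\frac{d-1}{2}};\big(\sqrt t,t\big),\big(\sqrt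 s\,\xi_0(x,t,y,s;u),s\big)\Big)(1-u^2)^{\mu-1}\,du, $$ where $c'=\big(\int_{-1}^1(1-u^2)^{\mu-1}du\big)^{-1}$. In both cases the identity also holds for $\mu=0$ when the normalized integral in $u$ is interpreted by its limit as $\mu\to0$, that is, when $c'\int_{-1}^1 F(u)(1-u^2)^{\mu-1}du$ is replaced by $\frac12(F(1)+F(-1))$.
   Context: The solid paraboloid is $\mathbb V^{d+1}=\{(x,t):x\in\mathbb R^d,\ \|x\|^2\le t,\ 0\le t\le1\}$. The weight is $W_{\beta,\gamma,\mu}(x,t)=t^\beta(1-t)^\gamma(t-\|x\|^2)^{\mu-\frac12}$, with inner product $\langle f,g\rangle_{\beta,\gamma,\mu}=\mathbf b_{\beta,\gamma,\mu}\int_{\mathbb V^{d+1}}f g\,W_{\beta,\gamma,\mu}\,dx\,dt$, where $\mathbf b_{\beta,\gamma,\mu}$ is chosen so that $\langle1,1\rangle_{\beta,\gamma,\mu}=1$. $\mathcal V_n(\mathbb V^{d+1},W_{\beta,\gamma,\mu})$ is the space of polynomials in $(x,t)$ of total degree at most $n$ that are orthogonal to all polynomials of degree less than $n$, and $\mathbf P_n(W_{\beta,\gamma,\mu};\cdot,\cdot)$ is its reproducing kernel, $\mathbf P_n(W_{\beta,\gamma,\mu};p,q)=\sum_jQ_j(p)Q_j(q)$ for any orthonormal basis $\{Q_j\}$ of it. The parabolic domain is $\mathbb U=\{(x_1,x_2)\in\mathbb R^2:x_1^2\le x_2\le1\}$. For $a>-1$, $b>-\frac12$, $U_{a,b}(x)=(1-x_2)^a(x_2-x_1^2)^{b-\frac12}$,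 with inner product $\langle f,g\rangle_{\mathbb U}=\mathbf d_{a,b}\int_{\mathbb U}f g\,U_{a,b}\,dx$, $\mathbf d_{a,b}$ chosen so that $\langle1,1\rangle_{\mathbb U}=1$. $\mathcal V_n(\mathbb U,U_{a,b})$ is the space of polynomials in two variables of degree at most $n$ that are orthogonal to all polynomials of degree less than $n$, and $\mathbf P_n(U_{a,b};\cdot,\cdot)$ is its reproducing kernel, $\mathbf P_n(U_{a,b};x,y)=\sum_jP_j(x)P_j(y)$ for any orthonormal basis $\{P_j\}$ of $\mathcal V_n(\mathbb U,U_{a,b})$. *)

theory Defs
  imports "HOL-Analysis.Analysis"
begin

text \<open>Multi-indices are extended by \<open>0\<close> outside \<^term>\<open>Basis\<close>, so that there are only finitely
  many of each total degree.\<close>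

definition multi_indices :: "nat \<Rightarrow> ('b::euclidean_space \<Rightarrow> nat) set" where
  "multi_indices n = {k. (\<forall>b. b \<notin> Basis \<longrightarrow> k b = 0) \<and> (\<Sum>b\<in>Basis. k b) \<le> n}"

definition poly_upto :: "nat \<Rightarrow> ('b::euclidean_space \<Rightarrow> real) set" where
  "poly_upto n = {f. \<exists>c. \<forall>p. f p = (\<Sum>k\<in>multi_indices n. c k * (\<Prod>b\<in>Basis. (p \<bullet> b) ^ k b))}"

lemma finite_multi_indices: "finite (multi_indices n :: ('b::euclidean_space \<Rightarrow> nat) set)"
proof (rule finite_subset)
  show "(multi_indices n :: ('b \<Rightarrow> nat) set)
      \<subseteq> {k. \<forall>b. (b \<in> Basis \<longrightarrow> k b \<in> {..n}) \<and> (b \<notin> Basis \<longrightarrow> k b = 0)}"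
  proof
    fix k :: "'b \<Rightarrow> nat" assume k: "k \<in> multi_indices n"
    have "k b \<le> n" if "b \<in> Basis" for b
      using member_le_sum[of b Basis k] that k by (auto simp: multi_indices_def)
    then show "k \<in> {k. \<forall>b. (b \<in> Basis \<longrightarrow> k b \<in> {..n}) \<and> (b \<notin> Basis \<longrightarrow> k b = 0)}"
      using k by (auto simp: multi_indices_def)
  qed
  show "finite {k :: 'b \<Rightarrow> nat. \<forall>b. (b \<in> Basis \<longrightarrow> k b \<in> {..n}) \<and> (b \<notin> Basis \<longrightarrow> k b = 0)}"
    by (rule finite_set_of_finite_funs) auto
qed

text \<open>The constant that turns \<open>w\<close> into a probability density on \<open>D\<close>, equivalently
  \<open>weighted_inner D w 1 1 = 1\<close>. Weights are written with \<^term>\<open>(powr)\<close>, whose convention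
  \<open>0 powr a = 0\<close> only affects null sets of the domains below.\<close>

definition norm_const :: "'b::euclidean_space set \<Rightarrow> ('b \<Rightarrow> real) \<Rightarrow> real" where
  "norm_const D w = 1 / (LINT p:D|lborel. w p)"

definition weighted_inner ::
    "'b::euclidean_space set \<Rightarrow> ('b \<Rightarrow> real) \<Rightarrow> ('b \<Rightarrow> real) \<Rightarrow> ('b \<Rightarrow> real) \<Rightarrow> real" where
  "weighted_inner D w f g = norm_const D w * (LINT p:D|lborel. f p * g p * w p)"

definition orth_polys :: "'b::euclidean_space set \<Rightarrow> ('b \<Rightarrow> real) \<Rightarrow> nat \<Rightarrow> ('b \<Rightarrow> real) set" where
  "orth_polys D w n =
     {f \<in> poly_upto n. \<forall>m<n. \<forall>g \<in> poly_upto m. weighted_inner D w f g = 0}"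

definition orthonormal_basis ::
    "'b::euclidean_space set \<Rightarrow> ('b \<Rightarrow> real) \<Rightarrow> nat \<Rightarrow> ('b \<Rightarrow> real) set \<Rightarrow> bool" where
  "orthonormal_basis D w n B \<longleftrightarrow>
     finite B \<and> B \<subseteq> orth_polys D w n \<and>
     (\<forall>P\<in>B. \<forall>Q\<in>B. weighted_inner D w P Q = (if P = Q then 1 else 0)) \<and>
     (\<forall>f\<in>orth_polys D w n. \<exists>c. \<forall>p. f p = (\<Sum>Q\<in>B. c Q * Q p))"

text \<open>The choice of the basis is immaterial whenever products of polynomials are integrable
  against the weight; see \<open>repro_kernel_eq\<close> below.\<close>

definition repro_kernel ::
    "'b::euclidean_space set \<Rightarrow> ('b \<Rightarrow> real) \<Rightarrow> nat \<Rightarrow> 'b \<Rightarrow> 'b \<Rightarrow> real" where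
  "repro_kernel D w n p q = (\<Sum>Q\<in>(SOME B. orthonormal_basis D w n B). Q p * Q q)"

lemma weighted_inner_commute: "weighted_inner D w f g = weighted_inner D w g f"
proof -
  have "(\<lambda>p. f p * g p * w p) = (\<lambda>p. g p * f p * w p)"
    by (simp add: mult.commute[of "f _" "g _"])
  then show ?thesis unfolding weighted_inner_def by simp
qed

lemma orthonormal_expansion:
  assumes int: "\<And>f g. f \<in> poly_upto n \<Longrightarrow> g \<in> poly_upto n \<Longrightarrow>
      set_integrable lborel D (\<lambda>p. f p * g p * w p)"
    and B: "orthonormal_basis D w n B" and f: "f \<in> orth_polys D w n"
  shows "f p = (\<Sum>Q\<in>B. weighted_inner D w f Q * Q p)"
proof -
  from B f obtain c where c: "\<And>p. f p = (\<Sum>Q\<in>B. c Q * Q p)"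
    unfolding orthonormal_basis_def by blast
  have fin: "finite B" and sub: "B \<subseteq> poly_upto n"
    and on: "\<And>P Q. P \<in> B \<Longrightarrow> Q \<in> B \<Longrightarrow> weighted_inner D w P Q = (if P = Q then 1 else 0)"
    using B unfolding orthonormal_basis_def orth_polys_def by auto
  have "weighted_inner D w f Q = c Q" if Q: "Q \<in> B" for Q
  proof -
    have "(LINT p:D|lborel. f p * Q p * w p)
        = (LINT p:D|lborel. (\<Sum>P\<in>B. c P * (P p * Q p * w p)))"
      by (simp only: c sum_distrib_right mult.assoc)
    also have "\<dots> = (\<Sum>P\<in>B. c P * (LINT p:D|lborel. P p * Q p * w p))"
    proof -
      have i: "integrable lborel (\<lambda>p. c P * (indicator D p * (P p * Q p * w p)))" if "P \<in> B" for P
        using int[of P Q] that Q sub unfolding set_integrable_def by auto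
      have "(LINT p:D|lborel. (\<Sum>P\<in>B. c P * (P p * Q p * w p)))
          = (LINT p|lborel. (\<Sum>P\<in>B. c P * (indicator D p * (P p * Q p * w p))))"
        unfolding set_lebesgue_integral_def
        by (simp only: real_scaleR_def sum_distrib_left mult.left_commute)
      also have "\<dots> = (\<Sum>P\<in>B. LINT p|lborel. c P * (indicator D p * (P p * Q p * w p)))"
        by (rule Bochner_Integration.integral_sum) (rule i)
      finally show ?thesis
        unfolding set_lebesgue_integral_def by simp
    qed
    finally have "weighted_inner D w f Q = (\<Sum>P\<in>B. c P * weighted_inner D w P Q)"
      by (simp only: weighted_inner_def sum_distrib_left mult.left_commute)
    also have "\<dots> = (\<Sum>P\<in>B. if P = Q then c P else 0)"
      by (rule sum.cong) (auto simp: on Q)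
    also have "\<dots> = c Q" using fin Q by simp
    finally show ?thesis .
  qed
  then show ?thesis by (simp add: c)
qed

lemma repro_kernel_eq:
  assumes int: "\<And>f g. f \<in> poly_upto n \<Longrightarrow> g \<in> poly_upto n \<Longrightarrow>
      set_integrable lborel D (\<lambda>p. f p * g p * w p)"
    and B: "orthonormal_basis D w n B"
  shows "repro_kernel D w n p q = (\<Sum>P\<in>B. P p * P q)"
proof -
  define C where "C = (SOME B. orthonormal_basis D w n B)"
  have C: "orthonormal_basis D w n C" unfolding C_def using B by (rule someI)
  have subB: "B \<subseteq> orth_polys D w n" and subC: "C \<subseteq> orth_polys D w n"
    using B C unfolding orthonormal_basis_def by auto
  have "(\<Sum>P\<in>B. P p * P q) = (\<Sum>P\<in>B. (\<Sum>Q\<in>C. weighted_inner D w P Q * Q p) * P q)"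
  proof (rule sum.cong[OF refl])
    fix P assume "P \<in> B"
    then have "P \<in> orth_polys D w n" using subB by blast
    note e = orthonormal_expansion[OF int C this]
    show "P p * P q = (\<Sum>Q\<in>C. weighted_inner D w P Q * Q p) * P q"
      by (rule arg_cong[OF e, where f = "\<lambda>r. r * P q"])
  qed
  also have "\<dots> = (\<Sum>Q\<in>C. Q p * (\<Sum>P\<in>B. weighted_inner D w Q P * P q))"
  proof -
    have "weighted_inner D w P Q * Q p * P q = Q p * (weighted_inner D w Q P * P q)" for P Q
      using weighted_inner_commute[of D w P Q] by simp
    then show ?thesis
      unfolding sum_distrib_left sum_distrib_right by (subst sum.swap) (simp only:)
  qed
  also have "\<dots> = (\<Sum>Q\<in>C. Q p * Q q)"
  proof (rule sum.cong[OF refl])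
    fix Q assume "Q \<in> C"
    then have "Q \<in> orth_polys D w n" using subC by blast
    note e = orthonormal_expansion[OF int B this]
    show "Q p * (\<Sum>P\<in>B. weighted_inner D w Q P * P q) = Q p * Q q"
      by (rule arg_cong[OF e[symmetric], where f = "\<lambda>r. Q p * r"])
  qed
  finally show ?thesis unfolding repro_kernel_def C_def by simp
qed

definition solid_paraboloid :: "((real^'d) \<times> real) set" where
  "solid_paraboloid = {(x, t). (norm x)\<^sup>2 \<le> t \<and> 0 \<le> t \<and> t \<le> 1}"

definition W_weight :: "real \<Rightarrow> real \<Rightarrow> real \<Rightarrow> (real^'d) \<times> real \<Rightarrow> real" where
  "W_weight \<beta> \<gamma> \<mu> = (\<lambda>(x, t). t powr \<beta> * (1 - t) powr \<gamma> * (t - (norm x)\<^sup>2) powr (\<mu> - 1/2))"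

definition P_paraboloid ::
    "real \<Rightarrow> real \<Rightarrow> real \<Rightarrow> nat \<Rightarrow> (real^'d) \<times> real \<Rightarrow> (real^'d) \<times> real \<Rightarrow> real" where
  "P_paraboloid \<beta> \<gamma> \<mu> = repro_kernel solid_paraboloid (W_weight \<beta> \<gamma> \<mu>)"

definition parabolic_domain :: "(real \<times> real) set" where
  "parabolic_domain = {(x1, x2). x1\<^sup>2 \<le> x2 \<and> x2 \<le> 1}"

definition U_weight :: "real \<Rightarrow> real \<Rightarrow> real \<times> real \<Rightarrow> real" where
  "U_weight a b = (\<lambda>(x1, x2). (1 - x2) powr a * (x2 - x1\<^sup>2) powr (b - 1/2))"

definition P_parabolic :: "real \<Rightarrow> real \<Rightarrow> nat \<Rightarrow> real \<times> real \<Rightarrow> real \<times> real \<Rightarrow> real" where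
  "P_parabolic a b = repro_kernel parabolic_domain (U_weight a b)"

definition xi0 :: "real^'d \<Rightarrow> real \<Rightarrow> real^'d \<Rightarrow> real \<Rightarrow> real \<Rightarrow> real" where
  "xi0 x t y s u =
     1 / sqrt (s * t) * (x \<bullet> y + u * sqrt (t - (norm x)\<^sup>2) * sqrt (s - (norm y)\<^sup>2))"

definition xi :: "real^'d \<Rightarrow> real \<Rightarrow> real^'d \<Rightarrow> real \<Rightarrow> real \<Rightarrow> real \<Rightarrow> real \<Rightarrow> real" where
  "xi x t y s z1 z2 u = (1 - z1) / 2 * xi0 x t y s u + (1 + z1) / 2 * z2"

definition z_weight :: "real \<Rightarrow> real \<Rightarrow> real \<Rightarrow> real \<Rightarrow> real" where
  "z_weight \<kappa> \<beta> z1 z2 =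
     (1 - z1) powr \<kappa> * (1 + z1) powr (\<beta> - 1) * (1 - z2\<^sup>2) powr (\<beta> - 1/2)"

definition u_weight :: "real \<Rightarrow> real \<Rightarrow> real" where
  "u_weight \<mu> u = (1 - u\<^sup>2) powr (\<mu> - 1)"

end

theory Submission
  imports Defs "HOL-Probability.Distributions"
begin

text \<open>Put \<open>X = x/\<surd>t\<close> and let \<open>T\<close> be the operator that averages \<open>f(\<surd>s \<xi>, s)\<close> over \<open>\<xi>\<close>, so that the
  right-hand side is \<open>T\<close> applied to the kernel \<open>P\<^sub>n(U; (\<surd>t, t), \<cdot>)\<close>. Odd moments vanish, hence \<open>T\<close> maps
  polynomials of degree at most \<open>n\<close> to polynomials of degree at most \<open>n\<close>. The point is that its adjoint
  \<open>T\<^sup>*\<close> does so too and satisfies \<open>(T\<^sup>*Q)(\<surd>t, t) = Q(x, t)\<close>. Therefore \<open>T\<close> and \<open>T\<^sup>*\<close> preserve orthogonality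
  to lower degrees, and \<open>\<langle>T P\<^sub>n, Q\<rangle> = \<langle>P\<^sub>n, T\<^sup>*Q\<rangle> = (T\<^sup>*Q)(\<surd>t, t) = Q(x, t)\<close>: the right-hand side is the
  reproducing kernel.

  The adjoint is found from moments. Scaling \<open>y = \<surd>s Y\<close> and a Gamma integral in \<open>s\<close> reduce integrals
  over the paraboloid to Gaussian ones, in which the \<open>u\<close>-average becomes a Gaussian integral in one more
  variable, accessible to integration by parts. The \<open>z\<close>-average raises the Gegenbauer parameter from
  \<open>\<lambda> = \<mu> + (d - 1)/2\<close> to \<open>\<alpha> = \<lambda> + \<beta>\<close>; on moments this is the Rothe--Hagen convolution identity. All moments
  are meaningful at \<open>\<mu> = 0\<close> and \<open>\<beta> = 0\<close>, so the degenerate cases need no limit.\<close>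

section \<open>Moments of Gegenbauer weights\<close>

text \<open>The parameter \<alpha> is dictated by the height: under both weights its marginal
  density is proportional to s^\<alpha> (1 - s)^\<gamma>. Hence the moments on the two domains share
  the factor \<open>beta_moment\<close>, and only the scaled variable has to be compared. The
  obstacle is the degree of the adjoint. Moments determine T*Q, but they show neither that it is a
  polynomial of degree at most that of Q nor what its value at the base point is. The predicate
  \<open>geg_represents\<close> therefore carries a degree bound, a parity and the value at 1
  together through inductions on the degree, in which integration by parts trades one degree for a
  step from a to a + 1 in the Gegenbauer parameter. Parity is what makes the result a polynomial
  again: degrees missing in the scaled variable come in pairs and are refilled by integral powers of
  the height.\<close>

definition rothe :: "nat \<Rightarrow> real \<Rightarrow> real" where
  "rothe n x = pochhammer (x + real n + 1) n / fact n"

text \<open>\<open>rothe n x\<close> is the binomial coefficient of x + 2n over n, and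
  \<open>hagen n y\<close> is y / (y + 2n) times that of y + 2n over n, with the division carried
  out so that a polynomial in y remains. They are the coefficients of C^x / sqrt(1 - 4z) and of C^y
  for the Catalan series C = 1 + z C^2.\<close>

definition hagen :: "nat \<Rightarrow> real \<Rightarrow> real" where
  "hagen n y = (if n = 0 then 1 else y * pochhammer (y + real n + 1) (n - 1) / fact n)"

text \<open>Pascal's rule for the binomial coefficient of x + 2n + 3 over n + 1.\<close>

lemma rothe_add_one: "rothe (Suc n) (x + 1) = rothe (Suc n) x + rothe n (x + 2)"
proof -
  have "pochhammer (x + 1 + real (Suc n) + 1) (Suc n) = pochhammer (x + real n + 3) n * (x + 2 * real n + 3)"
    by (simp add: pochhammer_Suc algebra_simps)
  moreover have "pochhammer (x + real (Suc n) + 1) (Suc n) = (x + real n + 2) * pochhammer (x + real n + 3) n"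
    by (simp add: pochhammer_rec algebra_simps)
  moreover have "pochhammer (x + 2 + real n + 1) n = pochhammer (x + real n + 3) n"
    by (simp add: algebra_simps)
  moreover have "P * (x + 2 * real n + 3) / fact (Suc n) = (x + real n + 2) * P / fact (Suc n) + P / fact n" for P
  proof -
    have "P * (x + 2 * N + 1) / (N * F) = (x + N + 1) * P / (N * F) + P / F" if "N > 0" "F > 0" for N F :: real
      using that by (simp add: field_simps)
    from this[of "real n + 1" "fact n"] show ?thesis by (simp add: add_ac)
  qed
  ultimately show ?thesis
    unfolding rothe_def by metis
qed

text \<open>Coefficientwise this is C^(y+1) = C^y + z C^(y+2), the equation of the Catalan series
  times C^y.\<close>

lemma hagen_add_one: "hagen (Suc n) (y + 1) = hagen (Suc n) y + hagen n (y + 2)"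
proof (cases n)
  case 0
  then show ?thesis by (simp add: hagen_def)
next
  case (Suc k)
  define P where "P = pochhammer (y + real k + 4) k"
  have 1: "pochhammer (y + 1 + real (Suc n) + 1) n = P * (y + 2 * real k + 4)"
    by (simp add: Suc P_def pochhammer_Suc algebra_simps)
  have 2: "pochhammer (y + real (Suc n) + 1) n = (y + real k + 3) * P"
    by (simp add: Suc P_def pochhammer_rec algebra_simps)
  have 3: "pochhammer (y + 2 + real n + 1) k = P"
    by (simp add: Suc P_def algebra_simps)
  have "(y + 1) * (P * (y + 2 * K)) / (K * F) = y * ((y + K + 1) * P) / (K * F) + (y + 2) * P / F"
    if "K > 0" "F > 0" for K F :: real
    using that by (simp add: field_simps)
  note this[of "real k + 2" "fact n"]
  moreover have "(fact (Suc n) :: real) = (real k + 2) * fact n" "y + 2 * real k + 4 = y + 2 * (real k + 2)"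
    "y + real k + 3 = y + (real k + 2) + 1"
    by (simp_all add: Suc)
  ultimately have "(y + 1) * (P * (y + 2 * real k + 4)) / fact (Suc n)
      = y * ((y + real k + 3) * P) / fact (Suc n) + (y + 2) * P / fact n"
    by (simp only:) simp
  then show ?thesis
    unfolding hagen_def using 1 2 3 by (simp add: Suc)
qed

definition is_poly_fun :: "(real \<Rightarrow> real) \<Rightarrow> bool" where
  "is_poly_fun f \<longleftrightarrow> (\<exists>p. f = poly p)"

lemma is_poly_fun_const: "is_poly_fun (\<lambda>y. c)"
  unfolding is_poly_fun_def by (rule exI[of _ "[:c:]"]) auto

lemma is_poly_fun_shift: "is_poly_fun (\<lambda>y. c + y)"
  unfolding is_poly_fun_def by (rule exI[of _ "[:c, 1:]"]) auto

lemma is_poly_fun_add: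
  assumes "is_poly_fun f" "is_poly_fun g" shows "is_poly_fun (\<lambda>y. f y + g y)"
proof -
  obtain p q where "f = poly p" "g = poly q" using assms unfolding is_poly_fun_def by blast
  then show ?thesis unfolding is_poly_fun_def by (intro exI[of _ "p + q"]) auto
qed

lemma is_poly_fun_mult:
  assumes "is_poly_fun f" "is_poly_fun g" shows "is_poly_fun (\<lambda>y. f y * g y)"
proof -
  obtain p q where "f = poly p" "g = poly q" using assms unfolding is_poly_fun_def by blast
  then show ?thesis unfolding is_poly_fun_def by (intro exI[of _ "p * q"]) auto
qed

lemma is_poly_fun_sum:
  "(\<And>i. i \<in> I \<Longrightarrow> is_poly_fun (f i)) \<Longrightarrow> is_poly_fun (\<lambda>y. \<Sum>i\<in>I. f i y)"
  by (induction I rule: infinite_finite_induct) (auto intro: is_poly_fun_add is_poly_fun_const)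

lemma is_poly_fun_pochhammer: "is_poly_fun (\<lambda>y. pochhammer (c + y) n)"
proof (induction n)
  case (Suc n)
  have "is_poly_fun (\<lambda>y. pochhammer (c + y) n * ((c + real n) + y))"
    by (intro is_poly_fun_mult Suc is_poly_fun_shift)
  then show ?case by (simp add: pochhammer_Suc algebra_simps)
qed (simp add: is_poly_fun_const)

lemma is_poly_fun_eq_0:
  assumes f: "is_poly_fun f" and zero: "infinite {y. f y = 0}"
  shows "f y = 0"
proof -
  obtain p where p: "f = poly p" using f unfolding is_poly_fun_def by blast
  then have "p = 0" using zero poly_roots_finite[of p] by auto
  then show ?thesis using p by simp
qed

text \<open>For fixed \<open>x\<close> both sides are polynomials in \<open>y\<close>, and by the two difference equations
  their difference is \<open>1\<close>-periodic once the identity is known for \<open>n - 1\<close>.\<close>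

lemma rothe_hagen: "(\<Sum>l\<le>n. rothe l x * hagen (n - l) y) = rothe n (x + y)"
proof (induction n arbitrary: y)
  case 0
  then show ?case by (simp add: rothe_def hagen_def)
next
  case (Suc n)
  define F where "F y = (\<Sum>l\<le>Suc n. rothe l x * hagen (Suc n - l) y) + (- 1) * rothe (Suc n) (x + y)" for y
  have poly_rothe: "is_poly_fun (\<lambda>y. rothe m (x + y))" for m
    using is_poly_fun_mult[OF is_poly_fun_pochhammer[of "x + real m + 1" m] is_poly_fun_const[of "1 / fact m"]]
    by (simp add: rothe_def algebra_simps)
  have poly_hagen: "is_poly_fun (hagen m)" for m
  proof (cases m)
    case (Suc k)
    show ?thesis
      using is_poly_fun_mult[OF is_poly_fun_mult[OF is_poly_fun_shift[of 0] 
              is_poly_fun_pochhammer[of "real m + 1" k]] is_poly_fun_const[of "1 / fact m"]]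
      by (simp add: hagen_def[abs_def] Suc algebra_simps)
  qed (simp add: hagen_def[abs_def] is_poly_fun_const)
  have poly_F: "is_poly_fun F"
    unfolding F_def by (intro is_poly_fun_add is_poly_fun_sum is_poly_fun_mult is_poly_fun_const poly_rothe poly_hagen)
  have F_Suc: "F (y + 1) = F y" for y
  proof -
    have "(\<Sum>l\<le>Suc n. rothe l x * hagen (Suc n - l) (y + 1))
        = (\<Sum>l\<le>n. rothe l x * (hagen (Suc n - l) y + hagen (n - l) (y + 2))) + rothe (Suc n) x"
      by (simp add: Suc_diff_le hagen_add_one) (simp add: hagen_def)
    also have "\<dots> = (\<Sum>l\<le>Suc n. rothe l x * hagen (Suc n - l) y) + rothe n (x + (y + 2))"
      by (simp add: distrib_left sum.distrib Suc) (simp add: hagen_def)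
    finally show ?thesis
      using rothe_add_one[of n "x + y"] by (simp add: F_def algebra_simps)
  qed
  \<comment> \<open>At y = 0 only the last summand survives, because \<open>hagen m 0 = 0\<close>
    for m > 0. Periodicity spreads this zero over all naturals.\<close>
  have "F 0 = 0"
  proof -
    have "(\<Sum>l\<le>Suc n. rothe l x * hagen (Suc n - l) 0) = (\<Sum>l\<le>Suc n. if l = Suc n then rothe l x else 0)"
      by (intro sum.cong) (auto simp: hagen_def)
    then show ?thesis by (simp add: F_def)
  qed
  then have nat0: "F (real k) = 0" for k
  proof (induction k)
    case (Suc k)
    then show ?case using F_Suc[of "real k"] by (simp add: add.commute)
  qed simp
  have "F y = 0"
  proof (rule is_poly_fun_eq_0[of F])
    have "range real \<subseteq> {y. F y = 0}" using nat0 by auto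
    moreover have "infinite (range real)" by (simp add: finite_image_iff inj_on_def)
    ultimately show "infinite {y. F y = 0}" by (rule infinite_super)
  qed (rule poly_F)
  then show ?case by (simp add: F_def)
qed

lemma sum_even_terms:
  fixes f :: "nat \<Rightarrow> real"
  assumes "\<And>k. odd k \<Longrightarrow> f k = 0"
  shows "(\<Sum>k\<le>2 * n. f k) = (\<Sum>l\<le>n. f (2 * l))"
proof -
  have "sum f {..2 * n} = sum f ((\<lambda>l. 2 * l) ` {..n})"
  proof (rule sum.mono_neutral_right)
    show "\<forall>k\<in>{..2 * n} - (\<lambda>l. 2 * l) ` {..n}. f k = 0"
    proof
      fix k assume "k \<in> {..2 * n} - (\<lambda>l. 2 * l) ` {..n}"
      then have "odd k" by (auto elim!: evenE)
      then show "f k = 0" by (rule assms)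
    qed
  qed auto
  then show ?thesis by (simp add: sum.reindex inj_on_def)
qed

section \<open>Gaussian and Gegenbauer moments\<close>

fun gauss_moment :: "nat \<Rightarrow> real" where
  "gauss_moment 0 = 1"
| "gauss_moment (Suc 0) = 0"
| "gauss_moment (Suc (Suc k)) = (real k + 1) / 2 * gauss_moment k"

text \<open>The factor between a Gaussian moment of degree k and the same moment on the interval or
  the ball: the radial integration contributes a quotient of Gamma values that depends on the degree
  only.\<close>

abbreviation gamma_quot :: "real \<Rightarrow> nat \<Rightarrow> real" where
  "gamma_quot a k \<equiv> Gamma (a + 1) / Gamma (a + 1 + real k / 2)"

text \<open>The moments of the probability measure on \<open>[-1, 1]\<close> with density proportional to
  \<open>(1 - x\<^sup>2)\<^bsup>b - 1/2\<^esup>\<close>, see \<open>gegenbauer_integral\<close>; for \<open>b = -1/2\<close> those of its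
  weak limit, the uniform measure on \<open>{-1, 1}\<close>.\<close>

definition geg_moment :: "real \<Rightarrow> nat \<Rightarrow> real" where
  "geg_moment b k = gauss_moment k * gamma_quot b k"

lemma gauss_moment_odd: "odd k \<Longrightarrow> gauss_moment k = 0"
  by (induction k rule: gauss_moment.induct) auto

lemma gauss_moment_even: "gauss_moment (2 * l) = fact (2 * l) / (4 ^ l * fact l)"
proof (induction l)
  case (Suc l)
  have "(2 * N) * ((2 * N - 1) * F) / (4 * P * (N * G)) = (2 * N - 1) / 2 * (F / (P * G))" if "N > 0" for N F P G :: real
    using that by (cases "P * G = 0") (auto simp: field_simps)
  from this[of "real l + 1" "fact (2 * l)" "4 ^ l" "fact l"]
  have "fact (2 * Suc l) / (4 ^ Suc l * fact (Suc l)) = (2 * real l + 1) / 2 * (fact (2 * l) / (4 ^ l * fact l))"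
    by (simp add: algebra_simps)
  moreover have "gauss_moment (2 * Suc l) = (2 * real l + 1) / 2 * gauss_moment (2 * l)" by simp
  ultimately show ?case unfolding Suc by simp
qed simp

text \<open>If U and V are independent with density exp(-x^2) / sqrt pi, then a U + b V is
  distributed like sqrt(a^2 + b^2) U; the root disappears because odd moments vanish.\<close>

lemma gauss_moment_convolution:
  "(\<Sum>l\<le>k. real (k choose l) * (a ^ (k - l) * gauss_moment (k - l)) * (b ^ l * gauss_moment l))
     = (if even k then (a\<^sup>2 + b\<^sup>2) ^ (k div 2) else 0) * gauss_moment k" (is "sum ?f _ = _")
proof (cases "even k")
  case False
  have "?f l = 0" if "l \<le> k" for l
    using that False by (cases "even l") (auto simp: gauss_moment_odd)
  then have "sum ?f {..k} = 0" by (intro sum.neutral) simp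
  then show ?thesis using False by simp
next
  case True
  then obtain n where k: "k = 2 * n" by blast
  have "sum ?f {..k} = (\<Sum>l\<le>n. ?f (2 * l))"
    unfolding k by (rule sum_even_terms) (simp add: gauss_moment_odd)
  also have "\<dots> = (\<Sum>l\<le>n. gauss_moment k * (real (n choose l) * (b\<^sup>2) ^ l * (a\<^sup>2) ^ (n - l)))"
  proof (rule sum.cong[OF refl])
    fix l assume "l \<in> {..n}"
    then have l: "l \<le> n" "2 * n - 2 * l = 2 * (n - l)" by auto
    have "real (2 * n choose (2 * l)) * gauss_moment (2 * (n - l)) * gauss_moment (2 * l)
        = real (2 * n choose (2 * l)) * fact (2 * l) * fact (2 * (n - l)) / (4 ^ l * 4 ^ (n - l)) / (fact l * fact (n - l))"
      unfolding gauss_moment_even by (simp add: mult_ac)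
    also have "real (2 * n choose (2 * l)) * fact (2 * l) * fact (2 * (n - l)) = fact (2 * n)"
      using l by (simp add: binomial_fact flip: l(2))
    also have "(4::real) ^ l * 4 ^ (n - l) = 4 ^ n" using l by (simp flip: power_add)
    also have "fact (2 * n) / 4 ^ n / (fact l * fact (n - l)) = gauss_moment (2 * n) * real (n choose l)"
      unfolding gauss_moment_even using l by (simp add: binomial_fact)
    finally have "real (2 * n choose (2 * l)) * gauss_moment (2 * (n - l)) * gauss_moment (2 * l)
        = gauss_moment (2 * n) * real (n choose l)" .
    then show "?f (2 * l) = gauss_moment k * (real (n choose l) * (b\<^sup>2) ^ l * (a\<^sup>2) ^ (n - l))"
    proof -
      assume "real (2 * n choose (2 * l)) * gauss_moment (2 * (n - l)) * gauss_moment (2 * l)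
        = gauss_moment (2 * n) * real (n choose l)"
      moreover have "x * (A * y) * (B * z) = w * (v * B * A)" if "x * y * z = w * v" for x y z w v A B :: real
      proof -
        have "x * (A * y) * (B * z) = (x * y * z) * (A * B)" by (simp only: mult_ac)
        then show ?thesis unfolding that by (simp only: mult_ac)
      qed
      ultimately show ?thesis unfolding k l(2) power_mult by blast
    qed
  qed
  also have "\<dots> = gauss_moment k * (b\<^sup>2 + a\<^sup>2) ^ n"
    by (simp add: binomial_ring flip: sum_distrib_left)
  finally show ?thesis by (simp add: k add.commute mult.commute)
qed

lemma geg_moment_odd: "odd k \<Longrightarrow> geg_moment b k = 0"
  by (simp add: geg_moment_def gauss_moment_odd)

lemma geg_moment_0: "b > -1 \<Longrightarrow> geg_moment b 0 = 1"
  using Gamma_real_pos[of "b + 1"] by (simp add: geg_moment_def less_imp_neq[symmetric])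

lemma Gamma_add_one_real: "z > 0 \<Longrightarrow> Gamma (z + 1) = z * Gamma (z::real)"
  by (rule Gamma_plus1) (auto simp: nonpos_Ints_def)

lemma geg_moment_Suc_Suc:
  assumes "b > -1"
  shows "(b + 1 + real k / 2) * geg_moment b (Suc (Suc k)) = (real k + 1) / 2 * geg_moment b k"
proof -
  have *: "b + 1 + real k / 2 > 0" using assms by (simp add: add_pos_nonneg)
  have "b + 1 + real (Suc (Suc k)) / 2 = b + 1 + real k / 2 + 1" by (simp add: field_simps)
  moreover have "D * (h * g * (G / (D * G'))) = h * (g * (G / G'))" if "D > 0" for D h g G G' :: real
    using that by simp
  ultimately show ?thesis
    using * by (simp only: geg_moment_def gauss_moment.simps Gamma_add_one_real[OF *])
qed

lemma geg_moment_shift: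
  assumes "b > -1"
  shows "(b + 1 + real k / 2) * geg_moment (b + 1) k = (b + 1) * geg_moment b k"
proof -
  have *: "b + 1 + real k / 2 > 0" "b + 1 > 0" using assms by (auto simp: add_pos_nonneg)
  have eq: "b + 1 + 1 + real k / 2 = b + 1 + real k / 2 + 1" by (simp add: field_simps)
  moreover have "D * (g * (h * G / (D * G'))) = h * (g * (G / G'))" if "D > 0" for D h g G G' :: real
    using that by simp
  ultimately show ?thesis
    using * by (simp only: geg_moment_def eq Gamma_add_one_real[OF *(1)] Gamma_add_one_real[OF *(2)])
qed

text \<open>Both sides obey the same recurrence in l. The Pochhammer factor is part of a moment of
  (1 - z1)/2; multiplied by the Gegenbauer moment it collapses to a binomial coefficient, which is
  how the Rothe--Hagen identity enters.\<close>

lemma pochhammer_geg_moment_even: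
  assumes "a > -1"
  shows "pochhammer (a + 1) (2 * l) * geg_moment a (2 * l) = fact (2 * l) / 4 ^ l * rothe l a"
proof (induction l)
  case 0
  then show ?case using geg_moment_0[OF assms] by (simp add: rothe_def)
next
  case (Suc l)
  have pos: "a + real l + 1 > 0" using assms by (simp add: add_pos_nonneg)
  have m: "(a + 1 + real l) * geg_moment a (2 * Suc l) = (2 * real l + 1) / 2 * geg_moment a (2 * l)"
    using geg_moment_Suc_Suc[OF assms, of "2 * l"] by simp
  define P where "P = pochhammer (a + real l + 2) l"
  have "pochhammer (a + real l + 1) (Suc l) = (a + real l + 1) * P"
    unfolding P_def pochhammer_rec by (simp add: algebra_simps)
  then have P1: "pochhammer (a + real l + 1) l * (a + 2 * real l + 1) = (a + real l + 1) * P"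
    by (simp add: pochhammer_Suc algebra_simps)
  have P2: "pochhammer (a + real (Suc l) + 1) (Suc l) = P * (a + 2 * real l + 2)"
    by (simp add: P_def pochhammer_Suc algebra_simps)
  \<comment> \<open>From l to l + 1 the product in \<open>rothe\<close> loses the factor a + l + 1
    and gains a + 2l + 1 and a + 2l + 2.\<close>
  have r: "(a + 1 + real l) * (real l + 1) * rothe (Suc l) a
      = (a + 2 * real l + 1) * (a + 2 * real l + 2) * rothe l a"
  proof -
    have "A * L * (P * C / (L * F)) = B * C * (Q / F)" if "Q * B = A * P" "L > 0" for A B C L F Q P :: real
      using that by (simp add: field_simps)
    from this[OF P1, where L = "real l + 1" and C = "a + 2 * real l + 2" and F = "fact l"]
    show ?thesis
      unfolding rothe_def P2 by (simp add: add_ac)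
  qed
  have "(a + 1 + real l) * (pochhammer (a + 1) (2 * Suc l) * geg_moment a (2 * Suc l))
      = pochhammer (a + 1) (2 * l) * (a + 1 + 2 * real l) * (a + 2 + 2 * real l)
         * ((a + 1 + real l) * geg_moment a (2 * Suc l))"
    by (simp add: pochhammer_Suc algebra_simps)
  also have "\<dots> = (a + 1 + 2 * real l) * (a + 2 + 2 * real l) * ((2 * real l + 1) / 2)
         * (pochhammer (a + 1) (2 * l) * geg_moment a (2 * l))"
    unfolding m by (simp only: mult_ac)
  also have "\<dots> = fact (2 * l) / 4 ^ l * ((2 * real l + 1) / 2) * ((a + 2 * real l + 1) * (a + 2 * real l + 2) * rothe l a)"
    unfolding Suc by (simp add: mult_ac add_ac)
  also have "\<dots> = (a + 1 + real l) * (fact (2 * Suc l) / 4 ^ Suc l * rothe (Suc l) a)"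
    unfolding r[symmetric] by (simp add: field_simps)
  finally show ?case using pos by (subst (asm) mult_left_cancel) auto
qed

text \<open>The Pochhammer symbol starts at b instead of b + 1 because 1 + z1 carries the exponent b
  - 1. For l > 0 this costs the factor b / (b + 2l), which is exactly the quotient of
  \<open>hagen l b\<close> by \<open>rothe l b\<close>.\<close>

lemma pochhammer_geg_moment_even':
  assumes "b \<ge> 0"
  shows "pochhammer b (2 * l) * geg_moment b (2 * l) = fact (2 * l) / 4 ^ l * hagen l b"
proof (cases l)
  case 0
  then show ?thesis using geg_moment_0[of b] assms by (simp add: hagen_def)
next
  case (Suc k)
  have pos: "b + 2 * real l > 0" using assms Suc by simp
  have "(b + 2 * real l) * pochhammer b (2 * l) = b * pochhammer (b + 1) (2 * l)"
    using pochhammer_rec[of b "2 * l"] by (simp add: pochhammer_Suc mult.commute)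
  moreover have "(b + 2 * real l) * hagen l b = b * rothe l b"
    by (simp add: hagen_def rothe_def Suc pochhammer_Suc algebra_simps)
  moreover have "x * (P * m) = x * (F * h)" if "x * P = y * Q" "x * h = y * r" "Q * m = F * r" for x P m F h y Q r :: real
  proof -
    have "x * (P * m) = y * (Q * m)" using that(1) by (simp add: mult.assoc[symmetric])
    also have "\<dots> = F * (y * r)" using that(3) by simp
    finally show ?thesis using that(2) by simp
  qed
  moreover have "pochhammer (b + 1) (2 * l) * geg_moment b (2 * l) = fact (2 * l) / 4 ^ l * rothe l b"
    using assms by (intro pochhammer_geg_moment_even) simp
  ultimately have "(b + 2 * real l) * (pochhammer b (2 * l) * geg_moment b (2 * l))
      = (b + 2 * real l) * (fact (2 * l) / 4 ^ l * hagen l b)"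
    by blast
  then show ?thesis using pos by (subst (asm) mult_left_cancel) auto
qed

text \<open>Averaging a variable with moments \<open>geg_moment a\<close> over z1 and z2 produces
  one with moments \<open>geg_moment (a + b)\<close>; here both sides are multiplied by the
  normalising Pochhammer symbol. The even terms are the summands of the Rothe--Hagen
  identity.\<close>

lemma geg_moment_convolution:
  assumes "a > -1" "b \<ge> 0"
  shows "(\<Sum>k\<le>i. real (i choose k) * pochhammer (a + 1) k * pochhammer b (i - k)
            * geg_moment b (i - k) * geg_moment a k)
       = pochhammer (a + b + 1) i * geg_moment (a + b) i" (is "sum ?f _ = _")
proof (cases "even i")
  case False
  have "?f k = 0" if "k \<le> i" for k
    using that False by (cases "even k") (auto simp: geg_moment_odd)
  then have "sum ?f {..i} = 0" by (intro sum.neutral) simp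
  then show ?thesis using False by (simp add: geg_moment_odd)
next
  case True
  then obtain n where i: "i = 2 * n" by blast
  have "sum ?f {..i} = (\<Sum>l\<le>n. ?f (2 * l))"
    unfolding i by (rule sum_even_terms) (simp add: geg_moment_odd)
  also have "\<dots> = (\<Sum>l\<le>n. fact (2 * n) / 4 ^ n * (rothe l a * hagen (n - l) b))"
  proof (rule sum.cong[OF refl])
    fix l assume "l \<in> {..n}"
    then have l: "l \<le> n" "2 * n - 2 * l = 2 * (n - l)" by auto
    have "?f (2 * l) = real (2 * n choose (2 * l)) * (pochhammer (a + 1) (2 * l) * geg_moment a (2 * l))
        * (pochhammer b (2 * (n - l)) * geg_moment b (2 * (n - l)))"
      unfolding i l by (simp only: mult_ac)
    also have "\<dots> = real (2 * n choose (2 * l)) * fact (2 * l) * fact (2 * (n - l)) / (4 ^ l * 4 ^ (n - l))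
        * (rothe l a * hagen (n - l) b)"
      unfolding pochhammer_geg_moment_even[OF assms(1)] pochhammer_geg_moment_even'[OF assms(2)] by simp
    also have "real (2 * n choose (2 * l)) * fact (2 * l) * fact (2 * (n - l)) = fact (2 * n)"
      using l by (simp add: binomial_fact flip: l(2))
    also have "(4::real) ^ l * 4 ^ (n - l) = 4 ^ n" using l by (simp flip: power_add)
    finally show "?f (2 * l) = fact (2 * n) / 4 ^ n * (rothe l a * hagen (n - l) b)" .
  qed
  also have "\<dots> = pochhammer (a + b + 1) i * geg_moment (a + b) i"
    using assms pochhammer_geg_moment_even[of "a + b" n]
    by (simp only: i rothe_hagen flip: sum_distrib_left)
  finally show ?thesis .
qed

text \<open>\<open>s\<close> is the sequence \<open>i \<mapsto> E [\<zeta>\<^sup>i q(\<zeta>)]\<close>, where \<open>\<zeta>\<close> has the moments \<open>geg_moment a\<close> and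
  \<open>q\<close> is a polynomial of degree at most \<open>j\<close>, of the parity of \<open>j\<close>, with \<open>q(1) = c\<close>.\<close>

definition geg_represents :: "real \<Rightarrow> nat \<Rightarrow> real \<Rightarrow> (nat \<Rightarrow> real) \<Rightarrow> bool" where
  "geg_represents a j c s \<longleftrightarrow>
     (\<exists>q. (\<Sum>l\<le>j div 2. q l) = c \<and> (\<forall>i. s i = (\<Sum>l\<le>j div 2. q l * geg_moment a (i + (j - 2 * l)))))"

section \<open>Calculus of represented moment sequences\<close>

lemma geg_represents_moment:
  assumes "2 * l \<le> j"
  shows "geg_represents a j 1 (\<lambda>i. geg_moment a (i + (j - 2 * l)))"
proof -
  have l: "l \<in> {..j div 2}" using assms by auto
  show ?thesis
    unfolding geg_represents_def using l
    by (intro exI[of _ "\<lambda>k. if k = l then 1 else 0"]) (auto simp: if_distrib[of "\<lambda>x. x * _"] cong: if_cong)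
qed

lemma geg_represents_add:
  assumes "geg_represents a j c s" "geg_represents a j c' s'"
  shows "geg_represents a j (c + c') (\<lambda>i. s i + s' i)"
proof -
  obtain q q' where "(\<Sum>l\<le>j div 2. q l) = c" "\<forall>i. s i = (\<Sum>l\<le>j div 2. q l * geg_moment a (i + (j - 2 * l)))"
     "(\<Sum>l\<le>j div 2. q' l) = c'" "\<forall>i. s' i = (\<Sum>l\<le>j div 2. q' l * geg_moment a (i + (j - 2 * l)))"
    using assms unfolding geg_represents_def by blast
  then show ?thesis unfolding geg_represents_def
    by (intro exI[of _ "\<lambda>l. q l + q' l"]) (auto simp: sum.distrib distrib_right)
qed

lemma geg_represents_scale:
  assumes "geg_represents a j c s"
  shows "geg_represents a j (r * c) (\<lambda>i. r * s i)"
proof -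
  obtain q where "(\<Sum>l\<le>j div 2. q l) = c" "\<forall>i. s i = (\<Sum>l\<le>j div 2. q l * geg_moment a (i + (j - 2 * l)))"
    using assms unfolding geg_represents_def by blast
  then show ?thesis unfolding geg_represents_def
    by (intro exI[of _ "\<lambda>l. r * q l"]) (auto simp: sum_distrib_left mult.assoc)
qed

lemma geg_represents_sum:
  "(\<And>x. x \<in> S \<Longrightarrow> geg_represents a j (c x) (s x)) \<Longrightarrow> geg_represents a j (\<Sum>x\<in>S. c x) (\<lambda>i. \<Sum>x\<in>S. s x i)"
proof (induction S rule: infinite_finite_induct)
  case (insert x F)
  then show ?case using geg_represents_add[of a j "c x" "s x"] by simp
qed (auto simp: geg_represents_def intro: exI[of _ "\<lambda>_. 0"])

text \<open>By linearity a transformation of sequences need only be understood on pure powers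
  \<zeta>^(j - 2l); \<open>r\<close> is the common value at 1 of their images.\<close>

lemma geg_represents_lift:
  assumes s: "geg_represents a j c s"
    and basis: "\<And>l. 2 * l \<le> j \<Longrightarrow>
      geg_represents a' j' r (\<lambda>i. \<Sum>k\<in>K i. w i k * geg_moment a (k + (j - 2 * l)))"
  shows "geg_represents a' j' (r * c) (\<lambda>i. \<Sum>k\<in>K i. w i k * s k)"
proof -
  obtain q where c: "(\<Sum>l\<le>j div 2. q l) = c"
    and s: "\<And>i. s i = (\<Sum>l\<le>j div 2. q l * geg_moment a (i + (j - 2 * l)))"
    using s unfolding geg_represents_def by blast
  have "geg_represents a' j' (\<Sum>l\<le>j div 2. q l * r)
      (\<lambda>i. \<Sum>l\<le>j div 2. q l * (\<Sum>k\<in>K i. w i k * geg_moment a (k + (j - 2 * l))))"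
    by (intro geg_represents_sum geg_represents_scale basis) auto
  moreover have "(\<Sum>l\<le>j div 2. q l * r) = r * c"
    by (simp add: mult.commute flip: c sum_distrib_left)
  moreover have "(\<Sum>l\<le>j div 2. q l * (\<Sum>k\<in>K i. w i k * geg_moment a (k + (j - 2 * l))))
      = (\<Sum>k\<in>K i. w i k * s k)" for i
    unfolding s sum_distrib_left by (subst sum.swap) (simp add: mult_ac)
  ultimately show ?thesis by simp
qed

lemma geg_represents_Suc_Suc:
  assumes "geg_represents a j c s" shows "geg_represents a (Suc (Suc j)) c s"
proof -
  have "geg_represents a (Suc (Suc j)) 1 (\<lambda>i. geg_moment a (i + (j - 2 * l)))" if "2 * l \<le> j" for l
    using geg_represents_moment[of "Suc l" "Suc (Suc j)" a] that by simp
  then show ?thesis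
    using geg_represents_lift[OF assms, where K = "\<lambda>i. {i}" and w = "\<lambda>_ _. 1" and r = 1
        and a' = a and j' = "Suc (Suc j)"] by simp
qed

lemma geg_represents_add_even:
  "geg_represents a j c s \<Longrightarrow> geg_represents a (j + 2 * l) c s"
  by (induction l) (auto intro: geg_represents_Suc_Suc)

text \<open>Integration by parts: \<open>((2a+1) \<zeta> - (1-\<zeta>\<^sup>2) d/d\<zeta>)\<close> is adjoint to \<open>d/d\<zeta>\<close> up to the shift of \<open>a\<close>;
  here it is applied to \<open>\<zeta>\<^sup>e\<close>.\<close>

lemma geg_moment_by_parts:
  assumes "a > -1/2"
  shows "(2 * a + 1) / (2 * (a + 1)) * (real i * geg_moment (a + 1) (i - 1 + e))
       = (2 * a + 1 + real e) * geg_moment a (Suc (i + e)) - real e * geg_moment a (i + e - 1)"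
proof (cases "i + e")
  case 0
  then show ?thesis by (simp add: geg_moment_odd)
next
  case (Suc K)
  define M where "M = geg_moment a K"
  define D where "D = a + 1 + real K / 2"
  have pos: "D > 0" "a + 1 > 0" using assms by (auto simp: D_def add_pos_nonneg)
  have K: "real K = real i + real e - 1" using Suc by linarith
  have up: "geg_moment a (Suc (i + e)) = (real K + 1) / 2 * M / D"
    using geg_moment_Suc_Suc[of a K, folded D_def M_def] assms pos by (simp add: Suc eq_divide_eq mult_ac)
  have prev: "geg_moment a (i + e - 1) = M" by (simp add: Suc M_def)
  have low: "real i * geg_moment (a + 1) (i - 1 + e) = real i * ((a + 1) * M / D)"
  proof (cases i)
    case (Suc i')
    then have "i - 1 + e = K" using \<open>i + e = Suc K\<close> by simp
    then show ?thesis
      using geg_moment_shift[of a K, folded D_def M_def] assms pos by (simp add: eq_divide_eq mult_ac)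
  qed simp
  have alg: "(2 * a + 1) / (2 * A) * (x * (A * M / D)) = (2 * a + 1 + e') * ((x + e' - 1 + 1) / 2 * M / D) - e' * M"
    if "D = a + 1 + (x + e' - 1) / 2" "D > 0" "A > 0" for x e' D A :: real
  proof -
    have "(2 * a + 1) * x * M / (2 * D) = ((2 * a + 1 + e') * (x + e') * M - 2 * D * (e' * M)) / (2 * D)"
    proof -
      have "(2 * a + 1) * x * M = (2 * a + 1 + e') * (x + e') * M - 2 * D * (e' * M)"
        unfolding that(1) by (simp add: field_simps)
      then show ?thesis by simp
    qed
    then show ?thesis using that(2,3) by (simp add: diff_divide_distrib)
  qed
  show ?thesis
    unfolding up prev low K by (rule alg) (use pos in \<open>simp_all add: D_def K\<close>)
qed

text \<open>The density of the measure with parameter \<open>a + 1\<close> has the extra factor \<open>1 - \<zeta>\<^sup>2\<close>, which vanishes at \<open>1\<close>.\<close>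

lemma geg_represents_shift:
  assumes "geg_represents (a + 1) j c s" "a > -1/2"
  shows "geg_represents a (Suc (Suc j)) 0 s"
proof -
  \<comment> \<open>\<open>1 / K\<close> is the mean of 1 - \<zeta>^2 for the parameter
    \<open>a\<close>, so \<open>K\<close> normalises the density with the extra factor.\<close>
  define K where "K = (a + 1) / (a + 1/2)"
  have "geg_represents a (Suc (Suc j)) 0 (\<lambda>i. geg_moment (a + 1) (i + (j - 2 * l)))" if "2 * l \<le> j" for l
  proof -
    have shift: "geg_moment (a + 1) k = K * (geg_moment a k + (- 1) * geg_moment a (Suc (Suc k)))" for k
    proof -
      define D where "D = a + 1 + real k / 2"
      have D: "D > 0" using assms(2) by (simp add: D_def add_pos_nonneg)
      have 1: "D * geg_moment a (Suc (Suc k)) = (D - (a + 1/2)) * geg_moment a k"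
        using geg_moment_Suc_Suc[of a k] assms(2) by (simp add: D_def algebra_simps)
      have 2: "D * geg_moment (a + 1) k = (a + 1) * geg_moment a k"
        using geg_moment_shift[of a k] assms(2) by (simp add: D_def)
      have "D * (K * (geg_moment a k + (- 1) * geg_moment a (Suc (Suc k))))
          = K * (D * geg_moment a k - D * geg_moment a (Suc (Suc k)))"
        by (simp add: algebra_simps)
      also have "\<dots> = K * (a + 1/2) * geg_moment a k"
        unfolding 1 by (simp add: algebra_simps)
      also have "\<dots> = D * geg_moment (a + 1) k"
        unfolding 2 using assms(2) by (simp add: K_def)
      finally show ?thesis using D by simp
    qed
    have "geg_represents a (Suc (Suc j)) (K * (1 + (- 1) * 1))
       (\<lambda>i. K * (geg_moment a (i + (Suc (Suc j) - 2 * Suc l)) + (- 1) * geg_moment a (i + (Suc (Suc j) - 2 * l))))"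
      using that by (intro geg_represents_scale geg_represents_add geg_represents_moment) auto
    moreover have "i + (Suc (Suc j) - 2 * Suc l) = i + (j - 2 * l)"
        "i + (Suc (Suc j) - 2 * l) = Suc (Suc (i + (j - 2 * l)))" for i
      using that by auto
    ultimately show ?thesis by (simp only: shift) simp
  qed
  then show ?thesis
    using geg_represents_lift[OF assms(1), where K = "\<lambda>i. {i}" and w = "\<lambda>_ _. 1" and r = 0
        and a' = a and j' = "Suc (Suc j)"] by simp
qed

text \<open>\<open>real i * s (i - 1)\<close> pairs q with the derivative of \<zeta>^i at parameter
  a + 1. Moving the derivative over yields (2a+1) \<zeta> q - (1 - \<zeta>^2) q' at parameter a: one
  degree more, opposite parity, and value (2a+1) c at 1, where 1 - \<zeta>^2 vanishes.\<close>

lemma geg_represents_by_parts: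
  assumes s: "geg_represents (a + 1) j c s" and a: "a > -1/2"
  shows "geg_represents a (Suc j) ((2 * a + 1) * c) (\<lambda>i. (2 * a + 1) / (2 * (a + 1)) * (real i * s (i - 1)))"
proof -
  define w where "w i = (2 * a + 1) / (2 * (a + 1)) * real i" for i
  have "geg_represents a (Suc j) (2 * a + 1) (\<lambda>i. w i * geg_moment (a + 1) (i - 1 + (j - 2 * l)))"
    if "2 * l \<le> j" for l
  proof -
    define e where "e = j - 2 * l"
    have up: "geg_represents a (Suc j) ((2 * a + 1 + real e) * 1) (\<lambda>i. (2 * a + 1 + real e) * geg_moment a (Suc (i + e)))"
      using geg_represents_scale[OF geg_represents_moment[of l "Suc j" a]] that
      by (simp add: e_def Suc_diff_le)
    \<comment> \<open>For e = 0 the coefficient is zero, so the truncated exponent is harmless; for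
      e > 0 this is the basis power with index l + 1.\<close>
    have low: "geg_represents a (Suc j) (- real e * 1) (\<lambda>i. - real e * geg_moment a (i + e - 1))"
    proof (cases "e = 0")
      case True
      then show ?thesis
        using geg_represents_scale[OF geg_represents_moment[of l "Suc j" a], of 0] that by simp
    next
      case False
      then have "2 * Suc l \<le> Suc j" "i + e - 1 = i + (Suc j - 2 * Suc l)" for i
        using that by (auto simp: e_def)
      then show ?thesis
        using geg_represents_scale[OF geg_represents_moment[of "Suc l" "Suc j" a], of "- real e"]
        by simp
    qed
    have "w i * geg_moment (a + 1) (i - 1 + e)
        = (2 * a + 1 + real e) * geg_moment a (Suc (i + e)) + - real e * geg_moment a (i + e - 1)" for i
      using geg_moment_by_parts[OF a, of i e] by (simp add: w_def)
    then show ?thesis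
      using geg_represents_add[OF up low] by (simp flip: e_def)
  qed
  then show ?thesis
    using geg_represents_lift[OF s, where K = "\<lambda>i. {i - 1}" and w = "\<lambda>i _. w i" and r = "2 * a + 1"
        and a' = a and j' = "Suc j"] by (simp add: w_def mult.assoc)
qed

text \<open>The effect on moments of averaging \<open>f((1-z\<^sub>1)/2 x + (1+z\<^sub>1)/2 z\<^sub>2)\<close> over \<open>z\<^sub>1, z\<^sub>2\<close>.\<close>

definition z_transform :: "real \<Rightarrow> real \<Rightarrow> (nat \<Rightarrow> real) \<Rightarrow> nat \<Rightarrow> real" where
  "z_transform a b s i = (\<Sum>k\<le>i. real (i choose k) * (pochhammer (a + 1) k * pochhammer b (i - k)
     / pochhammer (a + b + 1) i) * geg_moment b (i - k) * s k)"

section \<open>The z-average on moment sequences\<close>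

lemma z_transform_add: "z_transform a b (\<lambda>k. s k + s' k) i = z_transform a b s i + z_transform a b s' i"
  by (simp add: z_transform_def distrib_left sum.distrib)

lemma z_transform_scale: "z_transform a b (\<lambda>k. r * s k) i = r * z_transform a b s i"
  by (simp add: z_transform_def sum_distrib_left mult_ac)

text \<open>The chain rule: differentiating the averaged function releases a factor (1 - z1)/2,
  which raises the exponent of 1 - z1 from a to a + 1. Its mean (a + 1) / (a + b + 1) compensates
  the change of normalisation.\<close>

lemma z_transform_derivative:
  assumes "a \<ge> 0" "b \<ge> 0"
  shows "z_transform a b (\<lambda>k. real k * s (k - 1)) i
       = (a + 1) / (a + b + 1) * (real i * z_transform (a + 1) b s (i - 1))"
proof (cases i)
  case 0
  then show ?thesis by (simp add: z_transform_def)
next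
  case (Suc n)
  have "z_transform a b (\<lambda>k. real k * s (k - 1)) i
      = (\<Sum>k\<le>n. real (Suc n choose Suc k) * (pochhammer (a + 1) (Suc k) * pochhammer b (n - k)
          / pochhammer (a + b + 1) (Suc n)) * geg_moment b (n - k) * (real (Suc k) * s k))"
    unfolding z_transform_def Suc by (subst sum.atMost_Suc_shift) simp
  also have "\<dots> = (\<Sum>k\<le>n. (a + 1) / (a + b + 1) * (real i *
       (real (n choose k) * (pochhammer (a + 1 + 1) k * pochhammer b (n - k)
          / pochhammer (a + 1 + b + 1) n) * geg_moment b (n - k) * s k)))"
  proof (rule sum.cong[OF refl])
    fix k
    have "real (Suc n choose Suc k) * real (Suc k) = real i * real (n choose k)"
      using Suc_times_binomial_eq[of n k] unfolding Suc by (metis of_nat_mult)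
    moreover have "A * B * C * (D * E) = (A * D) * B * C * E" for A B C D E :: real
      by (simp only: mult_ac)
    ultimately have "real (Suc n choose Suc k) * (pochhammer (a + 1) (Suc k) * pochhammer b (n - k)
          / pochhammer (a + b + 1) (Suc n)) * geg_moment b (n - k) * (real (Suc k) * s k)
        = real i * real (n choose k) * (pochhammer (a + 1) (Suc k) * pochhammer b (n - k)
          / pochhammer (a + b + 1) (Suc n)) * geg_moment b (n - k) * s k"
      by (simp only:)
    also have "\<dots> = (a + 1) / (a + b + 1) * (real i *
       (real (n choose k) * (pochhammer (a + 1 + 1) k * pochhammer b (n - k)
          / pochhammer (a + 1 + b + 1) n) * geg_moment b (n - k) * s k))"
      unfolding pochhammer_rec by (simp add: add_ac)
    finally show "real (Suc n choose Suc k) * (pochhammer (a + 1) (Suc k) * pochhammer b (n - k)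
          / pochhammer (a + b + 1) (Suc n)) * geg_moment b (n - k) * (real (Suc k) * s k) = \<dots>" .
  qed
  also have "\<dots> = (a + 1) / (a + b + 1) * (real i * z_transform (a + 1) b s (i - 1))"
    by (simp add: z_transform_def Suc sum_distrib_left)
  finally show ?thesis .
qed

text \<open>The adjoint of the z-average keeps degree, parity and the value at 1. Integration by
  parts writes the power j as a derivative term, which passes through the average to parameter a + 1
  and degree j - 1, plus a multiple of the power j - 2. The case j = 0 is the moment
  convolution.\<close>

lemma z_transform_geg_moment:
  assumes "a \<ge> 0" "b \<ge> 0"
  shows "geg_represents (a + b) j 1 (z_transform a b (\<lambda>k. geg_moment a (k + j)))"
  using assms(1)
proof (induction j arbitrary: a rule: less_induct)
  case (less j)
  show ?case
  proof (cases j)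
    case 0
    have "z_transform a b (geg_moment a) i = geg_moment (a + b) i" for i
    proof -
      have "pochhammer (a + b + 1) i > 0" using less.prems assms(2) by (intro pochhammer_pos) auto
      moreover have "z_transform a b (geg_moment a) i = (\<Sum>k\<le>i. real (i choose k) * pochhammer (a + 1) k
          * pochhammer b (i - k) * geg_moment b (i - k) * geg_moment a k) / pochhammer (a + b + 1) i"
        unfolding z_transform_def sum_divide_distrib by (intro sum.cong refl) simp
      ultimately show ?thesis
        using geg_moment_convolution[of a b i] less.prems assms(2) by simp
    qed
    then show ?thesis
      using geg_represents_moment[of 0 0 "a + b"] by (simp add: 0)
  next
    case (Suc n)
    define s where "s = (\<lambda>k. geg_moment (a + 1) (k + n))"
    \<comment> \<open>The coefficient of the top moment in \<open>geg_moment_by_parts\<close> with e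
      = n.\<close>
    define N where "N = 2 * a + 1 + real n"
    have N: "N > 0" using less.prems by (simp add: N_def)
    have "geg_represents (a + b + 1) n 1 (z_transform (a + 1) b s)"
      using less.IH[of n "a + 1"] less.prems Suc by (simp add: s_def add_ac)
    then have "geg_represents (a + b) j ((2 * (a + b) + 1) * 1)
        (\<lambda>i. (2 * (a + b) + 1) / (2 * (a + b + 1)) * (real i * z_transform (a + 1) b s (i - 1)))"
      using less.prems assms(2) unfolding Suc by (intro geg_represents_by_parts) auto
    \<comment> \<open>The step back to parameter a + b brought the factor 2(a + b) + 1; it is
      rescaled to the share (2a + 1) / N, which the share n / N of the lower power completes to the
      value 1.\<close>
    from geg_represents_scale[OF this, of "(2 * a + 1) / (2 * (a + b) + 1) / N"]
    have "geg_represents (a + b) j ((2 * a + 1) / N)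
        (\<lambda>i. (2 * a + 1) / N / (2 * (a + b + 1)) * (real i * z_transform (a + 1) b s (i - 1)))"
      using less.prems assms(2) by simp
    moreover have "(2 * a + 1) / N / (2 * (a + b + 1)) * (real i * z_transform (a + 1) b s (i - 1))
       = (2 * a + 1) / (2 * (a + 1)) / N * z_transform a b (\<lambda>k. real k * s (k - 1)) i" for i
    proof -
      have "x / N / (2 * D) * y = x / (2 * A) / N * (A / D * y)" if "A > 0" for x y A D
        using that by simp
      from this[of "a + 1"] show ?thesis
        unfolding z_transform_derivative[OF less.prems assms(2)] using less.prems by (simp only:)
    qed
    ultimately have 1: "geg_represents (a + b) j ((2 * a + 1) / N)
        (\<lambda>i. (2 * a + 1) / (2 * (a + 1)) / N * z_transform a b (\<lambda>k. real k * s (k - 1)) i)"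
      by simp
    have 2: "geg_represents (a + b) j (real n / N * 1)
        (\<lambda>i. real n / N * z_transform a b (\<lambda>k. geg_moment a (k + n - 1)) i)"
    proof (cases n)
      case 0
      then show ?thesis using geg_represents_scale[OF geg_represents_moment[of 0 j "a + b"], of 0] by simp
    next
      case (Suc n')
      then have "geg_represents (a + b) (Suc (Suc n')) 1 (z_transform a b (\<lambda>k. geg_moment a (k + n')))"
        using less.IH[of n' a] less.prems \<open>j = Suc n\<close> by (intro geg_represents_Suc_Suc) auto
      then show ?thesis
        unfolding \<open>j = Suc n\<close> Suc by (intro geg_represents_scale) simp
    qed
    have expand: "geg_moment a (k + j) = (2 * a + 1) / (2 * (a + 1)) / N * (real k * s (k - 1)) + real n / N * geg_moment a (k + n - 1)" for k
    proof -
      have "(2 * a + 1) / (2 * (a + 1)) * (real k * s (k - 1)) = N * geg_moment a (k + j) - real n * geg_moment a (k + n - 1)"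
        using geg_moment_by_parts[of a k n] less.prems by (simp add: s_def N_def Suc)
      then have "N * geg_moment a (k + j) = (2 * a + 1) / (2 * (a + 1)) * (real k * s (k - 1)) + real n * geg_moment a (k + n - 1)"
        by simp
      then have "geg_moment a (k + j) = ((2 * a + 1) / (2 * (a + 1)) * (real k * s (k - 1)) + real n * geg_moment a (k + n - 1)) / N"
        using N by (simp add: eq_divide_eq mult.commute)
      moreover have "(C * X + r * Y) / N = C / N * X + r / N * Y" for C X r Y
        by (simp add: add_divide_distrib)
      ultimately show ?thesis by (simp only:)
    qed
    have "z_transform a b (\<lambda>k. geg_moment a (k + j))
        = (\<lambda>i. (2 * a + 1) / (2 * (a + 1)) / N * z_transform a b (\<lambda>k. real k * s (k - 1)) i
             + real n / N * z_transform a b (\<lambda>k. geg_moment a (k + n - 1)) i)"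
      by (rule ext) (simp only: expand z_transform_add z_transform_scale)
    moreover have "(2 * a + 1) / N + real n / N * 1 = 1"
      using N by (simp add: N_def flip: add_divide_distrib)
    ultimately show ?thesis
      using geg_represents_add[OF 1 2] by (simp only:)
  qed
qed

lemma geg_represents_z_transform:
  assumes s: "geg_represents a j c s" and ab: "a \<ge> 0" "b \<ge> 0"
  shows "geg_represents (a + b) j c (z_transform a b s)"
proof -
  have "geg_represents (a + b) j 1 (z_transform a b (\<lambda>k. geg_moment a (k + (j - 2 * l))))" if "2 * l \<le> j" for l
    using geg_represents_add_even[OF z_transform_geg_moment[OF ab, of "j - 2 * l"], of l] that by simp
  then show ?thesis
    using geg_represents_lift[OF s, where a' = "a + b" and j' = j and r = 1 and K = "\<lambda>i. {..i}"
       and w = "\<lambda>i k. real (i choose k) * (pochhammer (a + 1) k * pochhammer b (i - k)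
     / pochhammer (a + b + 1) i) * geg_moment b (i - k)"]
    by (simp add: z_transform_def[abs_def])
qed

section \<open>Polynomials and reproducing kernels\<close>

definition monomial :: "('b::euclidean_space \<Rightarrow> nat) \<Rightarrow> 'b \<Rightarrow> real" where
  "monomial k p = (\<Prod>b\<in>Basis. (p \<bullet> b) ^ k b)"

lemma poly_upto_iff: "f \<in> poly_upto n \<longleftrightarrow> (\<exists>c. f = (\<lambda>p. \<Sum>k\<in>multi_indices n. c k * monomial k p))"
  by (auto simp: poly_upto_def monomial_def fun_eq_iff)

lemma monomial_in_poly_upto: "k \<in> multi_indices n \<Longrightarrow> monomial k \<in> poly_upto n"
  unfolding poly_upto_iff
  by (intro exI[of _ "\<lambda>j. if j = k then 1 else 0"] ext)
    (simp add: finite_multi_indices if_distrib[of "\<lambda>x. x * _"] cong: if_cong)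

lemma poly_upto_add:
  assumes "f \<in> poly_upto n" "g \<in> poly_upto n" shows "(\<lambda>p. f p + g p) \<in> poly_upto n"
proof -
  obtain c d where "f = (\<lambda>p. \<Sum>k\<in>multi_indices n. c k * monomial k p)"
    "g = (\<lambda>p. \<Sum>k\<in>multi_indices n. d k * monomial k p)"
    using assms unfolding poly_upto_iff by blast
  then show ?thesis unfolding poly_upto_iff
    by (intro exI[of _ "\<lambda>k. c k + d k"]) (simp add: sum.distrib distrib_right)
qed

lemma poly_upto_scale:
  assumes "f \<in> poly_upto n" shows "(\<lambda>p. r * f p) \<in> poly_upto n"
proof -
  obtain c where "f = (\<lambda>p. \<Sum>k\<in>multi_indices n. c k * monomial k p)"
    using assms unfolding poly_upto_iff by blast
  then show ?thesis unfolding poly_upto_iff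
    by (intro exI[of _ "\<lambda>k. r * c k"]) (simp add: sum_distrib_left mult.assoc)
qed

lemma poly_upto_0: "(\<lambda>p. 0) \<in> poly_upto n"
  unfolding poly_upto_iff by (intro exI[of _ "\<lambda>_. 0"]) simp

lemma poly_upto_sum:
  "(\<And>i. i \<in> I \<Longrightarrow> f i \<in> poly_upto n) \<Longrightarrow> (\<lambda>p. \<Sum>i\<in>I. f i p) \<in> poly_upto n"
  by (induction I rule: infinite_finite_induct) (auto intro: poly_upto_add poly_upto_0)

lemma poly_upto_induct [consumes 1, case_names monomial zero add scale]:
  assumes f: "f \<in> poly_upto n"
    and mono: "\<And>k. k \<in> multi_indices n \<Longrightarrow> P (monomial k)" and zero: "P (\<lambda>p. 0)"
    and add: "\<And>f g. f \<in> poly_upto n \<Longrightarrow> g \<in> poly_upto n \<Longrightarrow> P f \<Longrightarrow> P g \<Longrightarrow> P (\<lambda>p. f p + g p)"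
    and scale: "\<And>f r. f \<in> poly_upto n \<Longrightarrow> P f \<Longrightarrow> P (\<lambda>p. r * f p)"
  shows "P f"
proof -
  obtain c where c: "f = (\<lambda>p. \<Sum>k\<in>multi_indices n. c k * monomial k p)"
    using f unfolding poly_upto_iff by blast
  have "P (\<lambda>p. \<Sum>k\<in>K. c k * monomial k p)" if "K \<subseteq> multi_indices n" for K
    using finite_subset[OF that finite_multi_indices] that
  proof (induction K rule: finite_induct)
    case (insert k K)
    have "P (\<lambda>p. c k * monomial k p + (\<Sum>k\<in>K. c k * monomial k p))"
      using insert by (intro add scale mono poly_upto_scale poly_upto_sum monomial_in_poly_upto) auto
    then show ?case using insert by simp
  qed (simp add: zero)
  then show ?thesis unfolding c by simp
qed

lemma poly_upto_mono: "f \<in> poly_upto m \<Longrightarrow> m \<le> n \<Longrightarrow> f \<in> poly_upto n"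
  by (induction rule: poly_upto_induct)
    (auto intro!: monomial_in_poly_upto poly_upto_add poly_upto_scale poly_upto_0 simp: multi_indices_def)

lemma monomial_mult: "monomial k p * monomial j p = monomial (\<lambda>b. k b + j b) p"
  by (simp add: monomial_def power_add prod.distrib)

lemma monomial_remove:
  "b \<in> Basis \<Longrightarrow> monomial k p = (p \<bullet> b) ^ k b * (\<Prod>c\<in>Basis - {b}. (p \<bullet> c) ^ k c)"
  unfolding monomial_def by (rule prod.remove) auto

lemma monomial_in_poly_upto_degree:
  "(monomial \<kappa> :: 'b::euclidean_space \<Rightarrow> real) \<in> poly_upto (\<Sum>b\<in>(Basis::'b set). \<kappa> b)"
proof -
  have "(monomial \<kappa> :: 'b \<Rightarrow> real) = monomial (\<lambda>b. if b \<in> Basis then \<kappa> b else 0)"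
    by (auto simp: monomial_def fun_eq_iff intro!: prod.cong)
  moreover have "monomial (\<lambda>b::'b. if b \<in> Basis then \<kappa> b else 0) \<in> poly_upto (\<Sum>b\<in>Basis. \<kappa> b)"
    by (rule monomial_in_poly_upto) (simp add: multi_indices_def)
  ultimately show ?thesis by simp
qed

lemma multi_indices_add:
  "k \<in> multi_indices m \<Longrightarrow> j \<in> multi_indices n \<Longrightarrow> (\<lambda>b. k b + j b) \<in> multi_indices (m + n)"
  by (auto simp: multi_indices_def sum.distrib)

lemma poly_upto_mult:
  assumes "f \<in> poly_upto m" "g \<in> poly_upto n" shows "(\<lambda>p. f p * g p) \<in> poly_upto (m + n)"
  using assms(1)
proof (induction rule: poly_upto_induct)
  case (monomial k)
  show ?case using assms(2)
  proof (induction rule: poly_upto_induct)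
    case (monomial j)
    then show ?case
      using monomial_in_poly_upto[OF multi_indices_add[OF \<open>k \<in> _\<close> monomial]]
      by (simp add: monomial_mult[abs_def])
  qed (auto simp: distrib_left mult.left_commute[of "monomial k _"] intro: poly_upto_add poly_upto_scale poly_upto_0)
qed (auto simp: distrib_right mult.assoc intro: poly_upto_add poly_upto_scale poly_upto_0)

lemma poly_upto_const: "(\<lambda>p. r) \<in> poly_upto n"
proof -
  have "monomial (\<lambda>_. 0) \<in> poly_upto n"
    by (rule monomial_in_poly_upto) (simp add: multi_indices_def)
  from poly_upto_scale[OF this, of r] show ?thesis by (simp add: monomial_def)
qed

lemma poly_upto_inner: "(\<lambda>p. p \<bullet> a) \<in> poly_upto 1"
proof -
  have "(\<lambda>p. (a \<bullet> b) * (p \<bullet> b)) \<in> poly_upto 1" if b: "b \<in> Basis" for b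
  proof -
    have "monomial (\<lambda>b'. if b' = b then 1 else 0) = (\<lambda>p. p \<bullet> b)"
      using b by (auto simp: monomial_def if_distrib[of "\<lambda>k. _ ^ k"] cong: if_cong)
    moreover have "monomial (\<lambda>b'. if b' = b then 1 else 0) \<in> poly_upto 1"
      using b by (intro monomial_in_poly_upto) (auto simp: multi_indices_def)
    ultimately have "(\<lambda>p. p \<bullet> b) \<in> poly_upto 1" by (simp only:)
    then show ?thesis by (rule poly_upto_scale)
  qed
  then have "(\<lambda>p. \<Sum>b\<in>Basis. (a \<bullet> b) * (p \<bullet> b)) \<in> poly_upto 1" by (rule poly_upto_sum)
  then show ?thesis by (subst euclidean_inner) (simp add: mult.commute)
qed

lemma poly_upto_power: "f \<in> poly_upto m \<Longrightarrow> (\<lambda>p. f p ^ k) \<in> poly_upto (k * m)"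
  by (induction k) (auto intro: poly_upto_mult poly_upto_const)

lemma poly_upto_line:
  assumes "f \<in> poly_upto n" shows "\<exists>q. \<forall>\<tau>. f (p + \<tau> *\<^sub>R v) = poly q \<tau>"
  using assms
proof (induction rule: poly_upto_induct)
  case (monomial k)
  have "monomial k (p + \<tau> *\<^sub>R v) = poly (\<Prod>b\<in>Basis. [:p \<bullet> b, v \<bullet> b:] ^ k b) \<tau>" for \<tau>
    by (simp add: monomial_def poly_prod inner_add_left mult.commute)
  then show ?case by blast
next
  case zero
  show ?case by (rule exI[of _ 0]) simp
next
  case (add f g)
  then show ?case by (metis poly_add)
next
  case (scale f r)
  then show ?case by (metis poly_smult)
qed

lemma poly_upto_continuous: "f \<in> poly_upto n \<Longrightarrow> continuous_on UNIV f"
  by (induction rule: poly_upto_induct) (auto simp: monomial_def[abs_def] intro!: continuous_intros)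

text \<open>On the line through \<open>p\<close> and \<open>q\<close> the function is a polynomial
  in one variable that vanishes at infinitely many parameters.\<close>

lemma poly_upto_zero_on_open:
  assumes f: "f \<in> poly_upto n" and S: "open S" "p \<in> S" and zero: "\<And>q. q \<in> S \<Longrightarrow> f q = 0"
  shows "f q = 0"
proof -
  obtain r where r: "\<And>\<tau>. f (p + \<tau> *\<^sub>R (q - p)) = poly r \<tau>"
    using poly_upto_line[OF f] by blast
  have "open ((\<lambda>\<tau>. p + \<tau> *\<^sub>R (q - p)) -` S)"
    by (intro open_vimage S continuous_intros)
  moreover have "0 \<in> (\<lambda>\<tau>. p + \<tau> *\<^sub>R (q - p)) -` S" using S by simp
  ultimately have "infinite ((\<lambda>\<tau>::real. p + \<tau> *\<^sub>R (q - p)) -` S)"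
    using finite_imp_not_open by blast
  moreover have "(\<lambda>\<tau>. p + \<tau> *\<^sub>R (q - p)) -` S \<subseteq> {\<tau>. poly r \<tau> = 0}"
    using zero by (auto simp flip: r)
  ultimately have "r = 0" using poly_roots_finite[of r] finite_subset by blast
  then show ?thesis using r[of 1] by simp
qed

section \<open>Orthonormal bases and the reproducing kernel of a definite weight\<close>

locale poly_inner =
  fixes D :: "'b::euclidean_space set" and w :: "'b \<Rightarrow> real"
  assumes integrable: "\<And>n f g. f \<in> poly_upto n \<Longrightarrow> g \<in> poly_upto n \<Longrightarrow>
      set_integrable lborel D (\<lambda>p. f p * g p * w p)"
    and pos: "\<And>n f. f \<in> poly_upto n \<Longrightarrow> weighted_inner D w f f \<ge> 0"
    and definite: "\<And>n f p. f \<in> poly_upto n \<Longrightarrow> weighted_inner D w f f = 0 \<Longrightarrow> f p = 0"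
begin

abbreviation inn where "inn \<equiv> weighted_inner D w"

lemma inn_add_left:
  assumes "f \<in> poly_upto n" "g \<in> poly_upto n" "h \<in> poly_upto n"
  shows "inn (\<lambda>p. f p + g p) h = inn f h + inn g h"
proof -
  have "(LINT p:D|lborel. (f p + g p) * h p * w p) = (LINT p:D|lborel. f p * h p * w p + g p * h p * w p)"
    by (simp add: algebra_simps)
  also have "\<dots> = (LINT p:D|lborel. f p * h p * w p) + (LINT p:D|lborel. g p * h p * w p)"
    using assms by (intro set_integral_add integrable[where n = n])
  finally show ?thesis by (simp add: weighted_inner_def distrib_left)
qed

lemma inn_scale_left: "inn (\<lambda>p. r * f p) h = r * inn f h"
  by (simp add: weighted_inner_def mult.assoc)

lemma inn_sum_left:
  assumes "\<And>i. i \<in> I \<Longrightarrow> f i \<in> poly_upto n" "h \<in> poly_upto n"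
  shows "inn (\<lambda>p. \<Sum>i\<in>I. f i p) h = (\<Sum>i\<in>I. inn (f i) h)"
  using assms
proof (induction I rule: infinite_finite_induct)
  case (insert x F)
  then show ?case by (simp add: inn_add_left[where n = n] poly_upto_sum)
qed (simp_all add: weighted_inner_def)

lemma inn_commute: "inn f g = inn g f"
  by (rule weighted_inner_commute)

definition orthonormal :: "('b \<Rightarrow> real) set \<Rightarrow> bool" where
  "orthonormal B \<longleftrightarrow> (\<forall>P\<in>B. \<forall>Q\<in>B. inn P Q = (if P = Q then 1 else 0))"

definition lin_span :: "('b \<Rightarrow> real) set \<Rightarrow> ('b \<Rightarrow> real) set" where
  "lin_span B = {f. \<exists>c. \<forall>p. f p = (\<Sum>Q\<in>B. c Q * Q p)}"

lemma lin_span_mono: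
  assumes "finite B'" "B \<subseteq> B'" "f \<in> lin_span B" shows "f \<in> lin_span B'"
proof -
  obtain c where c: "\<And>p. f p = (\<Sum>Q\<in>B. c Q * Q p)" using assms(3) unfolding lin_span_def by blast
  have "f p = (\<Sum>Q\<in>B'. (if Q \<in> B then c Q else 0) * Q p)" for p
    unfolding c using assms(1,2) by (intro sum.mono_neutral_cong_left) auto
  then show ?thesis unfolding lin_span_def by (intro CollectI exI allI)
qed

lemma poly_upto_projection:
  assumes "finite B" "B \<subseteq> poly_upto n" "orthonormal B" "f \<in> poly_upto n" "P \<in> B"
  shows "inn (\<lambda>p. f p + (- 1) * (\<Sum>Q\<in>B. inn f Q * Q p)) P = 0"
proof -
  have "inn (\<lambda>p. f p + (- 1) * (\<Sum>Q\<in>B. inn f Q * Q p)) P = inn f P + (- 1) * inn (\<lambda>p. \<Sum>Q\<in>B. inn f Q * Q p) P"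
    using assms by (subst inn_add_left[where n = n]) (auto simp only: inn_scale_left intro!: poly_upto_scale poly_upto_sum)
  also have "inn (\<lambda>p. \<Sum>Q\<in>B. inn f Q * Q p) P = (\<Sum>Q\<in>B. inn f Q * inn Q P)"
    using assms by (subst inn_sum_left[where n = n]) (auto simp: inn_scale_left intro!: poly_upto_scale)
  also have "\<dots> = (\<Sum>Q\<in>B. if Q = P then inn f P else 0)"
    using assms by (intro sum.cong) (auto simp: orthonormal_def)
  finally show ?thesis using assms by simp
qed

text \<open>The process starts from a given orthonormal set, so that a basis of the lower degrees
  can be kept when the degree is raised.\<close>

lemma gram_schmidt:
  assumes "finite B" "B \<subseteq> poly_upto n" "orthonormal B" "finite S" "S \<subseteq> poly_upto n"
  shows "\<exists>B'. finite B' \<and> B \<subseteq> B' \<and> B' \<subseteq> poly_upto n \<and> orthonormal B' \<and> S \<subseteq> lin_span B'"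
  using assms(4,5)
proof (induction S rule: finite_induct)
  case empty
  then show ?case using assms by blast
next
  case (insert f S)
  then obtain B' where B': "finite B'" "B \<subseteq> B'" "B' \<subseteq> poly_upto n" "orthonormal B'" "S \<subseteq> lin_span B'"
    by auto
  define g where "g = (\<lambda>p. f p + (- 1) * (\<Sum>Q\<in>B'. inn f Q * Q p))"
  have g: "g \<in> poly_upto n"
    unfolding g_def using B' insert.prems by (intro poly_upto_add poly_upto_scale poly_upto_sum) auto
  have gP: "inn g P = 0" if "P \<in> B'" for P
    unfolding g_def using B' insert.prems that by (intro poly_upto_projection) auto
  show ?case
  \<comment> \<open>A remainder of norm zero is the zero function by definiteness, so
    \<open>f\<close> is already in the span and nothing is added.\<close>
  proof (cases "inn g g = 0")
    case True
    then have "f p = (\<Sum>Q\<in>B'. inn f Q * Q p)" for p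
      using definite[OF g True, of p] by (simp add: g_def)
    then have "f \<in> lin_span B'" unfolding lin_span_def by blast
    then show ?thesis using B' by blast
  next
    case False
    then have gg: "inn g g > 0" using pos[OF g] by simp
    define r where "r = 1 / sqrt (inn g g)"
    define h where "h = (\<lambda>p. r * g p)"
    have h: "h \<in> poly_upto n" unfolding h_def by (intro poly_upto_scale g)
    have hP: "inn h P = 0" if "P \<in> B'" for P
      using gP[OF that] by (simp add: h_def inn_scale_left)
    have "inn h h = r * (r * inn g g)"
      unfolding h_def by (subst inn_scale_left, subst inn_commute, subst inn_scale_left) simp
    also have "\<dots> = 1" using gg by (simp add: r_def real_sqrt_mult_self field_simps)
    finally have hh: "inn h h = 1" .
    have notin: "h \<notin> B'" using hP[of h] hh by auto
    have "orthonormal (insert h B')"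
      unfolding orthonormal_def
    proof (intro ballI)
      fix P Q assume "P \<in> insert h B'" "Q \<in> insert h B'"
      moreover have "inn P h = 0" if "P \<in> B'" using hP[OF that] by (simp only: inn_commute[of P h])
      ultimately show "inn P Q = (if P = Q then 1 else 0)"
        using B'(4) hh hP[of Q] notin unfolding orthonormal_def by fastforce
    qed
    moreover have "f \<in> lin_span (insert h B')"
    proof -
      have "f p = (\<Sum>Q\<in>insert h B'. (if Q = h then sqrt (inn g g) else inn f Q) * Q p)" for p
      proof -
        have "(\<Sum>Q\<in>B'. (if Q = h then sqrt (inn g g) else inn f Q) * Q p) = (\<Sum>Q\<in>B'. inn f Q * Q p)"
          using notin by (intro sum.cong) auto
        moreover have "sqrt (inn g g) * h p = g p" using gg by (simp add: h_def r_def)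
        ultimately show ?thesis using notin B'(1) by (simp add: g_def)
      qed
      then show ?thesis unfolding lin_span_def by (intro CollectI exI allI)
    qed
    moreover have "S \<subseteq> lin_span (insert h B')"
      using B'(5) lin_span_mono[of "insert h B'" B'] B'(1) by auto
    ultimately show ?thesis
      using B' h by (intro exI[of _ "insert h B'"]) auto
  qed
qed

lemma lin_span_monomials: "f \<in> poly_upto n \<Longrightarrow> monomial ` multi_indices n \<subseteq> lin_span B \<Longrightarrow> f \<in> lin_span B"
proof (induction rule: poly_upto_induct)
  case zero
  show ?case unfolding lin_span_def by (auto intro: exI[of _ "\<lambda>_. 0"])
next
  case (add f g)
  then obtain c d where "\<And>p. f p = (\<Sum>Q\<in>B. c Q * Q p)" "\<And>p. g p = (\<Sum>Q\<in>B. d Q * Q p)"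
    unfolding lin_span_def by blast
  then show ?case unfolding lin_span_def
    by (intro CollectI exI[of _ "\<lambda>Q. c Q + d Q"]) (simp add: sum.distrib distrib_right)
next
  case (scale f r)
  then obtain c where "\<And>p. f p = (\<Sum>Q\<in>B. c Q * Q p)"
    unfolding lin_span_def by blast
  then show ?case unfolding lin_span_def
    by (intro CollectI exI[of _ "\<lambda>Q. r * c Q"]) (simp add: sum_distrib_left mult.assoc)
qed auto

text \<open>An orthonormal basis \<open>B0\<close> of the polynomials of degree below n is extended
  to degree n; the added elements are orthogonal to \<open>B0\<close>, hence to all lower degrees.
  For n = 0 there is no lower degree and \<open>B0\<close> is empty.\<close>

lemma orthonormal_basis_exists: "\<exists>B. orthonormal_basis D w n B"
proof -
  obtain B0 where B0: "finite B0" "B0 \<subseteq> poly_upto n" "orthonormal B0"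
    and below: "\<And>m f. m < n \<Longrightarrow> f \<in> poly_upto m \<Longrightarrow> f \<in> lin_span B0"
    and B0_below: "B0 \<subseteq> (if n = 0 then {} else poly_upto (n - 1))"
  proof (cases n)
    case 0
    then show ?thesis using that[of "{}"] by (simp add: orthonormal_def)
  next
    case (Suc m)
    have "\<exists>B'. finite B' \<and> {} \<subseteq> B' \<and> B' \<subseteq> poly_upto m \<and> orthonormal B' \<and> monomial ` multi_indices m \<subseteq> lin_span B'"
      by (intro gram_schmidt) (auto simp: orthonormal_def finite_multi_indices monomial_in_poly_upto)
    then obtain B' where B': "finite B'" "B' \<subseteq> poly_upto m" "orthonormal B'" "monomial ` multi_indices m \<subseteq> lin_span B'"
      by auto
    show ?thesis
    proof (rule that[OF B'(1) _ B'(3)])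
      show "B' \<subseteq> poly_upto n" using B'(2) Suc poly_upto_mono[of _ m n] by auto
      show "f \<in> lin_span B'" if "k < n" "f \<in> poly_upto k" for k f
        using lin_span_monomials[OF poly_upto_mono[of f k m] B'(4)] that Suc by simp
      show "B' \<subseteq> (if n = 0 then {} else poly_upto (n - 1))" using B'(2) Suc by simp
    qed
  qed
  have "\<exists>B'. finite B' \<and> B0 \<subseteq> B' \<and> B' \<subseteq> poly_upto n \<and> orthonormal B' \<and> monomial ` multi_indices n \<subseteq> lin_span B'"
    using B0 by (intro gram_schmidt) (auto simp: finite_multi_indices monomial_in_poly_upto)
  then obtain B' where B': "finite B'" "B0 \<subseteq> B'" "B' \<subseteq> poly_upto n" "orthonormal B'"
      "monomial ` multi_indices n \<subseteq> lin_span B'"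
    by auto
  have B0_Q: "inn P Q = 0" if "P \<in> B' - B0" "Q \<in> B0" for P Q
    using that B'(2,4) unfolding orthonormal_def by auto
  have "orthonormal_basis D w n (B' - B0)"
    unfolding orthonormal_basis_def
  proof (intro conjI ballI)
    show "finite (B' - B0)" using B' by simp
    show "B' - B0 \<subseteq> orth_polys D w n"
    proof
      fix P assume P: "P \<in> B' - B0"
      have "inn P g = 0" if g: "m < n" "g \<in> poly_upto m" for m g
      proof -
        obtain c where c: "\<And>p. g p = (\<Sum>Q\<in>B0. c Q * Q p)"
          using below[OF g] unfolding lin_span_def by blast
        then have g_eq: "g = (\<lambda>p. \<Sum>Q\<in>B0. c Q * Q p)" by auto
        have "inn g P = (\<Sum>Q\<in>B0. inn (\<lambda>p. c Q * Q p) P)"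
          unfolding g_eq using B0 B' P by (intro inn_sum_left[where n = n]) (auto intro: poly_upto_scale)
        also have "\<dots> = 0"
          using B0_Q[OF P] by (intro sum.neutral) (simp add: inn_scale_left inn_commute[of _ P])
        finally show ?thesis by (simp add: inn_commute)
      qed
      then show "P \<in> orth_polys D w n" using P B' unfolding orth_polys_def by auto
    qed
    show "inn P Q = (if P = Q then 1 else 0)" if "P \<in> B' - B0" "Q \<in> B' - B0" for P Q
      using that B'(4) unfolding orthonormal_def by auto
    fix f assume f: "f \<in> orth_polys D w n"
    then have fn: "f \<in> poly_upto n" unfolding orth_polys_def by auto
    obtain c where c: "\<And>p. f p = (\<Sum>Q\<in>B'. c Q * Q p)"
      using lin_span_monomials[OF fn B'(5)] unfolding lin_span_def by blast
    then have f_eq: "f = (\<lambda>p. \<Sum>Q\<in>B'. c Q * Q p)" by auto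
    \<comment> \<open>Elements of \<open>B0\<close> have degree at most n - 1 and are orthogonal to
      \<open>f\<close>, so only the new elements contribute.\<close>
    have "c P = 0" if P: "P \<in> B0" for P
    proof -
      have "inn f P = (\<Sum>Q\<in>B'. inn (\<lambda>p. c Q * Q p) P)"
        using B' P by (subst f_eq) (intro inn_sum_left[where n = n], auto intro: poly_upto_scale)
      also have "\<dots> = (\<Sum>Q\<in>B'. if Q = P then c P else 0)"
        using B' P by (intro sum.cong) (auto simp: orthonormal_def inn_scale_left)
      also have "\<dots> = c P" using B' P by auto
      finally have "inn f P = c P" .
      moreover have "inn f P = 0"
        using f P B0_below unfolding orth_polys_def by (cases "n = 0") (auto dest!: spec[of _ "n - 1"])
      ultimately show ?thesis by simp
    qed
    then have "f p = (\<Sum>Q\<in>B' - B0. c Q * Q p)" for p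
      unfolding c using B' by (intro sum.mono_neutral_right) auto
    then show "\<exists>c. \<forall>p. f p = (\<Sum>Q\<in>B' - B0. c Q * Q p)" by blast
  qed
  then show ?thesis by blast
qed

lemma orth_polys_sum:
  assumes "\<And>i. i \<in> I \<Longrightarrow> f i \<in> orth_polys D w n"
  shows "(\<lambda>p. \<Sum>i\<in>I. c i * f i p) \<in> orth_polys D w n"
proof -
  have sub: "f i \<in> poly_upto n" if "i \<in> I" for i using assms[OF that] by (simp add: orth_polys_def)
  have "inn (\<lambda>p. \<Sum>i\<in>I. c i * f i p) g = 0" if g: "m < n" "g \<in> poly_upto m" for m g
  proof -
    have "inn (\<lambda>p. \<Sum>i\<in>I. c i * f i p) g = (\<Sum>i\<in>I. inn (\<lambda>p. c i * f i p) g)"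
      using g by (intro inn_sum_left[where n = n] poly_upto_scale sub poly_upto_mono[of _ m n]) auto
    also have "\<dots> = 0"
      using assms g by (intro sum.neutral) (auto simp: inn_scale_left orth_polys_def)
    finally show ?thesis .
  qed
  then show ?thesis
    unfolding orth_polys_def using sub by (auto intro!: poly_upto_sum poly_upto_scale)
qed

lemma repro_kernel_in_orth_polys: "repro_kernel D w n p \<in> orth_polys D w n"
proof -
  obtain B where B: "orthonormal_basis D w n B" using orthonormal_basis_exists by blast
  have "repro_kernel D w n p = (\<lambda>q. \<Sum>P\<in>B. P p * P q)"
    by (intro ext repro_kernel_eq[OF integrable B])
  then show ?thesis using B orth_polys_sum[of B "\<lambda>P. P" n "\<lambda>P. P p"] by (auto simp: orthonormal_basis_def)
qed

lemma repro_kernel_reproduces: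
  assumes f: "f \<in> orth_polys D w n"
  shows "inn (repro_kernel D w n p) f = f p"
proof -
  obtain B where B: "orthonormal_basis D w n B" using orthonormal_basis_exists by blast
  have sub: "B \<subseteq> poly_upto n" using B by (auto simp: orthonormal_basis_def orth_polys_def)
  have fn: "f \<in> poly_upto n" using f by (simp add: orth_polys_def)
  have "repro_kernel D w n p = (\<lambda>q. \<Sum>P\<in>B. P p * P q)"
    by (intro ext repro_kernel_eq[OF integrable B])
  then have "inn (repro_kernel D w n p) f = (\<Sum>P\<in>B. inn (\<lambda>q. P p * P q) f)"
    using sub fn by (simp only:) (intro inn_sum_left[where n = n], auto intro: poly_upto_scale)
  also have "\<dots> = (\<Sum>P\<in>B. inn f P * P p)"
    by (intro sum.cong refl) (metis inn_scale_left inn_commute mult.commute)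
  also have "\<dots> = f p"
    by (rule orthonormal_expansion[OF integrable B f, symmetric])
  finally show ?thesis .
qed

text \<open>The point \<open>p\<close> is fixed, so a candidate for the kernel only has to be
  examined as a function of its second argument.\<close>

lemma repro_kernel_unique:
  assumes K: "K \<in> orth_polys D w n" and repr: "\<And>f. f \<in> orth_polys D w n \<Longrightarrow> inn K f = f p"
  shows "K q = repro_kernel D w n p q"
proof -
  obtain B where B: "orthonormal_basis D w n B" using orthonormal_basis_exists by blast
  have "K q = (\<Sum>Q\<in>B. inn K Q * Q q)"
    by (rule orthonormal_expansion[OF integrable B K])
  also have "\<dots> = (\<Sum>Q\<in>B. Q p * Q q)"
    using B by (intro sum.cong) (auto simp: repr orthonormal_basis_def)
  also have "\<dots> = repro_kernel D w n p q"
    by (rule repro_kernel_eq[OF integrable B, symmetric])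
  finally show ?thesis .
qed

end

section \<open>Gaussian integrals and integrals over the paraboloid\<close>

lemma borel_measurable_fst [measurable]:
  "(fst :: 'a::euclidean_space \<times> real \<Rightarrow> 'a) \<in> borel \<rightarrow>\<^sub>M borel"
  by (intro borel_measurable_continuous_onI continuous_intros)

lemma borel_measurable_snd [measurable]:
  "(snd :: 'a::euclidean_space \<times> real \<Rightarrow> real) \<in> borel \<rightarrow>\<^sub>M borel"
  by (intro borel_measurable_continuous_onI continuous_intros)

text \<open>Restricting to r > 0 makes the positive and negative parts of a homogeneous function
  homogeneous of the same degree.\<close>

definition homogeneous :: "nat \<Rightarrow> ('a::real_vector \<Rightarrow> real) \<Rightarrow> bool" where
  "homogeneous m p \<longleftrightarrow> (\<forall>r>0. \<forall>y. p (r *\<^sub>R y) = r ^ m * p y)"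

text \<open>The ratio of the weighted ball integral to the Gaussian integral of a homogeneous
  function; k is its degree plus the dimension.\<close>

abbreviation ball_const :: "real \<Rightarrow> nat \<Rightarrow> real" where
  "ball_const \<nu> k \<equiv> Gamma (\<nu> + 1/2) / Gamma (\<nu> + 1/2 + real k / 2)"

abbreviation gaussian :: "'a::real_normed_vector \<Rightarrow> real" where
  "gaussian y \<equiv> exp (- (norm y)\<^sup>2)"

definition ball_weight :: "real \<Rightarrow> real \<Rightarrow> 'a::real_normed_vector \<Rightarrow> real" where
  "ball_weight \<nu> s y = indicator {..s} ((norm y)\<^sup>2) * (s - (norm y)\<^sup>2) powr (\<nu> - 1/2)"

lemma ball_weight_nonneg: "ball_weight \<nu> s y \<ge> 0"
  by (simp add: ball_weight_def)

lemma ball_weight_measurable [measurable]: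
  assumes [measurable]: "f \<in> borel_measurable M" "g \<in> M \<rightarrow>\<^sub>M borel"
  shows "(\<lambda>x. ball_weight \<nu> (f x) (g x :: 'a::euclidean_space)) \<in> borel_measurable M"
proof -
  have "(\<lambda>x. ball_weight \<nu> (f x) (g x)) = (\<lambda>x. (if (norm (g x))\<^sup>2 \<le> f x then 1 else 0) * (f x - (norm (g x))\<^sup>2) powr (\<nu> - 1/2))"
    by (auto simp: ball_weight_def fun_eq_iff)
  also have "\<dots> \<in> borel_measurable M" by measurable
  finally show ?thesis .
qed

lemma nn_integral_lborel_scale:
  fixes f :: "'a::euclidean_space \<Rightarrow> ennreal"
  assumes [measurable]: "f \<in> borel_measurable borel" and c: "c > 0"
  shows "(\<integral>\<^sup>+y. f y \<partial>lborel) = ennreal (c ^ DIM('a)) * (\<integral>\<^sup>+y. f (c *\<^sub>R y) \<partial>lborel)"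
proof -
  have "(\<integral>\<^sup>+y. f y \<partial>lborel) = (\<integral>\<^sup>+y. f y \<partial>density (distr lborel borel (\<lambda>y::'a. 0 + c *\<^sub>R y)) (\<lambda>_. ennreal (\<bar>c\<bar> ^ DIM('a))))"
    using c lborel_affine[of c "0::'a"] by (simp add: ennreal_power)
  also have "\<dots> = ennreal (c ^ DIM('a)) * (\<integral>\<^sup>+y. f (c *\<^sub>R y) \<partial>lborel)"
    using c by (simp add: nn_integral_density nn_integral_distr nn_integral_cmult)
  finally show ?thesis .
qed

lemma nn_integral_ball_weight_scale:
  fixes p :: "'a::euclidean_space \<Rightarrow> real"
  assumes p: "homogeneous m p" "\<And>y. p y \<ge> 0" and [measurable]: "p \<in> borel_measurable borel" and s: "s > 0"
  shows "(\<integral>\<^sup>+y. ennreal (p y * ball_weight \<nu> s y) \<partial>lborel)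
       = ennreal (s powr (\<nu> - 1/2 + real (m + DIM('a)) / 2)) * (\<integral>\<^sup>+y. ennreal (p y * ball_weight \<nu> 1 y) \<partial>lborel)"
proof -
  define c where "c = sqrt s"
  have c: "c > 0" "c\<^sup>2 = s" using s by (auto simp: c_def)
  have pow: "c ^ k = s powr (real k / 2)" for k
    using s by (simp add: c_def powr_half_sqrt[symmetric] powr_powr powr_realpow[symmetric])
  have bw: "ball_weight \<nu> s (c *\<^sub>R y) = s powr (\<nu> - 1/2) * ball_weight \<nu> 1 y" for y :: 'a
  proof -
    have n: "(norm (c *\<^sub>R y))\<^sup>2 = s * (norm y)\<^sup>2" using c by (simp add: power_mult_distrib)
    have "s * (norm y)\<^sup>2 \<le> s \<longleftrightarrow> (norm y)\<^sup>2 \<le> 1" using s by simp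
    moreover have "s - s * (norm y)\<^sup>2 = s * (1 - (norm y)\<^sup>2)" by (simp add: algebra_simps)
    ultimately show ?thesis
      using s unfolding ball_weight_def n by (auto simp: powr_mult indicator_def)
  qed
  have "(\<integral>\<^sup>+y. ennreal (p y * ball_weight \<nu> s y) \<partial>lborel)
     = ennreal (c ^ DIM('a)) * (\<integral>\<^sup>+y. ennreal (p (c *\<^sub>R y) * ball_weight \<nu> s (c *\<^sub>R y)) \<partial>lborel)"
    using c by (intro nn_integral_lborel_scale) auto
  also have "(\<lambda>y. ennreal (p (c *\<^sub>R y) * ball_weight \<nu> s (c *\<^sub>R y)))
     = (\<lambda>y. ennreal (c ^ m * s powr (\<nu> - 1/2)) * ennreal (p y * ball_weight \<nu> 1 y))"
    using p c by (auto simp: homogeneous_def bw fun_eq_iff mult_ac ball_weight_nonneg simp flip: ennreal_mult)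
  also have "ennreal (c ^ DIM('a)) * (\<integral>\<^sup>+y. ennreal (c ^ m * s powr (\<nu> - 1/2)) * ennreal (p y * ball_weight \<nu> 1 y) \<partial>lborel)
     = ennreal (c ^ DIM('a) * (c ^ m * s powr (\<nu> - 1/2))) * (\<integral>\<^sup>+y. ennreal (p y * ball_weight \<nu> 1 y) \<partial>lborel)"
    using c s by (simp add: nn_integral_cmult ennreal_mult mult.assoc)
  also have "c ^ DIM('a) * (c ^ m * s powr (\<nu> - 1/2)) = s powr (\<nu> - 1/2 + real (m + DIM('a)) / 2)"
    by (simp add: pow add_divide_distrib mult_ac flip: powr_add) (simp add: algebra_simps)
  finally show ?thesis .
qed

lemma nn_integral_paraboloid:
  fixes p :: "'a::euclidean_space \<Rightarrow> real" and \<phi> :: "real \<Rightarrow> real"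
  assumes p: "homogeneous m p" "\<And>y. p y \<ge> 0" and [measurable]: "p \<in> borel_measurable borel" "\<phi> \<in> borel_measurable borel"
    and \<phi>: "\<And>s. \<phi> s \<ge> 0"
  shows "(\<integral>\<^sup>+q. ennreal (p (fst q) * ball_weight \<nu> (snd q) (fst q) * \<phi> (snd q)) \<partial>lborel)
    = (\<integral>\<^sup>+s. ennreal (indicator {0<..} s * s powr (\<nu> - 1/2 + real (m + DIM('a)) / 2) * \<phi> s) \<partial>lborel)
      * (\<integral>\<^sup>+y. ennreal (p y * ball_weight \<nu> 1 y) \<partial>lborel)"
proof -
  define M where "M = (\<integral>\<^sup>+y. ennreal (p y * ball_weight \<nu> 1 y) \<partial>lborel)"
  have "(\<integral>\<^sup>+q. ennreal (p (fst q) * ball_weight \<nu> (snd q) (fst q) * \<phi> (snd q)) \<partial>lborel)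
      = (\<integral>\<^sup>+s. \<integral>\<^sup>+y. ennreal (p y * ball_weight \<nu> s y * \<phi> s) \<partial>lborel \<partial>lborel)"
    unfolding lborel_prod[symmetric] by (subst lborel_pair.nn_integral_snd[symmetric]) simp_all
  also have "\<dots> = (\<integral>\<^sup>+s. ennreal (indicator {0<..} s * s powr (\<nu> - 1/2 + real (m + DIM('a)) / 2) * \<phi> s) * M \<partial>lborel)"
  proof (rule nn_integral_cong_AE)
    show "AE s in lborel. (\<integral>\<^sup>+y. ennreal (p y * ball_weight \<nu> s y * \<phi> s) \<partial>lborel)
        = ennreal (indicator {0<..} s * s powr (\<nu> - 1/2 + real (m + DIM('a)) / 2) * \<phi> s) * M"
      using AE_lborel_singleton[of "0::real"]
    proof eventually_elim
      case (elim s)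
      show ?case
      proof (cases "s > 0")
        case True
        have "(\<integral>\<^sup>+y. ennreal (p y * ball_weight \<nu> s y * \<phi> s) \<partial>lborel)
            = (\<integral>\<^sup>+y. ennreal (p y * ball_weight \<nu> s y) * ennreal (\<phi> s) \<partial>lborel)"
          using \<phi> p by (simp add: ennreal_mult ball_weight_nonneg)
        also have "\<dots> = (\<integral>\<^sup>+y. ennreal (p y * ball_weight \<nu> s y) \<partial>lborel) * ennreal (\<phi> s)"
          by (rule nn_integral_multc) simp
        finally show ?thesis
          using True \<phi> p nn_integral_ball_weight_scale[OF p(1,2) _ True, of \<nu>]
          by (simp add: M_def ennreal_mult mult_ac)
      next
        case False
        \<comment> \<open>For s < 0 the ball is empty; s = 0 has been discarded as a null
          set.\<close>
        have "ball_weight \<nu> s y = 0" for y :: 'a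
        proof -
          have "\<not> (norm y)\<^sup>2 \<le> s" using False elim zero_le_power2[of "norm y"] by linarith
          then show ?thesis by (simp add: ball_weight_def)
        qed
        then show ?thesis using False by simp
      qed
    qed
  qed
  also have "\<dots> = (\<integral>\<^sup>+s. ennreal (indicator {0<..} s * s powr (\<nu> - 1/2 + real (m + DIM('a)) / 2) * \<phi> s) \<partial>lborel) * M"
    by (rule nn_integral_multc) simp
  finally show ?thesis unfolding M_def .
qed

lemma nn_integral_Gamma:
  assumes "z > 0"
  shows "(\<integral>\<^sup>+s. ennreal (indicator {0<..} s * s powr (z - 1) * exp (- s)) \<partial>lborel) = ennreal (Gamma z)"
proof -
  have "(\<integral>\<^sup>+s. ennreal (indicator {0<..} s * s powr (z - 1) * exp (- s)) \<partial>lborel)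
      = (\<integral>\<^sup>+s. ennreal (indicator {0..} s * s powr (z - 1) / exp s) \<partial>lborel)"
    using AE_lborel_singleton[of "0::real"]
    by (intro nn_integral_cong_AE, eventually_elim) (auto simp: indicator_def exp_minus divide_inverse)
  then show ?thesis using Gamma_conv_nn_integral_real[OF assms] by simp
qed

text \<open>Integrate \<open>p(y) (s - \<parallel>y\<parallel>\<^sup>2)\<^bsup>\<nu> - 1/2\<^esup> e\<^bsup>-s\<^esup>\<close> in both orders: over \<open>s\<close> first, the substitution
  \<open>s = \<parallel>y\<parallel>\<^sup>2 + v\<close> splits off a Gaussian; over \<open>y\<close> first, homogeneity reduces to the unit ball.\<close>

lemma nn_integral_ball_weight:
  fixes p :: "'a::euclidean_space \<Rightarrow> real"
  assumes p: "homogeneous m p" "\<And>y. p y \<ge> 0" and [measurable]: "p \<in> borel_measurable borel" and \<nu>: "\<nu> > -1/2"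
    and g: "(\<integral>\<^sup>+y. ennreal (p y * gaussian y) \<partial>lborel) = ennreal g" "g \<ge> 0"
  shows "(\<integral>\<^sup>+y. ennreal (p y * ball_weight \<nu> 1 y) \<partial>lborel)
       = ennreal (ball_const \<nu> (m + DIM('a)) * g)"
proof -
  define M where "M = (\<integral>\<^sup>+y. ennreal (p y * ball_weight \<nu> 1 y) \<partial>lborel)"
  define z where "z = \<nu> + 1/2 + real (m + DIM('a)) / 2"
  have z: "z > 0" using \<nu> by (simp add: z_def add_pos_nonneg)
  have exponent: "\<nu> - 1/2 + real (m + DIM('a)) / 2 = z - 1" by (simp add: z_def)
  have inner: "(\<integral>\<^sup>+s. ennreal (p y * ball_weight \<nu> s y * exp (- s)) \<partial>lborel)
      = ennreal (p y * gaussian y) * ennreal (Gamma (\<nu> + 1/2))" for y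
  proof -
    have "(\<integral>\<^sup>+s. ennreal (p y * ball_weight \<nu> s y * exp (- s)) \<partial>lborel)
        = (\<integral>\<^sup>+v. ennreal (p y * ball_weight \<nu> ((norm y)\<^sup>2 + 1 * v) y * exp (- ((norm y)\<^sup>2 + 1 * v))) \<partial>lborel)"
      by (subst nn_integral_real_affine[where c = 1 and t = "(norm y)\<^sup>2"]) simp_all
    also have "\<dots> = (\<integral>\<^sup>+v. ennreal (p y * gaussian y) *
          ennreal (indicator {0<..} v * v powr (\<nu> + 1/2 - 1) * exp (- v)) \<partial>lborel)"
      using AE_lborel_singleton[of "0::real"]
    proof (intro nn_integral_cong_AE, eventually_elim)
      case (elim v)
      have "p y * ball_weight \<nu> ((norm y)\<^sup>2 + 1 * v) y * exp (- ((norm y)\<^sup>2 + 1 * v))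
         = (p y * gaussian y) * (indicator {0<..} v * v powr (\<nu> + 1/2 - 1) * exp (- v))"
        using elim by (auto simp: ball_weight_def indicator_def exp_add[symmetric])
      then show ?case using p by (simp only:) (rule ennreal_mult, simp_all)
    qed
    also have "\<dots> = ennreal (p y * gaussian y) * ennreal (Gamma (\<nu> + 1/2))"
    proof -
      have "\<nu> + 1/2 > 0" using \<nu> by simp
      from nn_integral_Gamma[OF this] show ?thesis
        by (subst nn_integral_cmult) (simp, simp only:)
    qed
    finally show ?thesis .
  qed
  have "ennreal (Gamma z) * M = (\<integral>\<^sup>+q. ennreal (p (fst q) * ball_weight \<nu> (snd q) (fst q) * exp (- snd q)) \<partial>lborel)"
    using nn_integral_paraboloid[OF p, of "\<lambda>s. exp (- s)" \<nu>, unfolded exponent nn_integral_Gamma[OF z]]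
    by (simp add: M_def)
  also have "\<dots> = (\<integral>\<^sup>+y. \<integral>\<^sup>+s. ennreal (p y * ball_weight \<nu> s y * exp (- s)) \<partial>lborel \<partial>lborel)"
    unfolding lborel_prod[symmetric] by (subst lborel.nn_integral_fst[symmetric]) simp_all
  also have "\<dots> = ennreal (Gamma (\<nu> + 1/2) * g)"
    unfolding inner using g by (subst nn_integral_multc) (simp, simp only: ennreal_mult'[of g] mult.commute[of _ g])
  finally have eq: "ennreal (Gamma z) * M = ennreal (Gamma (\<nu> + 1/2) * g)" .
  have "M = ennreal (1 / Gamma z) * (ennreal (Gamma z) * M)"
    using Gamma_real_pos[OF z] by (simp add: mult.assoc[symmetric] flip: ennreal_mult)
  also have "\<dots> = ennreal (Gamma (\<nu> + 1/2) / Gamma z * g)"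
  proof -
    have "\<nu> + 1/2 > 0" using \<nu> by simp
    then have "Gamma (\<nu> + 1/2) * g \<ge> 0" "1 / Gamma z \<ge> 0"
      using g Gamma_real_pos[OF z] Gamma_real_pos[of "\<nu> + 1/2"] by auto
    then have "ennreal (1 / Gamma z) * ennreal (Gamma (\<nu> + 1/2) * g) = ennreal (1 / Gamma z * (Gamma (\<nu> + 1/2) * g))"
      by (subst ennreal_mult) auto
    then show ?thesis unfolding eq by simp
  qed
  finally show ?thesis unfolding M_def z_def .
qed

lemma ball_constant_pos:
  assumes "\<nu> > -1/2" shows "ball_const \<nu> k > 0"
proof -
  have "\<nu> + 1/2 > 0" using assms by simp
  moreover from this have "\<nu> + 1/2 + real k / 2 > 0" by (rule add_pos_nonneg) simp
  ultimately show ?thesis by (intro divide_pos_pos Gamma_real_pos)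
qed

definition gauss_integral :: "('a::euclidean_space \<Rightarrow> real) \<Rightarrow> real" where
  "gauss_integral p = (LINT y|lborel. p y * gaussian y)"

lemma homogeneous_pos_neg_parts:
  assumes "homogeneous m p"
  shows "homogeneous m (\<lambda>y. max 0 (p y))" "homogeneous m (\<lambda>y. max 0 (- p y))"
proof -
  have "max 0 (c * x) = c * max 0 x \<and> max 0 (- (c * x)) = c * max 0 (- x)" if "c > 0" for c x :: real
    using that by (simp add: max_def mult_le_0_iff zero_le_mult_iff)
  then show "homogeneous m (\<lambda>y. max 0 (p y))" "homogeneous m (\<lambda>y. max 0 (- p y))"
    using assms by (auto simp: homogeneous_def)
qed

lemma gauss_integral_pos_neg_parts:
  assumes int: "integrable lborel (\<lambda>y. p y * gaussian y)" and [measurable]: "p \<in> borel_measurable borel"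
  shows "(\<integral>\<^sup>+y. ennreal (max 0 (p y) * gaussian y) \<partial>lborel) = ennreal (gauss_integral (\<lambda>y. max 0 (p y)))"
    "(\<integral>\<^sup>+y. ennreal (max 0 (- p y) * gaussian y) \<partial>lborel) = ennreal (gauss_integral (\<lambda>y. max 0 (- p y)))"
    "gauss_integral (\<lambda>y. max 0 (p y)) \<ge> 0" "gauss_integral (\<lambda>y. max 0 (- p y)) \<ge> 0"
    "gauss_integral p = gauss_integral (\<lambda>y. max 0 (p y)) - gauss_integral (\<lambda>y. max 0 (- p y))"
proof -
  have i: "integrable lborel (\<lambda>y. max 0 (p y) * gaussian y)" "integrable lborel (\<lambda>y. max 0 (- p y) * gaussian y)"
    by (rule Bochner_Integration.integrable_bound[OF int], simp, simp add: abs_mult max_def)+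
  show "(\<integral>\<^sup>+y. ennreal (max 0 (p y) * gaussian y) \<partial>lborel) = ennreal (gauss_integral (\<lambda>y. max 0 (p y)))"
    "(\<integral>\<^sup>+y. ennreal (max 0 (- p y) * gaussian y) \<partial>lborel) = ennreal (gauss_integral (\<lambda>y. max 0 (- p y)))"
    unfolding gauss_integral_def by (intro nn_integral_eq_integral i; simp)+
  show "gauss_integral (\<lambda>y. max 0 (p y)) \<ge> 0" "gauss_integral (\<lambda>y. max 0 (- p y)) \<ge> 0"
    unfolding gauss_integral_def by (auto intro!: Bochner_Integration.integral_nonneg)
  have "p y * e = max 0 (p y) * e - max 0 (- p y) * e" for y e
    by (simp add: max_def)
  then show "gauss_integral p = gauss_integral (\<lambda>y. max 0 (p y)) - gauss_integral (\<lambda>y. max 0 (- p y))"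
    unfolding gauss_integral_def using i by (simp flip: Bochner_Integration.integral_diff)
qed

text \<open>Formulas proved with Tonelli for nonnegative integrands extend to signed ones by
  splitting. The parts of a polynomial are no longer polynomials, which is why \<open>nonneg\<close>
  ranges over measurable homogeneous functions.\<close>

lemma has_bochner_integral_homogeneous:
  fixes p :: "'a::euclidean_space \<Rightarrow> real"
  assumes p: "homogeneous m p" and [measurable]: "p \<in> borel_measurable borel"
    and int: "integrable lborel (\<lambda>y. p y * gaussian y)"
    and nonneg: "\<And>p'. homogeneous m p' \<Longrightarrow> (\<And>y. p' y \<ge> 0) \<Longrightarrow> p' \<in> borel_measurable borel \<Longrightarrow>
      gauss_integral p' \<ge> 0 \<Longrightarrow>
      (\<integral>\<^sup>+y. ennreal (p' y * gaussian y) \<partial>lborel) = ennreal (gauss_integral p') \<Longrightarrow>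
      has_bochner_integral M (\<lambda>q. p' (h q) * e q) (C * gauss_integral p')"
  shows "has_bochner_integral M (\<lambda>q. p (h q) * e q) (C * gauss_integral p)"
proof -
  note parts = gauss_integral_pos_neg_parts[OF int]
  have "has_bochner_integral M (\<lambda>q. max 0 (p (h q)) * e q - max 0 (- p (h q)) * e q)
      (C * gauss_integral (\<lambda>y. max 0 (p y)) - C * gauss_integral (\<lambda>y. max 0 (- p y)))"
    using parts homogeneous_pos_neg_parts[OF p] by (intro has_bochner_integral_diff nonneg) auto
  moreover have "max 0 (p y) * e - max 0 (- p y) * e = p y * e" for y e
    by (simp add: max_def)
  ultimately show ?thesis using parts(5) by (simp add: right_diff_distrib)
qed

lemma has_bochner_integral_ball:
  fixes p :: "'a::euclidean_space \<Rightarrow> real"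
  assumes "homogeneous m p" "p \<in> borel_measurable borel" and \<nu>: "\<nu> > -1/2"
    and "integrable lborel (\<lambda>y. p y * gaussian y)"
  shows "has_bochner_integral lborel (\<lambda>y. p y * ball_weight \<nu> 1 y)
       (ball_const \<nu> (m + DIM('a)) * gauss_integral p)"
  using assms(1,2,4)
proof (rule has_bochner_integral_homogeneous[where h = "\<lambda>y. y"])
  fix p' :: "'a \<Rightarrow> real"
  assume p': "homogeneous m p'" "\<And>y. p' y \<ge> 0" and [measurable]: "p' \<in> borel_measurable borel"
    and g: "gauss_integral p' \<ge> 0"
      "(\<integral>\<^sup>+y. ennreal (p' y * gaussian y) \<partial>lborel) = ennreal (gauss_integral p')"
  show "has_bochner_integral lborel (\<lambda>y. p' y * ball_weight \<nu> 1 y)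
       (ball_const \<nu> (m + DIM('a)) * gauss_integral p')"
  proof (rule has_bochner_integral_nn_integral)
    show "(\<integral>\<^sup>+y. ennreal (p' y * ball_weight \<nu> 1 y) \<partial>lborel)
        = ennreal (ball_const \<nu> (m + DIM('a)) * gauss_integral p')"
      by (rule nn_integral_ball_weight) (use p' \<nu> g in auto)
    show "0 \<le> ball_const \<nu> (m + DIM('a)) * gauss_integral p'"
      using ball_constant_pos[OF \<nu>, of "m + DIM('a)"] g by (intro mult_nonneg_nonneg) auto
  qed (use p' in \<open>auto simp: ball_weight_nonneg\<close>)
qed

lemma has_bochner_integral_paraboloid:
  fixes p :: "'a::euclidean_space \<Rightarrow> real" and \<phi> :: "real \<Rightarrow> real"
  assumes p: "homogeneous m p" "p \<in> borel_measurable borel" and [measurable]: "\<phi> \<in> borel_measurable borel"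
    and \<nu>: "\<nu> > -1/2" and int: "integrable lborel (\<lambda>y. p y * gaussian y)"
    and \<phi>: "\<And>s. \<phi> s \<ge> 0"
    and I: "(\<integral>\<^sup>+s. ennreal (indicator {0<..} s * s powr (\<nu> - 1/2 + real (m + DIM('a)) / 2) * \<phi> s) \<partial>lborel) = ennreal I" "I \<ge> 0"
  shows "has_bochner_integral lborel (\<lambda>q. p (fst q) * (ball_weight \<nu> (snd q) (fst q) * \<phi> (snd q)))
       (I * ball_const \<nu> (m + DIM('a)) * gauss_integral p)"
  using p int
proof (rule has_bochner_integral_homogeneous)
  define C where "C = ball_const \<nu> (m + DIM('a))"
  have C: "C \<ge> 0" unfolding C_def using ball_constant_pos[OF \<nu>, of "m + DIM('a)"] by simp
  fix p' :: "'a \<Rightarrow> real"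
  assume p': "homogeneous m p'" "\<And>y. p' y \<ge> 0" and [measurable]: "p' \<in> borel_measurable borel"
    and g: "gauss_integral p' \<ge> 0"
      "(\<integral>\<^sup>+y. ennreal (p' y * gaussian y) \<partial>lborel) = ennreal (gauss_integral p')"
  have "has_bochner_integral lborel (\<lambda>q. p' (fst q) * ball_weight \<nu> (snd q) (fst q) * \<phi> (snd q)) (I * C * gauss_integral p')"
  proof (rule has_bochner_integral_nn_integral)
    have "ennreal (I * C * gauss_integral p') = ennreal I * ennreal (C * gauss_integral p')"
      unfolding mult.assoc using I C g by (intro ennreal_mult) auto
    then show "(\<integral>\<^sup>+q. ennreal (p' (fst q) * ball_weight \<nu> (snd q) (fst q) * \<phi> (snd q)) \<partial>lborel) = ennreal (I * C * gauss_integral p')"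
      using nn_integral_paraboloid[OF p', of \<phi> \<nu>] nn_integral_ball_weight[OF p' _ \<nu> g(2,1)] \<phi> I
      by (simp only: C_def) simp
    show "(\<lambda>q. p' (fst q) * ball_weight \<nu> (snd q) (fst q) * \<phi> (snd q)) \<in> borel_measurable lborel"
      unfolding measurable_lborel1 by measurable
  qed (use I C g p' \<phi> in \<open>auto simp: ball_weight_nonneg\<close>)
  then show "has_bochner_integral lborel (\<lambda>q. p' (fst q) * (ball_weight \<nu> (snd q) (fst q) * \<phi> (snd q)))
       (I * ball_const \<nu> (m + DIM('a)) * gauss_integral p')"
    by (simp only: C_def mult.assoc)
qed

section \<open>Gaussian means of polynomials\<close>

lemma has_bochner_integral_gauss_moment:
  "has_bochner_integral lborel (\<lambda>x::real. x ^ k * exp (- x\<^sup>2)) (sqrt pi * gauss_moment k)"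
proof (cases "even k")
  case True
  then obtain l where k: "k = 2 * l" by blast
  have "has_bochner_integral lborel (\<lambda>x::real. exp (- x\<^sup>2) * x ^ (2 * l)) (2 *\<^sub>R (sqrt pi / 2 * (fact (2 * l) / (2 ^ (2 * l) * fact l))))"
    using gaussian_moment_even_pos[of l] by (rule has_bochner_integral_even_function) simp
  then show ?thesis unfolding k gauss_moment_even power_mult by (simp add: mult.commute)
next
  case False
  then obtain l where k: "k = 2 * l + 1" by (rule oddE)
  have "has_bochner_integral lborel (\<lambda>x::real. exp (- x\<^sup>2) * x ^ (2 * l + 1)) 0"
    using gaussian_moment_odd_pos[of l] by (rule has_bochner_integral_odd_function) simp
  then show ?thesis using False by (simp add: k gauss_moment_odd mult.commute)
qed

lemma has_bochner_integral_gauss_monomial: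
  "has_bochner_integral lborel (\<lambda>y::'a::euclidean_space. monomial k y * gaussian y)
     (\<Prod>b\<in>(Basis::'a set). sqrt pi * gauss_moment (k b))"
proof -
  interpret product_sigma_finite "\<lambda>b::'a. (lborel :: real measure)" ..
  define f where "f b x = x ^ k b * exp (- x\<^sup>2)" for b :: 'a and x :: real
  have f: "has_bochner_integral lborel (f b) (sqrt pi * gauss_moment (k b))" for b
    unfolding f_def by (rule has_bochner_integral_gauss_moment)
  have [measurable]: "f b \<in> borel_measurable borel" for b unfolding f_def by measurable
  have eq: "monomial k y * gaussian y = (\<Prod>b\<in>Basis. f b (y \<bullet> b))" for y :: 'a
    by (simp add: monomial_def f_def prod.distrib norm_eq_sqrt_inner euclidean_inner[of y y] power2_eq_square
        sum_nonneg exp_sum sum_negf[symmetric])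
  have 1: "(\<Prod>b\<in>Basis. f b ((\<Sum>b'\<in>Basis. g b' *\<^sub>R b') \<bullet> b)) = (\<Prod>b\<in>Basis. f b (g b))" for g :: "'a \<Rightarrow> real"
    by (intro prod.cong) (auto simp: inner_sum_left inner_Basis if_distrib cong: if_cong)
  have "integrable (\<Pi>\<^sub>M b\<in>(Basis::'a set). lborel) (\<lambda>g. \<Prod>b\<in>Basis. f b (g b))"
    using f by (intro product_integrable_prod) (auto simp: has_bochner_integral_iff)
  moreover have "(\<integral>g. (\<Prod>b\<in>Basis. f b (g b)) \<partial>(\<Pi>\<^sub>M b\<in>(Basis::'a set). lborel)) = (\<Prod>b\<in>(Basis::'a set). sqrt pi * gauss_moment (k b))"
    using f by (subst product_integral_prod) (auto simp: has_bochner_integral_iff)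
  ultimately show ?thesis
    unfolding eq has_bochner_integral_iff
    by (subst (1 2) lborel_eq) (simp add: integrable_distr_eq integral_distr 1)
qed

lemma monomial_measurable [measurable]: "monomial k \<in> borel_measurable borel"
  unfolding monomial_def by measurable

lemma poly_upto_measurable: "f \<in> poly_upto n \<Longrightarrow> f \<in> borel_measurable borel"
  using borel_measurable_continuous_onI poly_upto_continuous by blast

lemma gauss_integrable_poly:
  "f \<in> poly_upto n \<Longrightarrow> integrable lborel (\<lambda>y. f y * gaussian y)"
proof (induction rule: poly_upto_induct)
  case (monomial k)
  show ?case using has_bochner_integral_gauss_monomial[of k] by (simp add: has_bochner_integral_iff)
qed (auto simp: distrib_right mult.assoc)

lemma gauss_integral_monomial:
  "gauss_integral (monomial k :: 'a::euclidean_space \<Rightarrow> real) = (\<Prod>b\<in>(Basis::'a set). sqrt pi * gauss_moment (k b))"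
  unfolding gauss_integral_def using has_bochner_integral_gauss_monomial by (rule has_bochner_integral_integral_eq)

lemma gauss_integral_add:
  assumes "f \<in> poly_upto n" "g \<in> poly_upto m"
  shows "gauss_integral (\<lambda>y. f y + g y) = gauss_integral f + gauss_integral g"
  unfolding gauss_integral_def using gauss_integrable_poly[OF assms(1)] gauss_integrable_poly[OF assms(2)]
  by (simp add: distrib_right)

lemma gauss_integral_scale: "gauss_integral (\<lambda>y. r * f y) = r * gauss_integral f"
  unfolding gauss_integral_def by (simp add: mult.assoc)

lemma gauss_integral_sum:
  assumes "\<And>i. i \<in> I \<Longrightarrow> f i \<in> poly_upto n"
  shows "gauss_integral (\<lambda>y. \<Sum>i\<in>I. f i y) = (\<Sum>i\<in>I. gauss_integral (f i))"
  unfolding gauss_integral_def sum_distrib_right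
  using assms by (intro Bochner_Integration.integral_sum gauss_integrable_poly)

lemma monomial_partial_derivative:
  assumes b: "b \<in> Basis"
  shows "((\<lambda>\<tau>. monomial k (y + \<tau> *\<^sub>R b)) has_real_derivative (real (k b) * monomial (k(b := k b - 1)) y)) (at 0)"
proof -
  note eq = monomial_remove[OF b]
  have "(\<Prod>b'\<in>Basis - {b}. ((y + \<tau> *\<^sub>R b) \<bullet> b') ^ k b') = (\<Prod>b'\<in>Basis - {b}. (y \<bullet> b') ^ k b')" for \<tau>
    using b inner_not_same_Basis[of b] by (intro prod.cong) (auto simp: inner_add_left)
  then have "monomial k (y + \<tau> *\<^sub>R b) = (y \<bullet> b + \<tau>) ^ k b * (\<Prod>b'\<in>Basis - {b}. (y \<bullet> b') ^ k b')" for \<tau>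
    unfolding eq using b by (simp add: inner_add_left)
  moreover have "((\<lambda>\<tau>. (y \<bullet> b + \<tau>) ^ k b * P) has_real_derivative (real (k b) * ((y \<bullet> b) ^ (k b - 1) * P))) (at 0)" for P
    by (auto intro!: derivative_eq_intros)
  ultimately show ?thesis by (simp add: eq)
qed

text \<open>On monomials the integral is a product of one-dimensional moments, and the identity is
  the recursion of \<open>gauss_moment\<close> in the coordinate \<open>b\<close>; no boundary terms
  have to be estimated.\<close>

lemma gauss_integral_by_parts:
  fixes f :: "'a::euclidean_space \<Rightarrow> real"
  assumes f: "f \<in> poly_upto n" and b: "b \<in> Basis"
    and deriv: "\<And>y. ((\<lambda>\<tau>. f (y + \<tau> *\<^sub>R b)) has_real_derivative f' y) (at 0)"
  shows "gauss_integral (\<lambda>y. (y \<bullet> b) * f y) = 1/2 * gauss_integral f'"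
proof -
  obtain c where c: "f = (\<lambda>p. \<Sum>k\<in>multi_indices n. c k * monomial k p)"
    using f unfolding poly_upto_iff by blast
  define d where "d k = k(b := k b - 1)" for k :: "'a \<Rightarrow> nat"
  \<comment> \<open>\<open>f'\<close> is known only as a derivative; uniqueness identifies it with
    the termwise derivative.\<close>
  have f'_eq: "f' = (\<lambda>y. \<Sum>k\<in>multi_indices n. c k * (real (k b) * monomial (d k) y))"
  proof
    fix y
    have "((\<lambda>\<tau>. f (y + \<tau> *\<^sub>R b)) has_real_derivative (\<Sum>k\<in>multi_indices n. c k * (real (k b) * monomial (d k) y))) (at 0)"
      unfolding c d_def by (intro DERIV_sum DERIV_cmult monomial_partial_derivative b)
    then show "f' y = (\<Sum>k\<in>multi_indices n. c k * (real (k b) * monomial (d k) y))"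
      using deriv[of y] DERIV_unique by blast
  qed
  have d: "monomial (d k) \<in> poly_upto n" if "k \<in> multi_indices n" for k
  proof -
    have "(\<Sum>b'\<in>Basis. d k b') \<le> (\<Sum>b'\<in>Basis. k b')" by (intro sum_mono) (auto simp: d_def)
    then show ?thesis using that b by (intro monomial_in_poly_upto) (auto simp: multi_indices_def d_def)
  qed
  have up: "(\<lambda>y. (y \<bullet> b) * monomial k y) = monomial (k(b := Suc (k b)))" for k
  proof
    fix y
    show "(y \<bullet> b) * monomial k y = monomial (k(b := Suc (k b))) y" by (simp add: monomial_remove[OF b])
  qed
  have mono: "gauss_integral (\<lambda>y. (y \<bullet> b) * monomial k y) = 1/2 * (real (k b) * gauss_integral (monomial (d k)))" for k
  proof -
    have eq: "gauss_integral (monomial j) = sqrt pi * gauss_moment (j b) * (\<Prod>b'\<in>Basis - {b}. sqrt pi * gauss_moment (j b'))" for j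
      unfolding gauss_integral_monomial by (rule prod.remove) (use b in auto)
    have "gauss_moment (Suc (k b)) = real (k b) / 2 * gauss_moment (k b - 1)"
      by (cases "k b") auto
    then show ?thesis unfolding up by (simp add: eq d_def)
  qed
  have "gauss_integral (\<lambda>y. (y \<bullet> b) * f y) = gauss_integral (\<lambda>y. \<Sum>k\<in>multi_indices n. c k * ((y \<bullet> b) * monomial k y))"
    unfolding c sum_distrib_left by (simp add: mult.left_commute)
  also have "\<dots> = (\<Sum>k\<in>multi_indices n. c k * gauss_integral (\<lambda>y. (y \<bullet> b) * monomial k y))"
    by (subst gauss_integral_sum[where n = "1 + n"])
      (auto simp: gauss_integral_scale intro!: poly_upto_scale poly_upto_mult poly_upto_inner monomial_in_poly_upto
          simp del: One_nat_def plus_1_eq_Suc)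
  also have "\<dots> = 1/2 * gauss_integral f'"
    unfolding f'_eq mono
    by (subst gauss_integral_sum[where n = n]) (auto simp: gauss_integral_scale sum_distrib_left mult_ac intro!: poly_upto_scale d)
  finally show ?thesis .
qed

lemma homogeneous_mult:
  "homogeneous m p \<Longrightarrow> homogeneous n q \<Longrightarrow> homogeneous (m + n) (\<lambda>y. p y * q y)"
  by (simp add: homogeneous_def power_add)

lemma homogeneous_monomial: "homogeneous (\<Sum>b\<in>Basis. k b) (monomial k)"
  by (simp add: homogeneous_def monomial_def power_mult_distrib prod.distrib power_sum)

lemma homogeneous_inner_power: "homogeneous n (\<lambda>y. (X \<bullet> y) ^ n)"
  by (simp add: homogeneous_def power_mult_distrib)

lemma poly_upto_inner_power: "(\<lambda>y. (X \<bullet> y) ^ n) \<in> poly_upto n"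
  using poly_upto_power[OF poly_upto_inner[of X], of n] by (simp add: inner_commute)

definition normal_mean :: "('a::euclidean_space \<Rightarrow> real) \<Rightarrow> real" where
  "normal_mean p = gauss_integral p / sqrt pi ^ DIM('a)"

lemma normal_mean_monomial:
  "normal_mean (monomial k :: 'a::euclidean_space \<Rightarrow> real) = (\<Prod>b\<in>(Basis::'a set). gauss_moment (k b))"
  by (simp add: normal_mean_def gauss_integral_monomial prod.distrib)

lemma normal_mean_scale: "normal_mean (\<lambda>y. r * f y) = r * normal_mean f"
  by (simp add: normal_mean_def gauss_integral_scale)

lemma normal_mean_add:
  "f \<in> poly_upto n \<Longrightarrow> g \<in> poly_upto m \<Longrightarrow> normal_mean (\<lambda>y. f y + g y) = normal_mean f + normal_mean g"
  by (simp add: normal_mean_def gauss_integral_add add_divide_distrib)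

lemma normal_mean_sum:
  assumes "\<And>i. i \<in> I \<Longrightarrow> f i \<in> poly_upto n"
  shows "normal_mean (\<lambda>y. \<Sum>i\<in>I. f i y) = (\<Sum>i\<in>I. normal_mean (f i))"
proof -
  have "gauss_integral (\<lambda>y. \<Sum>i\<in>I. f i y) = (\<Sum>i\<in>I. gauss_integral (f i))"
    by (rule gauss_integral_sum[where n = n]) (rule assms)
  then show ?thesis by (simp add: normal_mean_def sum_divide_distrib)
qed

lemma normal_mean_by_parts:
  fixes f :: "'a::euclidean_space \<Rightarrow> real"
  assumes "f \<in> poly_upto n" "b \<in> Basis"
    "\<And>y. ((\<lambda>\<tau>. f (y + \<tau> *\<^sub>R b)) has_real_derivative f' y) (at 0)"
  shows "normal_mean (\<lambda>y. (y \<bullet> b) * f y) = 1/2 * normal_mean f'"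
  unfolding normal_mean_def by (subst gauss_integral_by_parts[OF assms]) auto

lemma inner_mult_expand:
  fixes X y :: "'a::euclidean_space"
  shows "(X \<bullet> y) * r = (\<Sum>b\<in>Basis. (X \<bullet> b) * ((y \<bullet> b) * r))"
  by (subst euclidean_inner) (simp add: sum_distrib_right mult.assoc)

text \<open>The projection of a Gaussian vector on X is a one-dimensional Gaussian scaled by the
  norm of X. Integration by parts in each coordinate gives the recursion of
  \<open>gauss_moment\<close> directly, without rotating coordinates.\<close>

lemma normal_mean_inner_power:
  "normal_mean (\<lambda>y::'a::euclidean_space. (X \<bullet> y) ^ n) = norm X ^ n * gauss_moment n"
proof -
  have step: "normal_mean (\<lambda>y. (X \<bullet> y) ^ Suc m) = 1/2 * (X \<bullet> X) * (real m * normal_mean (\<lambda>y. (X \<bullet> y) ^ (m - 1)))" for m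
  proof -
    have "normal_mean (\<lambda>y. (X \<bullet> y) ^ Suc m) = normal_mean (\<lambda>y. \<Sum>b\<in>Basis. (X \<bullet> b) * ((y \<bullet> b) * (X \<bullet> y) ^ m))"
      by (intro arg_cong[where f = normal_mean] ext) (subst power_Suc, rule inner_mult_expand)
    also have "\<dots> = (\<Sum>b\<in>Basis. (X \<bullet> b) * normal_mean (\<lambda>y. (y \<bullet> b) * (X \<bullet> y) ^ m))"
      by (subst normal_mean_sum[where n = "1 + m"])
        (auto simp: normal_mean_scale simp del: One_nat_def plus_1_eq_Suc
          intro!: poly_upto_scale poly_upto_mult poly_upto_inner poly_upto_inner_power)
    also have "\<dots> = (\<Sum>b\<in>Basis. (X \<bullet> b) * (1/2 * ((X \<bullet> b) * (real m * normal_mean (\<lambda>y. (X \<bullet> y) ^ (m - 1))))))"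
    proof (intro sum.cong refl arg_cong2[where f = "(*)"])
      fix b :: 'a assume b: "b \<in> Basis"
      have "((\<lambda>\<tau>. (X \<bullet> (y + \<tau> *\<^sub>R b)) ^ m) has_real_derivative (X \<bullet> b) * (real m * (X \<bullet> y) ^ (m - 1))) (at 0)" for y
        by (auto intro!: derivative_eq_intros simp: inner_add_right)
      from normal_mean_by_parts[OF poly_upto_inner_power b this]
      show "normal_mean (\<lambda>y. (y \<bullet> b) * (X \<bullet> y) ^ m) = 1/2 * ((X \<bullet> b) * (real m * normal_mean (\<lambda>y. (X \<bullet> y) ^ (m - 1))))"
        by (simp only: normal_mean_scale)
    qed
    also have "\<dots> = 1/2 * (X \<bullet> X) * (real m * normal_mean (\<lambda>y. (X \<bullet> y) ^ (m - 1)))"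
    proof -
      have "(\<Sum>b\<in>Basis. (X \<bullet> b) * (1/2 * ((X \<bullet> b) * Z))) = 1/2 * (X \<bullet> X) * Z" for Z
      proof -
        have "(X \<bullet> b) * (1/2 * ((X \<bullet> b) * Z)) = (X \<bullet> b) * ((X \<bullet> b) * (1/2 * Z))" for b by simp
        then have "(\<Sum>b\<in>Basis. (X \<bullet> b) * (1/2 * ((X \<bullet> b) * Z))) = (X \<bullet> X) * (1/2 * Z)"
          by (simp only: inner_mult_expand[of X X "1/2 * Z"])
        then show ?thesis by simp
      qed
      then show ?thesis .
    qed
    finally show ?thesis .
  qed
  show ?thesis
  proof (induction n rule: gauss_moment.induct)
    case 1
    have "normal_mean (monomial (\<lambda>_. 0) :: 'a \<Rightarrow> real) = 1" by (simp add: normal_mean_monomial)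
    then show ?case by (simp add: monomial_def[abs_def])
  next
    case 2
    then show ?case using step[of 0] by simp
  next
    case (3 k)
    have "X \<bullet> X = (norm X)\<^sup>2" by (simp add: power2_norm_eq_inner)
    then show ?case using step[of "Suc k"] 3 by (simp add: power2_eq_square)
  qed
qed

text \<open>The mean of \<open>(X \<bullet> y + B v)\<^sup>k f(y)\<close>, where \<open>(y, v)\<close> has density proportional to
  \<open>exp (- \<parallel>y\<parallel>\<^sup>2 - v\<^sup>2)\<close>.\<close>

definition ridge_mean :: "'a::euclidean_space \<Rightarrow> real \<Rightarrow> nat \<Rightarrow> ('a \<Rightarrow> real) \<Rightarrow> real" where
  "ridge_mean X B k f = (\<Sum>l\<le>k. real (k choose l) * (B ^ l * gauss_moment l) * normal_mean (\<lambda>y. (X \<bullet> y) ^ (k - l) * f y))"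

text \<open>(X, B) is a unit vector, so X \<bullet> y + B v is again Gaussian of the same
  variance.\<close>

lemma ridge_mean_1:
  assumes "(norm X)\<^sup>2 + B\<^sup>2 = 1"
  shows "ridge_mean X B k (\<lambda>_. 1) = gauss_moment k"
proof -
  have "ridge_mean X B k (\<lambda>_. 1) = (\<Sum>l\<le>k. real (k choose l) * (norm X ^ (k - l) * gauss_moment (k - l)) * (B ^ l * gauss_moment l))"
    by (simp add: ridge_mean_def normal_mean_inner_power mult_ac)
  then show ?thesis using assms by (simp add: gauss_moment_convolution gauss_moment_odd)
qed

lemma ridge_mean_scale: "ridge_mean X B k (\<lambda>y. r * f y) = r * ridge_mean X B k f"
proof -
  have "(\<lambda>y. (X \<bullet> y) ^ n * (r * f y)) = (\<lambda>y. r * ((X \<bullet> y) ^ n * f y))" for n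
    by (simp add: mult.left_commute)
  then show ?thesis
    unfolding ridge_mean_def sum_distrib_left by (simp only: normal_mean_scale mult.left_commute)
qed

text \<open>Gaussian integration by parts in y \<bullet> b: the derivative falls either on the ridge
  power, producing k (X \<bullet> b), or on \<open>f\<close>. The extra variable v is not
  touched.\<close>

lemma ridge_mean_by_parts:
  fixes f :: "'a::euclidean_space \<Rightarrow> real"
  assumes f: "f \<in> poly_upto n" "f' \<in> poly_upto n" and b: "b \<in> Basis"
    and f': "\<And>y. ((\<lambda>\<tau>. f (y + \<tau> *\<^sub>R b)) has_real_derivative f' y) (at 0)"
  shows "ridge_mean X B k (\<lambda>y. (y \<bullet> b) * f y)
       = 1/2 * (real k * ((X \<bullet> b) * ridge_mean X B (k - 1) f) + ridge_mean X B k f')"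
proof -
  have summand: "normal_mean (\<lambda>y. (X \<bullet> y) ^ m * ((y \<bullet> b) * f y))
      = 1/2 * (real m * ((X \<bullet> b) * normal_mean (\<lambda>y. (X \<bullet> y) ^ (m - 1) * f y)) + normal_mean (\<lambda>y. (X \<bullet> y) ^ m * f' y))" for m
  proof -
    have "((\<lambda>\<tau>. (X \<bullet> (y + \<tau> *\<^sub>R b)) ^ m * f (y + \<tau> *\<^sub>R b)) has_real_derivative
        (real m * (X \<bullet> b)) * ((X \<bullet> y) ^ (m - 1) * f y) + (X \<bullet> y) ^ m * f' y) (at 0)" for y
      by (auto intro!: derivative_eq_intros f' simp: inner_add_right)
    from normal_mean_by_parts[OF poly_upto_mult[OF poly_upto_inner_power f(1)] b this]
    have "normal_mean (\<lambda>y. (y \<bullet> b) * ((X \<bullet> y) ^ m * f y))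
        = 1/2 * (normal_mean (\<lambda>y. (real m * (X \<bullet> b)) * ((X \<bullet> y) ^ (m - 1) * f y)) + normal_mean (\<lambda>y. (X \<bullet> y) ^ m * f' y))"
      by (subst (asm) normal_mean_add[OF poly_upto_scale[OF poly_upto_mult] poly_upto_mult])
        (rule poly_upto_inner_power f)+
    then show ?thesis by (simp add: normal_mean_scale mult.left_commute mult.assoc)
  qed
  define c where "c l = B ^ l * gauss_moment l" for l
  define N where "N j = normal_mean (\<lambda>y. (X \<bullet> y) ^ j * f y)" for j
  define N' where "N' j = normal_mean (\<lambda>y. (X \<bullet> y) ^ j * f' y)" for j
  have "ridge_mean X B k (\<lambda>y. (y \<bullet> b) * f y)
      = (\<Sum>l\<le>k. real (k choose l) * c l * (1/2 * (real (k - l) * ((X \<bullet> b) * N (k - l - 1)) + N' (k - l))))"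
    unfolding ridge_mean_def summand c_def N_def N'_def by simp
  also have "\<dots> = 1/2 * ((X \<bullet> b) * (\<Sum>l\<le>k. real (k choose l) * real (k - l) * (c l * N (k - l - 1)))
      + (\<Sum>l\<le>k. real (k choose l) * c l * N' (k - l)))"
    unfolding sum_distrib_left sum.distrib[symmetric] by (intro sum.cong refl) (simp add: algebra_simps)
  also have "(\<Sum>l\<le>k. real (k choose l) * real (k - l) * (c l * N (k - l - 1))) = real k * ridge_mean X B (k - 1) f"
  proof (cases k)
    case (Suc n)
    have "real (k choose l) * real (k - l) = real k * real (n choose l)" for l
      using binomial_absorb_comp[of k l] unfolding Suc by (metis diff_Suc_1 mult.commute of_nat_mult)
    then have "real (k choose l) * real (k - l) * Y = real k * (real (n choose l) * Y)" for l Y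
      by (simp only: mult.assoc)
    then have "(\<Sum>l\<le>k. real (k choose l) * real (k - l) * (c l * N (k - l - 1)))
        = real k * (\<Sum>l\<le>k. real (n choose l) * (c l * N (k - l - 1)))"
      by (simp only: sum_distrib_left)
    then show ?thesis by (simp add: Suc ridge_mean_def c_def N_def mult.assoc)
  qed simp
  finally show ?thesis by (simp add: ridge_mean_def c_def N'_def mult.left_commute)
qed

text \<open>By homogeneity the Gamma quotient turns Gaussian means into means over the unit ball. Thus the
  sequence is \<open>k \<mapsto> E [(X \<bullet> y + u B (1 - \<parallel>y\<parallel>\<^sup>2)\<^bsup>1/2\<^esup>)\<^sup>k y\<^sup>\<kappa>]\<close>: the \<open>u\<close>-average on the ball has an
  adjoint that maps \<open>y\<^sup>\<kappa>\<close> to a polynomial in one variable with value \<open>X\<^sup>\<kappa>\<close> at \<open>1\<close>.\<close>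

lemma geg_represents_ridge_mean:
  fixes X :: "'a::euclidean_space"
  assumes X: "(norm X)\<^sup>2 + B\<^sup>2 = 1" and "a > -1/2" and "(\<Sum>b\<in>(Basis::'a set). \<kappa> b) = j"
  shows "geg_represents a j (monomial \<kappa> X)
    (\<lambda>k. gamma_quot a (k + j) * ridge_mean X B k (monomial \<kappa>))"
  using assms(2,3)
proof (induction j arbitrary: a \<kappa> rule: less_induct)
  case (less j)
  show ?case
  proof (cases "j = 0")
    case True
    then have "monomial \<kappa> = (\<lambda>y::'a. 1)" using less.prems by (simp add: monomial_def fun_eq_iff)
    then show ?thesis
      using geg_represents_moment[of 0 0 a] True
      by (simp add: ridge_mean_1[OF X] geg_moment_def mult.commute)
  next
    case False
    \<comment> \<open>Integrate by parts in a coordinate that occurs in the monomial. If the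
      derivative hits the ridge power, k and j drop by one; if it hits the rest of the monomial, j
      drops by two.\<close>
    then obtain b :: 'a where b: "b \<in> Basis" "\<kappa> b > 0"
      using less.prems(2) by (metis gr0I sum.neutral)
    define \<kappa>' where "\<kappa>' = \<kappa>(b := \<kappa> b - 1)"
    define \<kappa>'' where "\<kappa>'' = \<kappa>'(b := \<kappa>' b - 1)"
    have j': "(\<Sum>b\<in>(Basis::'a set). \<kappa>' b) = j - 1" and j'': "\<kappa>' b > 0 \<Longrightarrow> (\<Sum>b\<in>(Basis::'a set). \<kappa>'' b) = j - 2 \<and> j \<ge> 2"
    proof -
      have s: "(\<Sum>c\<in>(Basis::'a set). f c) = f b + (\<Sum>c\<in>Basis - {b}. f c)" for f :: "'a \<Rightarrow> nat"
        by (rule sum.remove) (use b in auto)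
      have 1: "(\<Sum>c\<in>Basis - {b}. \<kappa>' c) = (\<Sum>c\<in>Basis - {b}. \<kappa> c)" "(\<Sum>c\<in>Basis - {b}. \<kappa>'' c) = (\<Sum>c\<in>Basis - {b}. \<kappa> c)"
        by (auto simp: \<kappa>'_def \<kappa>''_def intro!: sum.cong)
      have 2: "\<kappa>' b = \<kappa> b - 1" "\<kappa>'' b = \<kappa>' b - 1" by (auto simp: \<kappa>'_def \<kappa>''_def)
      show "(\<Sum>b\<in>(Basis::'a set). \<kappa>' b) = j - 1"
        using s[of \<kappa>] s[of \<kappa>'] less.prems(2) b 1 2 by simp
      show "(\<Sum>b\<in>(Basis::'a set). \<kappa>'' b) = j - 2 \<and> j \<ge> 2" if "\<kappa>' b > 0"
        using s[of \<kappa>] s[of \<kappa>''] less.prems(2) b 1 2 that by simp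
    qed
    have split: "monomial \<kappa> = (\<lambda>y. (y \<bullet> b) * monomial \<kappa>' y)"
    proof
      fix y :: 'a
      have "(y \<bullet> b) ^ \<kappa> b = (y \<bullet> b) * (y \<bullet> b) ^ (\<kappa> b - 1)" using b by (simp flip: power_Suc)
      then show "monomial \<kappa> y = (y \<bullet> b) * monomial \<kappa>' y" by (simp add: monomial_remove[OF b(1)] \<kappa>'_def)
    qed
    define N where "N = (\<Sum>b\<in>(Basis::'a set). \<kappa>' b) + (\<Sum>b\<in>(Basis::'a set). \<kappa>'' b)"
    have in_poly: "(monomial \<kappa>' :: 'a \<Rightarrow> real) \<in> poly_upto N" "(monomial \<kappa>'' :: 'a \<Rightarrow> real) \<in> poly_upto N"
      by (rule poly_upto_mono[OF monomial_in_poly_upto_degree], simp add: N_def)+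
    have rec: "ridge_mean X B k (monomial \<kappa>)
       = 1/2 * (real k * ((X \<bullet> b) * ridge_mean X B (k - 1) (monomial \<kappa>')) + real (\<kappa>' b) * ridge_mean X B k (monomial \<kappa>''))" for k
    proof -
      have "ridge_mean X B k (monomial \<kappa>)
        = 1/2 * (real k * ((X \<bullet> b) * ridge_mean X B (k - 1) (monomial \<kappa>')) + ridge_mean X B k (\<lambda>y. real (\<kappa>' b) * monomial \<kappa>'' y))"
        unfolding split
      proof (rule ridge_mean_by_parts[OF in_poly(1) _ b(1)])
        show "(\<lambda>y. real (\<kappa>' b) * monomial \<kappa>'' y) \<in> poly_upto N" by (intro poly_upto_scale in_poly)
        show "((\<lambda>\<tau>. monomial \<kappa>' (y + \<tau> *\<^sub>R b)) has_real_derivative real (\<kappa>' b) * monomial \<kappa>'' y) (at 0)" for y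
          unfolding \<kappa>''_def by (rule monomial_partial_derivative[OF b(1)])
      qed
      then show ?thesis by (simp only: ridge_mean_scale)
    qed
    \<comment> \<open>In both terms k + j has dropped by two in total, so raising a to a + 1 leaves
      the Gamma value in the denominator unchanged; the numerators differ by the factor a +
      1.\<close>
    define s1 where "s1 k = Gamma (a + 1 + 1) / Gamma (a + 1 + 1 + real (k + (j - 1)) / 2) * ridge_mean X B k (monomial \<kappa>')" for k
    define s2 where "s2 k = Gamma (a + 1 + 1) / Gamma (a + 1 + 1 + real (k + (j - 2)) / 2) * ridge_mean X B k (monomial \<kappa>'')" for k
    have "geg_represents (a + 1) (j - 1) (monomial \<kappa>' X) s1"
      unfolding s1_def using less.prems False j' by (intro less.IH) auto
    then have "geg_represents a (Suc (j - 1)) ((2 * a + 1) * monomial \<kappa>' X) (\<lambda>k. (2 * a + 1) / (2 * (a + 1)) * (real k * s1 (k - 1)))"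
      by (rule geg_represents_by_parts) (rule less.prems)
    from geg_represents_scale[OF this, of "(X \<bullet> b) / (2 * a + 1)"]
    have 1: "geg_represents a j (monomial \<kappa> X) (\<lambda>k. (X \<bullet> b) / (2 * (a + 1)) * (real k * s1 (k - 1)))"
      using less.prems(1) False by (simp add: split)
    \<comment> \<open>No derivative accompanies this change of parameter, so the factor 1 -
      \<zeta>^2 removes the contribution at 1; the first term alone supplies
      \<open>monomial \<kappa> X\<close>.\<close>
    have 2: "geg_represents a j 0 (\<lambda>k. real (\<kappa>' b) / (2 * (a + 1)) * s2 k)"
    proof (cases "\<kappa>' b > 0")
      case True
      then have "geg_represents (a + 1) (j - 2) (monomial \<kappa>'' X) s2"
        unfolding s2_def using less.prems j'' by (intro less.IH) auto
      then have "geg_represents a (Suc (Suc (j - 2))) 0 s2"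
        by (rule geg_represents_shift) (rule less.prems)
      moreover have "Suc (Suc (j - 2)) = j" using conjunct2[OF j''[OF True]] by linarith
      ultimately show ?thesis using geg_represents_scale[of a j 0 s2 "real (\<kappa>' b) / (2 * (a + 1))"] by simp
    next
      case False
      then show ?thesis using geg_represents_scale[OF 1, of 0] by simp
    qed
    have "gamma_quot a (k + j) * ridge_mean X B k (monomial \<kappa>)
        = (X \<bullet> b) / (2 * (a + 1)) * (real k * s1 (k - 1)) + real (\<kappa>' b) / (2 * (a + 1)) * s2 k" for k
    proof -
      define G where "G = gamma_quot a (k + j)"
      have ga: "Gamma (a + 1 + 1) = (a + 1) * Gamma (a + 1)"
        using less.prems(1) by (intro Gamma_add_one_real) simp
      have "real k * s1 (k - 1) = real k * ((a + 1) * G * ridge_mean X B (k - 1) (monomial \<kappa>'))"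
      proof (cases k)
        case (Suc n)
        have eq: "a + 1 + 1 + real (k - 1 + (j - 1)) / 2 = a + 1 + real (k + j) / 2"
          using False Suc by (simp add: field_simps of_nat_diff)
        then show ?thesis by (simp only: s1_def ga G_def eq) simp
      qed simp
      moreover have "real (\<kappa>' b) * s2 k = real (\<kappa>' b) * ((a + 1) * G * ridge_mean X B k (monomial \<kappa>''))"
      proof (cases "\<kappa>' b > 0")
        case True
        have eq: "a + 1 + 1 + real (k + (j - 2)) / 2 = a + 1 + real (k + j) / 2"
          using conjunct2[OF j''[OF True]] by (simp add: field_simps of_nat_diff)
        then show ?thesis by (simp only: s2_def ga G_def eq) simp
      qed simp
      moreover have "G * (1/2 * (u * (x * p) + v * q)) = x / (2 * A) * (u * (A * G * p)) + (v * (A * G * q)) / (2 * A)"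
        if "A > 0" for x A u v p q
        using that by (simp add: field_simps)
      ultimately show ?thesis
        unfolding rec G_def[symmetric] using less.prems(1) by (simp only: times_divide_eq_left)
    qed
    then show ?thesis
      using geg_represents_add[OF 1 2] by simp
  qed
qed

section \<open>Moments of the weights on the paraboloid\<close>

abbreviation defect :: "'a::real_normed_vector \<times> real \<Rightarrow> real" where
  "defect q \<equiv> snd q - (norm (fst q))\<^sup>2"

lemma monomial_Pair:
  "monomial k (y, s) = monomial (\<lambda>b. k (b, 0)) y * s ^ k (0, 1 :: real)"
proof -
  have "monomial k (y, s) = (\<Prod>b\<in>(\<lambda>u. (u, 0)) ` Basis. ((y, s) \<bullet> b) ^ k b) * (\<Prod>b\<in>(\<lambda>v. (0, v)) ` Basis. ((y, s) \<bullet> b) ^ k b)"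
    unfolding monomial_def Basis_prod_def by (rule prod.union_disjoint) auto
  also have "(\<Prod>b\<in>(\<lambda>u. (u, 0)) ` Basis. ((y, s) \<bullet> b) ^ k b) = monomial (\<lambda>b. k (b, 0)) y"
    unfolding monomial_def by (subst prod.reindex) (auto simp: inj_on_def)
  also have "(\<Prod>b\<in>(\<lambda>v. (0, v)) ` Basis. ((y, s) \<bullet> b) ^ k b) = s ^ k (0, 1)"
    by simp
  finally show ?thesis .
qed

lemma monomial_real: "monomial k (x::real) = x ^ k 1"
  by (simp add: monomial_def)

text \<open>The points of \<open>U\<close> where \<open>f\<close> is nonzero form an open set, and a
  nonempty open set is not null.\<close>

lemma open_AE_zero:
  fixes f :: "'b::euclidean_space \<Rightarrow> real"
  assumes AE: "AE q in lborel. q \<in> U \<longrightarrow> f q = 0" and U: "open U" and f: "continuous_on UNIV f"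
    and q: "q \<in> U"
  shows "f q = 0"
proof (rule ccontr)
  assume "f q \<noteq> 0"
  define S where "S = U \<inter> {q. f q \<noteq> 0}"
  have "open {q. f q \<noteq> 0}"
    using f by (intro open_Collect_neq continuous_on_const)
  then have S: "open S" "S \<noteq> {}" using U q \<open>f q \<noteq> 0\<close> by (auto simp: S_def)
  obtain N where N: "{q \<in> space lborel. \<not> (q \<in> U \<longrightarrow> f q = 0)} \<subseteq> N" "N \<in> null_sets lborel"
    using AE by (auto elim!: AE_E simp: null_sets_def)
  have "S \<subseteq> N" using N(1) by (auto simp: S_def)
  moreover have "negligible N"
    using N(2) by (simp add: negligible_iff_null_sets null_sets_completionI)
  ultimately have "negligible S" by (rule negligible_subset[rotated])
  then show False using open_not_negligible[OF S] by blast
qed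

text \<open>The power of \<open>s\<close> is only prescribed for \<open>s > 0\<close>, so that the case \<open>\<beta> = 0\<close> covers weights without
  this factor although \<open>0 powr 0 = 0\<close>.\<close>

locale parabolic_weight =
  fixes D :: "('a::euclidean_space \<times> real) set" and w :: "'a \<times> real \<Rightarrow> real" and \<beta> \<gamma> \<mu> :: real
  assumes D: "D = {(y, s). (norm y)\<^sup>2 \<le> s \<and> s \<le> 1}"
    and w: "\<And>y s. s > 0 \<Longrightarrow> w (y, s) = s powr \<beta> * (1 - s) powr \<gamma> * (s - (norm y)\<^sup>2) powr (\<mu> - 1/2)"
    and w_measurable: "w \<in> borel_measurable borel"
    and \<beta>: "\<beta> \<ge> 0" and \<gamma>: "\<gamma> > -1" and \<mu>: "\<mu> > -1/2"
begin

text \<open>After y is scaled to the unit ball, its projection on any unit vector has the moments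
  \<open>geg_moment lam\<close>.\<close>

definition lam :: real where "lam = \<mu> + (real DIM('a) - 1) / 2"

lemma lam_gt: "lam > -1/2"
proof -
  have "real DIM('a) \<ge> 1" by (simp add: DIM_ge_Suc0 Suc_leI)
  then have "(real DIM('a) - 1) / 2 \<ge> 0" by simp
  then show ?thesis using \<mu> unfolding lam_def by linarith
qed

lemma D_measurable: "D \<in> sets borel"
proof -
  have "closed D"
    unfolding D case_prod_unfold by (intro closed_Collect_conj closed_Collect_le continuous_intros)
  then show ?thesis by simp
qed

lemma D_height_pos:
  assumes "q \<in> D" "q \<noteq> 0" shows "snd q > 0"
proof (rule ccontr)
  assume "\<not> snd q > 0"
  moreover have "(norm (fst q))\<^sup>2 \<le> snd q" using assms by (auto simp: D)
  ultimately have "(norm (fst q))\<^sup>2 \<le> 0" "snd q = 0" using zero_le_power2[of "norm (fst q)"] by linarith+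
  then show False using assms by (simp add: prod_eq_iff)
qed

text \<open>The power of the defect is absorbed into \<mu> and the power of s into the height
  factor. What remains separates into a Beta integral in s and a ball integral, which is converted
  to a Gaussian one.\<close>

lemma has_bochner_integral_weight:
  assumes p: "homogeneous m p" and [measurable]: "p \<in> borel_measurable borel"
    and int: "integrable lborel (\<lambda>y. p y * gaussian y)"
  shows "has_bochner_integral lborel (\<lambda>q. indicator D q *\<^sub>R (p (fst q) * snd q ^ r * defect q ^ h * w q))
    (Beta (\<beta> + lam + 1 + real r + real h + real m / 2) (\<gamma> + 1)
      * (Gamma (\<mu> + real h + 1/2) / Gamma (lam + 1 + real h + real m / 2) * gauss_integral p))"
proof -
  define \<nu> where "\<nu> = \<mu> + real h"
  have \<nu>: "\<nu> > -1/2" using \<mu> by (simp add: \<nu>_def)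
  define \<phi> where "\<phi> s = indicator {0<..1} s * (s ^ r * s powr \<beta> * (1 - s) powr \<gamma>)" for s :: real
  define z where "z = \<beta> + lam + 1 + real r + real h + real m / 2"
  have z: "z > 0" using lam_gt \<beta> by (simp add: z_def add_nonneg_pos)
  have z_pos: "0 \<le> Beta z (\<gamma> + 1)"
    unfolding Beta_def using z \<gamma> by (intro divide_nonneg_nonneg mult_nonneg_nonneg Gamma_real_nonneg) auto
  have \<phi>_meas[measurable]: "\<phi> \<in> borel_measurable borel" unfolding \<phi>_def by measurable
  have "(\<integral>\<^sup>+s. ennreal (indicator {0<..} s * s powr (\<nu> - 1/2 + real (m + DIM('a)) / 2) * \<phi> s) \<partial>lborel)
      = (\<integral>\<^sup>+s. ennreal (indicator {0..1} s * (s powr (z - 1) * (1 - s) powr (\<gamma> + 1 - 1))) \<partial>lborel)"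
    using AE_lborel_singleton[of "0::real"]
  proof (intro nn_integral_cong_AE, eventually_elim)
    case (elim s)
    have "s powr (\<nu> - 1/2 + real (m + DIM('a)) / 2) * (s ^ r * s powr \<beta>) = s powr (z - 1)" if "s > 0"
    proof -
      have "\<nu> - 1/2 + real (m + DIM('a)) / 2 + (real r + \<beta>) = z - 1"
        by (simp add: z_def lam_def \<nu>_def field_simps)
      then show ?thesis using that by (simp only: powr_realpow[symmetric] powr_add[symmetric])
    qed
    then show ?case using elim by (auto simp: \<phi>_def indicator_def mult.assoc[symmetric])
  qed
  also have "\<dots> = ennreal (Beta z (\<gamma> + 1))"
    using z \<gamma> by (intro nn_integral_has_integral_lebesgue has_integral_Beta_real) auto
  finally have I: "(\<integral>\<^sup>+s. ennreal (indicator {0<..} s * s powr (\<nu> - 1/2 + real (m + DIM('a)) / 2) * \<phi> s) \<partial>lborel)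
      = ennreal (Beta z (\<gamma> + 1))" .
  have \<phi>_nonneg: "\<phi> s \<ge> 0" for s by (simp add: \<phi>_def indicator_def)
  have main: "has_bochner_integral lborel (\<lambda>q. p (fst q) * ball_weight \<nu> (snd q) (fst q) * \<phi> (snd q))
       (Beta z (\<gamma> + 1) * (ball_const \<nu> (m + DIM('a)) * gauss_integral p))"
    using has_bochner_integral_paraboloid[OF p _ \<phi>_meas \<nu> int \<phi>_nonneg I z_pos] by (simp only: mult.assoc) measurable
  have arg: "\<nu> + 1/2 + real (m + DIM('a)) / 2 = lam + 1 + real h + real m / 2"
    by (simp add: \<nu>_def lam_def field_simps)
  note [measurable] = D_measurable w_measurable
  have "has_bochner_integral lborel (\<lambda>q. indicator D q *\<^sub>R (p (fst q) * snd q ^ r * defect q ^ h * w q))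
       (Beta z (\<gamma> + 1) * (ball_const \<nu> (m + DIM('a)) * gauss_integral p))"
  proof (rule has_bochner_integralI_AE[OF main])
    show "(\<lambda>q. indicator D q *\<^sub>R (p (fst q) * snd q ^ r * defect q ^ h * w q)) \<in> borel_measurable lborel"
      unfolding measurable_lborel1 by measurable
    \<comment> \<open>The apex is the only point of \<open>D\<close> of height zero; the weight is
      unspecified there, and the point is null.\<close>
    show "AE q in lborel. p (fst q) * ball_weight \<nu> (snd q) (fst q) * \<phi> (snd q)
       = indicator D q *\<^sub>R (p (fst q) * snd q ^ r * defect q ^ h * w q)"
      using AE_lborel_singleton[of "0 :: 'a \<times> real"]
    proof eventually_elim
      case (elim q)
      obtain y s where q: "q = (y, s)" by (cases q)
      show ?case
      proof (cases "q \<in> D")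
        case True
        then have ys: "(norm y)\<^sup>2 \<le> s" "s \<le> 1" by (auto simp: D q)
        have s: "s > 0" using D_height_pos[OF True elim] by (simp add: q)
        have "v powr (\<mu> + real h - 1/2) = v ^ h * v powr (\<mu> - 1/2)" if "v \<ge> 0" for v :: real
        proof (cases "v = 0")
          case False
          then have "v ^ h * v powr (\<mu> - 1/2) = v powr (real h + (\<mu> - 1/2))"
            using that by (simp add: powr_realpow[symmetric] powr_add)
          then show ?thesis by (simp add: algebra_simps)
        qed simp
        from this[of "s - (norm y)\<^sup>2"] show ?thesis
          using True ys s by (simp add: q ball_weight_def \<phi>_def w \<nu>_def)
      next
        case False
        then show ?thesis by (auto simp: D q ball_weight_def \<phi>_def indicator_def)
      qed
    qed
  qed
  then show ?thesis unfolding z_def \<nu>_def[symmetric] arg .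
qed

lemma set_integrable_poly:
  assumes "f \<in> poly_upto n" shows "set_integrable lborel D (\<lambda>q. f q * w q)"
  using assms
proof (induction rule: poly_upto_induct)
  case (monomial k)
  have "has_bochner_integral lborel (\<lambda>q. indicator D q *\<^sub>R (monomial (\<lambda>b. k (b, 0)) (fst q) * snd q ^ k (0, 1) * defect q ^ 0 * w q))
    (Beta (\<beta> + lam + 1 + real (k (0, 1)) + real 0 + real (\<Sum>b\<in>Basis. k (b, 0)) / 2) (\<gamma> + 1)
      * (Gamma (\<mu> + real 0 + 1/2) / Gamma (lam + 1 + real 0 + real (\<Sum>b\<in>Basis. k (b, 0)) / 2) * gauss_integral (monomial (\<lambda>b. k (b, 0)))))"
    using has_bochner_integral_gauss_monomial[of "\<lambda>b. k (b, 0)"]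
    by (intro has_bochner_integral_weight homogeneous_monomial) (auto simp: has_bochner_integral_iff)
  then show ?case
  proof -
    have "monomial k q = monomial (\<lambda>b. k (b, 0)) (fst q) * snd q ^ k (0, 1)" for q :: "'a \<times> real"
      using monomial_Pair[of k "fst q" "snd q"] by simp
    then show ?thesis
      using \<open>has_bochner_integral lborel _ _\<close> unfolding set_integrable_def has_bochner_integral_iff by simp
  qed
next
  case zero
  show ?case by (simp add: set_integrable_def)
next
  case (add f g)
  then show ?case using set_integral_add(1)[of lborel D "\<lambda>q. f q * w q" "\<lambda>q. g q * w q"] by (simp add: distrib_right)
next
  case (scale f r)
  then show ?case using set_integrable_mult_right[of r lborel D "\<lambda>q. f q * w q"] by (simp add: mult.assoc)
qed

definition mass :: real where
  "mass = Beta (\<beta> + lam + 1) (\<gamma> + 1) * (Gamma (\<mu> + 1/2) / Gamma (lam + 1) * sqrt pi ^ DIM('a))"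

lemma mass_pos: "mass > 0"
  unfolding mass_def Beta_def using lam_gt \<beta> \<gamma> \<mu>
  by (intro divide_pos_pos mult_pos_pos Gamma_real_pos zero_less_power) auto

lemma gauss_integral_1: "gauss_integral (\<lambda>y::'a. 1) = sqrt pi ^ DIM('a)"
  using gauss_integral_monomial[of "\<lambda>b::'a. 0"] by (simp add: monomial_def[abs_def])

lemma norm_const_eq: "norm_const D w = 1 / mass"
proof -
  have "has_bochner_integral lborel (\<lambda>q. indicator D q *\<^sub>R (1 * snd q ^ 0 * defect q ^ 0 * w q))
    (Beta (\<beta> + lam + 1 + real 0 + real 0 + real 0 / 2) (\<gamma> + 1)
      * (Gamma (\<mu> + real 0 + 1/2) / Gamma (lam + 1 + real 0 + real 0 / 2) * gauss_integral (\<lambda>y::'a. 1)))"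
    using gauss_integrable_poly[OF poly_upto_const[of 1 0]]
    by (intro has_bochner_integral_weight) (auto simp: homogeneous_def)
  then show ?thesis
    unfolding norm_const_def set_lebesgue_integral_def
    by (simp add: has_bochner_integral_iff mass_def gauss_integral_1)
qed

lemma w_nonneg:
  assumes "q \<in> D" "q \<noteq> 0" shows "w q \<ge> 0"
  using D_height_pos[OF assms] w[of "snd q" "fst q"] by simp

sublocale poly_inner D w
proof
  fix n :: nat and f g :: "'a \<times> real \<Rightarrow> real"
  assume "f \<in> poly_upto n" "g \<in> poly_upto n"
  then show "set_integrable lborel D (\<lambda>p. f p * g p * w p)"
    by (intro set_integrable_poly[where n = "n + n"] poly_upto_mult)
next
  fix n :: nat and f :: "'a \<times> real \<Rightarrow> real"
  assume f: "f \<in> poly_upto n"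
  define F where "F q = indicator D q *\<^sub>R (f q * f q * w q)" for q
  have AE_nonneg: "AE q in lborel. F q \<ge> 0"
    using AE_lborel_singleton[of "0 :: 'a \<times> real"]
    by eventually_elim (auto simp: F_def indicator_def intro!: mult_nonneg_nonneg[OF zero_le_square] w_nonneg)
  have integrable: "integrable lborel F"
    using set_integrable_poly[OF poly_upto_mult[OF f f]] unfolding set_integrable_def F_def .
  have inner: "weighted_inner D w f f = (LINT q|lborel. F q) / mass"
    by (simp add: weighted_inner_def norm_const_eq set_lebesgue_integral_def F_def)
  show "weighted_inner D w f f \<ge> 0"
    unfolding inner using mass_pos AE_nonneg by (intro divide_nonneg_pos integral_nonneg_AE)
  fix p assume "weighted_inner D w f f = 0"
  then have "(LINT q|lborel. F q) = 0" using inner mass_pos by simp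
  then have AE0: "AE q in lborel. F q = 0"
    using integral_nonneg_eq_0_iff_AE[OF integrable AE_nonneg] by simp
  \<comment> \<open>On this open set the weight is strictly positive, so a polynomial of norm zero
    vanishes on it almost everywhere, hence everywhere on it, hence identically.\<close>
  define U where "U = {q :: 'a \<times> real. (norm (fst q))\<^sup>2 < snd q \<and> snd q < 1}"
  have U: "open U"
    unfolding U_def by (intro open_Collect_conj open_Collect_less continuous_intros)
  have "AE q in lborel. q \<in> U \<longrightarrow> f q = 0"
    using AE0
  proof eventually_elim
    case (elim q)
    show ?case
    proof
      assume q: "q \<in> U"
      obtain y s where ys: "q = (y, s)" by (cases q)
      have lt: "(norm y)\<^sup>2 < s" "s < 1" using q by (auto simp: U_def ys)
      then have "s > 0" using zero_le_power2[of "norm y"] by linarith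
      then have "w q > 0" using lt by (simp add: ys w)
      moreover have "q \<in> D" using lt by (simp add: D ys)
      ultimately show "f q = 0" using elim by (simp add: F_def)
    qed
  qed
  then have zero: "f q = 0" if "q \<in> U" for q
    by (rule open_AE_zero[OF _ U poly_upto_continuous[OF f] that])
  have "(0, 1/2) \<in> U" by (simp add: U_def)
  from poly_upto_zero_on_open[OF f U this zero] show "f p = 0" .
qed

definition mean :: "('a \<times> real \<Rightarrow> real) \<Rightarrow> real" where
  "mean F = weighted_inner D w F (\<lambda>_. 1)"

lemma inner_eq_mean: "weighted_inner D w f g = mean (\<lambda>q. f q * g q)"
  by (simp add: mean_def weighted_inner_def)

lemma mean_add:
  "f \<in> poly_upto n \<Longrightarrow> g \<in> poly_upto n \<Longrightarrow> mean (\<lambda>q. f q + g q) = mean f + mean g"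
  unfolding mean_def by (intro inn_add_left poly_upto_const)

lemma mean_scale: "mean (\<lambda>q. r * F q) = r * mean F"
  by (simp add: mean_def inn_scale_left)

lemma mean_sum:
  assumes "\<And>i. i \<in> I \<Longrightarrow> f i \<in> poly_upto n"
  shows "mean (\<lambda>q. \<Sum>i\<in>I. f i q) = (\<Sum>i\<in>I. mean (f i))"
  unfolding mean_def using assms by (intro inn_sum_left poly_upto_const)

text \<open>The mean of s^z for the height marginal, whose density is proportional to s^(\<beta> +
  lam) (1 - s)^\<gamma>. Only the sum \<beta> + lam enters, so the values agree for the two
  domains.\<close>

definition beta_moment :: "real \<Rightarrow> real" where
  "beta_moment z = Beta (\<beta> + lam + 1 + z) (\<gamma> + 1) / Beta (\<beta> + lam + 1) (\<gamma> + 1)"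

lemma mean_homogeneous:
  assumes p: "homogeneous m p" "p \<in> poly_upto n"
  shows "mean (\<lambda>(y, s). p y * s ^ r * (s - (norm y)\<^sup>2) ^ h)
    = beta_moment (real r + real h + real m / 2)
      * (Gamma (\<mu> + real h + 1/2) / Gamma (\<mu> + 1/2) * (Gamma (lam + 1) / Gamma (lam + 1 + real h + real m / 2)) * normal_mean p)"
proof -
  have "has_bochner_integral lborel (\<lambda>q. indicator D q *\<^sub>R (p (fst q) * snd q ^ r * defect q ^ h * w q))
    (Beta (\<beta> + lam + 1 + real r + real h + real m / 2) (\<gamma> + 1)
      * (Gamma (\<mu> + real h + 1/2) / Gamma (lam + 1 + real h + real m / 2) * gauss_integral p))"
    using p by (intro has_bochner_integral_weight gauss_integrable_poly poly_upto_measurable)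
  then have "(LINT q:D|lborel. p (fst q) * snd q ^ r * defect q ^ h * w q)
     = Beta (\<beta> + lam + 1 + real r + real h + real m / 2) (\<gamma> + 1)
      * (Gamma (\<mu> + real h + 1/2) / Gamma (lam + 1 + real h + real m / 2) * gauss_integral p)"
    unfolding set_lebesgue_integral_def by (rule has_bochner_integral_integral_eq)
  then show ?thesis
    by (simp add: mean_def weighted_inner_def norm_const_eq case_prod_unfold mass_def beta_moment_def
        normal_mean_def add.assoc mult_ac)
qed

end

section \<open>The averaging operator and its adjoint\<close>

lemma normal_mean_power: "normal_mean (\<lambda>x::real. x ^ a) = gauss_moment a"
  using normal_mean_monomial[of "\<lambda>_::real. a"] by (simp add: monomial_real[abs_def])

lemma poly_upto_fst_inner: "(\<lambda>q :: 'a::euclidean_space \<times> real. X \<bullet> fst q) \<in> poly_upto 1"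
  using poly_upto_inner[of "(X, 0::real)"] by (simp add: inner_prod_def inner_commute)

lemma poly_upto_snd: "(\<lambda>q :: 'a::euclidean_space \<times> real. snd q) \<in> poly_upto 1"
  using poly_upto_inner[of "(0 :: 'a, 1::real)"] by (simp add: inner_prod_def)

lemma poly_upto_fst_power: "(\<lambda>q :: real \<times> real. fst q ^ k) \<in> poly_upto k"
  using poly_upto_power[OF poly_upto_fst_inner[of "1::real"], of k] by simp

lemma poly_upto_snd_power: "(\<lambda>q :: 'a::euclidean_space \<times> real. snd q ^ k) \<in> poly_upto k"
  using poly_upto_power[OF poly_upto_snd, of k] by simp

lemma poly_upto_monomial_fst:
  "(\<lambda>q :: 'a::euclidean_space \<times> real. monomial \<kappa> (fst q)) \<in> poly_upto (\<Sum>b\<in>Basis. \<kappa> b)"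
proof -
  have "(\<lambda>q :: 'a \<times> real. \<Prod>b\<in>S. (b \<bullet> fst q) ^ \<kappa> b) \<in> poly_upto (\<Sum>b\<in>S. \<kappa> b)" if "finite S" for S
    using that
  proof (induction S rule: finite_induct)
    case (insert b S)
    then show ?case
      using poly_upto_mult[OF poly_upto_power[OF poly_upto_fst_inner[of b], of "\<kappa> b"] insert.IH] by simp
  qed (simp add: poly_upto_const)
  from this[of Basis] show ?thesis by (simp add: monomial_def inner_commute)
qed

lemma poly_upto_defect: "(\<lambda>q :: 'a::euclidean_space \<times> real. defect q) \<in> poly_upto 2"
proof -
  have "(\<lambda>q :: 'a \<times> real. snd q + (- 1) * (\<Sum>b\<in>Basis. (b \<bullet> fst q) * (b \<bullet> fst q))) \<in> poly_upto 2"
    using poly_upto_mult[OF poly_upto_fst_inner poly_upto_fst_inner]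
    by (intro poly_upto_add poly_upto_scale poly_upto_sum poly_upto_mono[OF poly_upto_snd]) (auto simp: numeral_2_eq_2)
  then show ?thesis
    by (simp add: power2_norm_eq_inner euclidean_inner[of "fst _" "fst _"] inner_commute)
qed

context parabolic_weight
begin

text \<open>For \<open>\<parallel>y\<parallel>\<^sup>2 \<le> s\<close> this is the mean of \<open>(X \<bullet> y + u B (s - \<parallel>y\<parallel>\<^sup>2)\<^bsup>1/2\<^esup>)\<^sup>k\<close> over \<open>u\<close>; the square
  root disappears because odd moments vanish.\<close>

definition ridge_poly :: "'a \<Rightarrow> real \<Rightarrow> nat \<Rightarrow> 'a \<times> real \<Rightarrow> real" where
  "ridge_poly X B k q = (\<Sum>l\<le>k. real (k choose l) * (B ^ l * geg_moment (\<mu> - 1/2) l)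
      * ((X \<bullet> fst q) ^ (k - l) * defect q ^ (l div 2)))"

text \<open>The average of (sqrt s \<xi>)^i over all variables, a polynomial in (y, s): the power i
  - k of sqrt s is multiplied by \<open>geg_moment \<beta> (i - k)\<close>, which vanishes for odd i
  - k, so the exponent may be halved with rounding.\<close>

definition kernel_poly :: "'a \<Rightarrow> real \<Rightarrow> nat \<Rightarrow> 'a \<times> real \<Rightarrow> real" where
  "kernel_poly X B i q = z_transform lam \<beta> (\<lambda>k. snd q ^ ((i - k) div 2) * ridge_poly X B k q) i"

lemma ridge_term_in_poly_upto:
  assumes "l \<le> k"
  shows "(\<lambda>q :: 'a \<times> real. (X \<bullet> fst q) ^ (k - l) * defect q ^ (l div 2)) \<in> poly_upto k"
proof (rule poly_upto_mono)
  show "(\<lambda>q :: 'a \<times> real. (X \<bullet> fst q) ^ (k - l) * defect q ^ (l div 2))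
      \<in> poly_upto ((k - l) * 1 + (l div 2) * 2)"
    by (intro poly_upto_mult poly_upto_power poly_upto_defect poly_upto_fst_inner)
  show "(k - l) * 1 + (l div 2) * 2 \<le> k" using assms by linarith
qed

lemma ridge_poly_in_poly_upto: "ridge_poly X B k \<in> poly_upto k"
  unfolding ridge_poly_def[abs_def]
  by (intro poly_upto_sum poly_upto_scale ridge_term_in_poly_upto) auto

lemma kernel_term_in_poly_upto:
  assumes "k \<le> i" shows "(\<lambda>q. snd q ^ ((i - k) div 2) * ridge_poly X B k q) \<in> poly_upto i"
  using assms by (intro poly_upto_mono[OF poly_upto_mult[OF poly_upto_snd_power ridge_poly_in_poly_upto]]) linarith

lemma kernel_poly_in_poly_upto: "kernel_poly X B i \<in> poly_upto i"
  unfolding kernel_poly_def[abs_def] z_transform_def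
  by (intro poly_upto_sum poly_upto_scale kernel_term_in_poly_upto) auto

lemma mean_z_transform:
  assumes "\<And>k. k \<le> i \<Longrightarrow> (\<lambda>q. f k q * g q) \<in> poly_upto n"
  shows "mean (\<lambda>q. z_transform a b (\<lambda>k. f k q) i * g q) = z_transform a b (\<lambda>k. mean (\<lambda>q. f k q * g q)) i"
proof -
  have "mean (\<lambda>q. z_transform a b (\<lambda>k. f k q) i * g q)
     = mean (\<lambda>q. \<Sum>k\<le>i. real (i choose k) * (pochhammer (a + 1) k * pochhammer b (i - k)
         / pochhammer (a + b + 1) i) * geg_moment b (i - k) * (f k q * g q))"
    by (simp only: z_transform_def sum_distrib_right mult.assoc)
  also have "\<dots> = (\<Sum>k\<le>i. mean (\<lambda>q. real (i choose k) * (pochhammer (a + 1) k * pochhammer b (i - k)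
         / pochhammer (a + b + 1) i) * geg_moment b (i - k) * (f k q * g q)))"
    using assms by (intro mean_sum[where n = n] poly_upto_scale) auto
  finally show ?thesis by (simp only: z_transform_def mean_scale)
qed

text \<open>All surviving terms scale with the same power r + (i + j)/2 of the height, so one
  \<open>beta_moment\<close> comes out in front. The Gamma quotient in \<mu> turns the u-moment into
  a Gaussian moment, and together with the Gaussian mean in y this is a
  \<open>ridge_mean\<close>.\<close>

lemma mean_kernel_poly:
  assumes X: "(norm X)\<^sup>2 + B\<^sup>2 = 1"
  shows "mean (\<lambda>q. kernel_poly X B i q * (monomial \<kappa> (fst q) * snd q ^ r))
    = beta_moment (real r + real (i + (\<Sum>b\<in>Basis. \<kappa> b)) / 2)
      * z_transform lam \<beta> (\<lambda>k. gamma_quot lam (k + (\<Sum>b\<in>Basis. \<kappa> b))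
          * ridge_mean X B k (monomial \<kappa>)) i"
proof -
  define j where "j = (\<Sum>b\<in>(Basis :: 'a set). \<kappa> b)"
  define bm where "bm = beta_moment (real r + real (i + j) / 2)"
  define g where "g q = monomial \<kappa> (fst q) * snd q ^ r" for q :: "'a \<times> real"
  have g: "g \<in> poly_upto (j + r)"
    unfolding g_def j_def by (intro poly_upto_mult poly_upto_monomial_fst poly_upto_snd_power)
  define T where "T k l = mean (\<lambda>q. snd q ^ ((i - k) div 2) * ((X \<bullet> fst q) ^ (k - l) * defect q ^ (l div 2)) * g q)" for k l
  define c where "c k l = real (k choose l) * (B ^ l * geg_moment (\<mu> - 1/2) l)" for k l
  have T: "T k l = bm * (Gamma (\<mu> + 1/2 + real l / 2) / Gamma (\<mu> + 1/2) * gamma_quot lam (k + j)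
      * normal_mean (\<lambda>y. (X \<bullet> y) ^ (k - l) * monomial \<kappa> y))"
    \<comment> \<open>With both parities even, the halved exponents are exact and add up to the
      common scaling power.\<close>
    if kl: "k \<le> i" "l \<le> k" "even l" "even (i - k)" for k l
  proof -
    define p where "p y = (X \<bullet> y) ^ (k - l) * monomial \<kappa> y" for y
    have p: "homogeneous (k - l + j) p"
      unfolding p_def j_def by (intro homogeneous_mult homogeneous_inner_power homogeneous_monomial)
    have "(monomial \<kappa> :: 'a \<Rightarrow> real) \<in> poly_upto j"
      unfolding j_def by (rule monomial_in_poly_upto_degree)
    then have p_poly: "p \<in> poly_upto (k - l + j)"
      unfolding p_def by (intro poly_upto_mult poly_upto_inner_power)
    have "T k l = mean (\<lambda>(y, s). p y * s ^ (r + (i - k) div 2) * (s - (norm y)\<^sup>2) ^ (l div 2))"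
      unfolding T_def g_def p_def case_prod_unfold by (intro arg_cong[where f = mean] ext) (simp add: power_add mult_ac)
    also have "\<dots> = beta_moment (real (r + (i - k) div 2) + real (l div 2) + real (k - l + j) / 2)
      * (Gamma (\<mu> + real (l div 2) + 1/2) / Gamma (\<mu> + 1/2)
          * (Gamma (lam + 1) / Gamma (lam + 1 + real (l div 2) + real (k - l + j) / 2)) * normal_mean p)"
      by (rule mean_homogeneous[OF p p_poly])
    also have "real (r + (i - k) div 2) + real (l div 2) + real (k - l + j) / 2 = real r + real (i + j) / 2"
      using kl by (simp add: real_of_nat_div of_nat_diff field_simps)
    also have "\<mu> + real (l div 2) + 1/2 = \<mu> + 1/2 + real l / 2"
      using kl by (simp add: real_of_nat_div)
    also have "lam + 1 + real (l div 2) + real (k - l + j) / 2 = lam + 1 + real (k + j) / 2"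
      using kl by (simp add: real_of_nat_div of_nat_diff field_simps)
    finally show ?thesis unfolding bm_def p_def .
  qed
  have row: "mean (\<lambda>q. snd q ^ ((i - k) div 2) * ridge_poly X B k q * g q) = (\<Sum>l\<le>k. c k l * T k l)" if "k \<le> i" for k
  proof -
    have "mean (\<lambda>q. snd q ^ ((i - k) div 2) * ridge_poly X B k q * g q)
        = mean (\<lambda>q. \<Sum>l\<le>k. c k l * (snd q ^ ((i - k) div 2) * ((X \<bullet> fst q) ^ (k - l) * defect q ^ (l div 2)) * g q))"
      unfolding ridge_poly_def c_def[symmetric] sum_distrib_left sum_distrib_right
      by (intro arg_cong[where f = mean] ext sum.cong refl) (simp only: mult_ac)
    also have "\<dots> = (\<Sum>l\<le>k. mean (\<lambda>q. c k l * (snd q ^ ((i - k) div 2) * ((X \<bullet> fst q) ^ (k - l) * defect q ^ (l div 2)) * g q)))"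
      by (intro mean_sum[where n = "(i - k) div 2 + k + (j + r)"] poly_upto_scale poly_upto_mult poly_upto_snd_power ridge_term_in_poly_upto g) auto
    finally show ?thesis by (simp only: mean_scale T_def)
  qed
  have G\<mu>: "Gamma (\<mu> + 1/2 + real l / 2) > 0" "Gamma (\<mu> + 1/2) > 0" for l
  proof -
    have "\<mu> + 1/2 > 0" using \<mu> by simp
    moreover from this have "\<mu> + 1/2 + real l / 2 > 0" by (rule add_pos_nonneg) simp
    ultimately show "Gamma (\<mu> + 1/2 + real l / 2) > 0" "Gamma (\<mu> + 1/2) > 0" by simp_all
  qed
  have cT: "c k l * T k l = bm * (gamma_quot lam (k + j)
      * (real (k choose l) * (B ^ l * gauss_moment l) * normal_mean (\<lambda>y. (X \<bullet> y) ^ (k - l) * monomial \<kappa> y)))"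
    if kl: "k \<le> i" "l \<le> k" "even (i - k)" for k l
  proof (cases "even l")
    case True
    have "geg_moment (\<mu> - 1/2) l * (Gamma (\<mu> + 1/2 + real l / 2) / Gamma (\<mu> + 1/2)) = gauss_moment l"
      using G\<mu>(1)[of l] G\<mu>(2) by (simp add: geg_moment_def add_ac)
    moreover have "C * (P * m) * (b * (G / H * K * N)) = b * (K * (C * (P * g) * N))" if "m * (G / H) = g"
      for C P m b G H K N g :: real
      unfolding that[symmetric] by (simp only: mult_ac)
    ultimately show ?thesis
      unfolding c_def T[OF kl(1,2) True kl(3)] by blast
  next
    case False
    then show ?thesis by (simp add: c_def geg_moment_odd gauss_moment_odd)
  qed
  \<comment> \<open>The factor \<open>geg_moment \<beta> (i - k)\<close> is kept on both sides
    because it annihilates the odd rows, where the rounded exponent would not scale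
    correctly.\<close>
  have row': "geg_moment \<beta> (i - k) * mean (\<lambda>q. snd q ^ ((i - k) div 2) * ridge_poly X B k q * g q)
      = geg_moment \<beta> (i - k) * (bm * (gamma_quot lam (k + j) * ridge_mean X B k (monomial \<kappa>)))"
    if k: "k \<le> i" for k
  proof (cases "even (i - k)")
    case True
    have "mean (\<lambda>q. snd q ^ ((i - k) div 2) * ridge_poly X B k q * g q) = (\<Sum>l\<le>k. c k l * T k l)"
      by (rule row[OF k])
    also have "\<dots> = bm * (gamma_quot lam (k + j) * ridge_mean X B k (monomial \<kappa>))"
      unfolding ridge_mean_def sum_distrib_left by (intro sum.cong refl cT k True) simp
    finally show ?thesis by simp
  qed (simp add: geg_moment_odd)
  have "mean (\<lambda>q. kernel_poly X B i q * g q)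
      = z_transform lam \<beta> (\<lambda>k. mean (\<lambda>q. snd q ^ ((i - k) div 2) * ridge_poly X B k q * g q)) i"
    unfolding kernel_poly_def
    by (intro mean_z_transform[where n = "i + (j + r)"] poly_upto_mult kernel_term_in_poly_upto g)
  also have "\<dots> = z_transform lam \<beta> (\<lambda>k. bm * (gamma_quot lam (k + j) * ridge_mean X B k (monomial \<kappa>))) i"
  proof -
    have cong: "a * g * M = a * g * N" if "g * M = g * N" for a g M N :: real
      using that by (simp only: mult.assoc)
    show ?thesis
      unfolding z_transform_def by (intro sum.cong refl cong row') simp
  qed
  finally show ?thesis by (simp only: z_transform_scale g_def bm_def j_def)
qed

text \<open>The adjoint of the u-average on the ball followed by that of the z-average. The
  coefficients \<open>c\<close> do not depend on i or r, and it is this uniformity that makes them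
  describe the adjoint.\<close>

lemma mean_kernel_poly_adjoint:
  assumes X: "(norm X)\<^sup>2 + B\<^sup>2 = 1" and lam: "lam \<ge> 0" and j: "j = (\<Sum>b\<in>(Basis :: 'a set). \<kappa> b)"
  obtains c where "(\<Sum>l\<le>j div 2. c l) = monomial \<kappa> X"
    "\<And>i r. mean (\<lambda>q. kernel_poly X B i q * (monomial \<kappa> (fst q) * snd q ^ r))
        = (\<Sum>l\<le>j div 2. c l * (beta_moment (real r + real (i + j) / 2) * geg_moment (lam + \<beta>) (i + (j - 2 * l))))"
proof -
  have "geg_represents lam j (monomial \<kappa> X)
    (\<lambda>k. gamma_quot lam (k + j) * ridge_mean X B k (monomial \<kappa>))"
    using lam j by (intro geg_represents_ridge_mean X) auto
  then have "geg_represents (lam + \<beta>) j (monomial \<kappa> X) (z_transform lam \<beta>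
    (\<lambda>k. gamma_quot lam (k + j) * ridge_mean X B k (monomial \<kappa>)))"
    by (rule geg_represents_z_transform[OF _ lam \<beta>])
  then obtain c where c: "(\<Sum>l\<le>j div 2. c l) = monomial \<kappa> X"
    "\<And>i. z_transform lam \<beta> (\<lambda>k. gamma_quot lam (k + j) * ridge_mean X B k (monomial \<kappa>)) i
       = (\<Sum>l\<le>j div 2. c l * geg_moment (lam + \<beta>) (i + (j - 2 * l)))"
    unfolding geg_represents_def by blast
  show ?thesis
  proof (rule that[OF c(1)])
    show "mean (\<lambda>q. kernel_poly X B i q * (monomial \<kappa> (fst q) * snd q ^ r))
        = (\<Sum>l\<le>j div 2. c l * (beta_moment (real r + real (i + j) / 2) * geg_moment (lam + \<beta>) (i + (j - 2 * l))))" for i r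
      unfolding mean_kernel_poly[OF X] j[symmetric] c(2) sum_distrib_left
      by (intro sum.cong refl) (simp only: mult_ac)
  qed
qed

end

section \<open>The kernel identity before the averages are written as integrals\<close>

lemma parabolic_weight_U:
  assumes "\<gamma> > -1" "\<alpha> > -1/2"
  shows "parabolic_weight parabolic_domain (U_weight \<gamma> \<alpha>) 0 \<gamma> \<alpha>"
proof
  show "parabolic_domain = {(y, s). (norm y)\<^sup>2 \<le> s \<and> s \<le> 1}" by (simp add: parabolic_domain_def)
  show "U_weight \<gamma> \<alpha> (y, s) = s powr 0 * (1 - s) powr \<gamma> * (s - (norm y)\<^sup>2) powr (\<alpha> - 1 / 2)" if "s > 0" for y s
    using that by (simp add: U_weight_def)
  show "U_weight \<gamma> \<alpha> \<in> borel_measurable borel" unfolding U_weight_def case_prod_unfold by measurable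
qed (use assms in auto)

context parabolic_weight
begin

lemma repro_kernel_eq_kernel_poly:
  fixes c :: "(real \<times> real \<Rightarrow> nat) \<Rightarrow> real"
  assumes lam: "lam \<ge> 0" and t: "t > 0" and X: "x = sqrt t *\<^sub>R X" "(norm X)\<^sup>2 + B\<^sup>2 = 1"
    and K: "\<And>q. repro_kernel parabolic_domain (U_weight \<gamma> (lam + \<beta>)) n (sqrt t, t) q
        = (\<Sum>k\<in>multi_indices n. c k * (fst q ^ k (1, 0) * snd q ^ k (0, 1)))"
  shows "repro_kernel D w n (x, t) q = (\<Sum>k\<in>multi_indices n. c k * (kernel_poly X B (k (1, 0)) q * snd q ^ k (0, 1)))"
proof -
  define \<alpha> where "\<alpha> = lam + \<beta>"
  \<comment> \<open>The planar domain is the same kind of weighted domain with base dimension 1 and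
    no height factor, so its \<open>lam\<close> is \<alpha> itself and all moment formulas apply to
    both sides.\<close>
  interpret U: parabolic_weight parabolic_domain "U_weight \<gamma> \<alpha>" 0 \<gamma> \<alpha>
    by (rule parabolic_weight_U) (use \<gamma> lam \<beta> in \<open>auto simp: \<alpha>_def\<close>)
  have U_lam: "U.lam = \<alpha>" by (simp add: U.lam_def)
  have bm: "U.beta_moment z = beta_moment z" for z
    unfolding U.beta_moment_def beta_moment_def U_lam by (simp add: \<alpha>_def add_ac)
  have U_mean: "U.mean (\<lambda>q. fst q ^ a * snd q ^ b) = beta_moment (real b + real a / 2) * geg_moment \<alpha> a" for a b
  proof -
    have "(\<lambda>x::real. x ^ a) \<in> poly_upto a" using poly_upto_inner_power[of "1::real" a] by simp
    moreover have "homogeneous a (\<lambda>x::real. x ^ a)" by (simp add: homogeneous_def power_mult_distrib)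
    moreover have "Gamma (\<alpha> + 1/2) > 0" using lam \<beta> by (intro Gamma_real_pos) (simp add: \<alpha>_def)
    ultimately show ?thesis
      using U.mean_homogeneous[of a "\<lambda>x. x ^ a" a b 0]
      by (simp add: case_prod_unfold bm U_lam normal_mean_power geg_moment_def mult.commute)
  qed
  \<comment> \<open>\<open>kp k\<close> is T applied to the planar monomial \<open>um k\<close>;
    adjointness has to be checked on these only.\<close>
  define kp where "kp k q = kernel_poly X B (k (1, 0)) q * snd q ^ k (0, 1)" for k :: "real \<times> real \<Rightarrow> nat" and q
  define um where "um k q = fst q ^ k (1, 0) * snd q ^ k (0, 1)" for k :: "real \<times> real \<Rightarrow> nat" and q :: "real \<times> real"
  have Basis2: "(Basis :: (real \<times> real) set) = {(1, 0), (0, 1)}" by (auto simp: Basis_prod_def)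
  have deg: "k (1, 0) + k (0, 1) \<le> m" if "k \<in> multi_indices m" for k :: "real \<times> real \<Rightarrow> nat" and m
    using that by (simp add: multi_indices_def Basis2)
  have kp: "kp k \<in> poly_upto m" if "k \<in> multi_indices m" for k m
    unfolding kp_def using deg[OF that]
    by (intro poly_upto_mono[OF poly_upto_mult[OF kernel_poly_in_poly_upto poly_upto_snd_power]])
  have um_mono: "um k = monomial k" for k
    by (auto simp: um_def fun_eq_iff monomial_Pair monomial_real)
  have um: "um k \<in> poly_upto m" if "k \<in> multi_indices m" for k m
    unfolding um_mono using that by (rule monomial_in_poly_upto)
  have adjoint: "\<exists>Q'\<in>poly_upto m. Q' (sqrt t, t) = Q (x, t) \<and> (\<forall>k. mean (\<lambda>q. kp k q * Q q) = U.mean (\<lambda>q. um k q * Q' q))"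
    if "Q \<in> poly_upto m" for Q m
    using that
  proof (induction rule: poly_upto_induct)
    case (monomial e)
    define \<kappa> where "\<kappa> b = e (b, 0)" for b :: 'a
    define r where "r = e (0, 1)"
    define j where "j = (\<Sum>b\<in>(Basis::'a set). \<kappa> b)"
    have jr: "j + r \<le> m"
    proof -
      have "(\<Sum>b\<in>Basis. e b) = (\<Sum>b\<in>(\<lambda>u. (u, 0)) ` Basis. e b) + (\<Sum>b\<in>(\<lambda>v. (0, v)) ` Basis. e b)"
        unfolding Basis_prod_def by (rule sum.union_disjoint) auto
      also have "(\<Sum>b\<in>(\<lambda>u. (u, 0)) ` Basis. e b) = j"
        unfolding j_def \<kappa>_def by (subst sum.reindex) (auto simp: inj_on_def)
      finally show ?thesis using monomial by (simp add: multi_indices_def r_def)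
    qed
    have mono: "monomial e q = monomial \<kappa> (fst q) * snd q ^ r" for q
      using monomial_Pair[of e "fst q" "snd q"] by (simp add: \<kappa>_def[abs_def] r_def)
    obtain d where d: "(\<Sum>l\<le>j div 2. d l) = monomial \<kappa> X"
      "\<And>i r. mean (\<lambda>q. kernel_poly X B i q * (monomial \<kappa> (fst q) * snd q ^ r))
        = (\<Sum>l\<le>j div 2. d l * (beta_moment (real r + real (i + j) / 2) * geg_moment (lam + \<beta>) (i + (j - 2 * l))))"
      using mean_kernel_poly_adjoint[OF X(2) lam j_def] by blast
    \<comment> \<open>The exponent l + r of the height compensates the loss of 2l in the first
      variable: the degree stays at most j + r, and at (sqrt t, t) every term carries the same power
      of t, leaving the sum of the \<open>d l\<close>.\<close>
    define Q' where "Q' q = (\<Sum>l\<le>j div 2. d l * (fst q ^ (j - 2 * l) * snd q ^ (l + r)))" for q :: "real \<times> real"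
    have term_poly: "(\<lambda>q :: real \<times> real. fst q ^ (j - 2 * l) * snd q ^ (l + r)) \<in> poly_upto m" if "l \<le> j div 2" for l
      using jr that by (intro poly_upto_mono[OF poly_upto_mult[OF poly_upto_fst_power poly_upto_snd_power]]) auto
    have "Q' \<in> poly_upto m"
      unfolding Q'_def by (intro poly_upto_sum poly_upto_scale term_poly) auto
    moreover have "Q' (sqrt t, t) = monomial e (x, t)"
    proof -
      have "d l * (sqrt t ^ (j - 2 * l) * t ^ (l + r)) = sqrt t ^ j * t ^ r * d l" if "l \<le> j div 2" for l
      proof -
        have "sqrt t ^ j = sqrt t ^ (j - 2 * l) * (sqrt t ^ 2) ^ l"
          using that by (simp flip: power_mult power_add)
        then show ?thesis using t by (simp add: power_add)
      qed
      then have "Q' (sqrt t, t) = sqrt t ^ j * t ^ r * (\<Sum>l\<le>j div 2. d l)"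
        unfolding Q'_def sum_distrib_left by (intro sum.cong) auto
      also have "\<dots> = monomial e (x, t)"
        unfolding d(1) using homogeneous_monomial[of \<kappa>] t by (simp add: mono X(1) homogeneous_def j_def)
      finally show ?thesis .
    qed
    moreover have "mean (\<lambda>q. kp k q * monomial e q) = U.mean (\<lambda>q. um k q * Q' q)" for k
    proof -
      define i where "i = k (1, 0)"
      define r' where "r' = k (0, 1)"
      define M where "M l q = fst q ^ (i + (j - 2 * l)) * snd q ^ (r' + (l + r))" for l and q :: "real \<times> real"
      have "mean (\<lambda>q. kp k q * monomial e q) = mean (\<lambda>q. kernel_poly X B i q * (monomial \<kappa> (fst q) * snd q ^ (r + r')))"
        by (simp add: kp_def mono i_def r'_def power_add mult_ac)
      also have "\<dots> = (\<Sum>l\<le>j div 2. d l * (beta_moment (real (r + r') + real (i + j) / 2) * geg_moment \<alpha> (i + (j - 2 * l))))"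
        unfolding d(2) \<alpha>_def ..
      also have "\<dots> = (\<Sum>l\<le>j div 2. U.mean (\<lambda>q. d l * M l q))"
      proof (rule sum.cong[OF refl])
        fix l assume "l \<in> {..j div 2}"
        then have "2 * l \<le> j" by auto
        then have "real (r' + (l + r)) + real (i + (j - 2 * l)) / 2 = real (r + r') + real (i + j) / 2"
          by (simp add: of_nat_diff field_simps)
        then show "d l * (beta_moment (real (r + r') + real (i + j) / 2) * geg_moment \<alpha> (i + (j - 2 * l)))
          = U.mean (\<lambda>q. d l * M l q)"
          by (simp only: U.mean_scale U_mean M_def)
      qed
      also have "\<dots> = U.mean (\<lambda>q. \<Sum>l\<le>j div 2. d l * M l q)"
      proof (rule U.mean_sum[symmetric])
        fix l assume "l \<in> {..j div 2}"
        then show "(\<lambda>q. d l * M l q) \<in> poly_upto (i + j + (r' + (j + r)))"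
          unfolding M_def
          by (intro poly_upto_scale poly_upto_mono[OF poly_upto_mult[OF poly_upto_fst_power poly_upto_snd_power]]) auto
      qed
      also have "\<dots> = U.mean (\<lambda>q. um k q * Q' q)"
        unfolding um_def Q'_def M_def sum_distrib_left i_def r'_def
        by (intro arg_cong[where f = U.mean] ext sum.cong refl) (simp only: power_add mult_ac)
      finally show ?thesis .
    qed
    ultimately show ?case by blast
  next
    case zero
    have "mean (\<lambda>q. 0 * 0) = 0" "U.mean (\<lambda>q. 0 * 0) = 0" by (simp_all only: mean_scale U.mean_scale)
    then show ?case by (intro bexI[of _ "\<lambda>_. 0"]) (auto simp: poly_upto_0)
  next
    case (add f g)
    then obtain f' g' where f': "f' \<in> poly_upto m" "f' (sqrt t, t) = f (x, t)" "\<And>k. mean (\<lambda>q. kp k q * f q) = U.mean (\<lambda>q. um k q * f' q)"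
      and g': "g' \<in> poly_upto m" "g' (sqrt t, t) = g (x, t)" "\<And>k. mean (\<lambda>q. kp k q * g q) = U.mean (\<lambda>q. um k q * g' q)"
      by blast
    have "mean (\<lambda>q. kp k q * (f q + g q)) = U.mean (\<lambda>q. um k q * (f' q + g' q))" for k
    proof -
      have k: "kp k \<in> poly_upto (k (1, 0) + k (0, 1))" "um k \<in> poly_upto (k (1, 0) + k (0, 1))"
        unfolding kp_def um_def
        by (intro poly_upto_mult kernel_poly_in_poly_upto poly_upto_snd_power poly_upto_fst_power)+
      show ?thesis
        unfolding distrib_left mean_add[OF poly_upto_mult[OF k(1) add(1)] poly_upto_mult[OF k(1) add(2)]]
          U.mean_add[OF poly_upto_mult[OF k(2) f'(1)] poly_upto_mult[OF k(2) g'(1)]]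
        by (simp only: f'(3) g'(3))
    qed
    then show ?case
      using f'(1,2) g'(1,2) by (intro bexI[of _ "\<lambda>q. f' q + g' q"]) (auto intro: poly_upto_add)
  next
    case (scale f r)
    then obtain f' where f': "f' \<in> poly_upto m" "f' (sqrt t, t) = f (x, t)" "\<And>k. mean (\<lambda>q. kp k q * f q) = U.mean (\<lambda>q. um k q * f' q)"
      by blast
    have "mean (\<lambda>q. kp k q * (r * f q)) = U.mean (\<lambda>q. um k q * (r * f' q))" for k
      using f'(3)[of k] by (simp only: mult.left_commute[of "_ k _" r] mean_scale U.mean_scale)
    then show ?case
      using f'(1,2) by (intro bexI[of _ "\<lambda>q. r * f' q"]) (auto intro: poly_upto_scale)
  qed
  have sum_adjoint: "mean (\<lambda>q. (\<Sum>k\<in>multi_indices m'. e k * kp k q) * Q q) = U.mean (\<lambda>q. (\<Sum>k\<in>multi_indices m'. e k * um k q) * Q' q)"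
    if Q: "Q \<in> poly_upto m" "Q' \<in> poly_upto m" "\<And>k. mean (\<lambda>q. kp k q * Q q) = U.mean (\<lambda>q. um k q * Q' q)" for Q Q' m m' e
  proof -
    have "mean (\<lambda>q. (\<Sum>k\<in>multi_indices m'. e k * kp k q) * Q q) = mean (\<lambda>q. \<Sum>k\<in>multi_indices m'. e k * (kp k q * Q q))"
      by (simp only: sum_distrib_right mult.assoc)
    also have "\<dots> = (\<Sum>k\<in>multi_indices m'. mean (\<lambda>q. e k * (kp k q * Q q)))"
      by (intro mean_sum[where n = "m' + m"] poly_upto_scale poly_upto_mult kp Q(1))
    also have "\<dots> = (\<Sum>k\<in>multi_indices m'. U.mean (\<lambda>q. e k * (um k q * Q' q)))"
      by (simp only: mean_scale U.mean_scale Q(3))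
    also have "\<dots> = U.mean (\<lambda>q. \<Sum>k\<in>multi_indices m'. e k * (um k q * Q' q))"
      by (intro U.mean_sum[symmetric, where n = "m' + m"] poly_upto_scale poly_upto_mult um Q(2))
    finally show ?thesis by (simp only: sum_distrib_right mult.assoc)
  qed
  define F where "F q = (\<Sum>k\<in>multi_indices n. c k * kp k q)" for q
  define KU where "KU = repro_kernel parabolic_domain (U_weight \<gamma> \<alpha>) n (sqrt t, t)"
  have KU_eq: "KU q = (\<Sum>k\<in>multi_indices n. c k * um k q)" for q
    unfolding KU_def um_def \<alpha>_def by (rule K)
  have KU_orth: "KU \<in> orth_polys parabolic_domain (U_weight \<gamma> \<alpha>) n"
    unfolding KU_def by (rule U.repro_kernel_in_orth_polys)
  have F_mean: "mean (\<lambda>q. F q * Q q) = U.mean (\<lambda>q. KU q * Q' q)"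
    if "Q \<in> poly_upto m" "Q' \<in> poly_upto m" "\<And>k. mean (\<lambda>q. kp k q * Q q) = U.mean (\<lambda>q. um k q * Q' q)" for Q Q' m
    unfolding F_def KU_eq by (rule sum_adjoint[OF that])
  have "F q = repro_kernel D w n (x, t) q"
  proof (rule repro_kernel_unique)
    have "F \<in> poly_upto n" unfolding F_def by (intro poly_upto_sum poly_upto_scale kp)
    moreover have "weighted_inner D w F Q = 0" if Q: "m < n" "Q \<in> poly_upto m" for m Q
    proof -
      obtain Q' where Q': "Q' \<in> poly_upto m" "\<And>k. mean (\<lambda>q. kp k q * Q q) = U.mean (\<lambda>q. um k q * Q' q)"
        using adjoint[OF Q(2)] by blast
      have "weighted_inner D w F Q = U.inn KU Q'"
        unfolding inner_eq_mean U.inner_eq_mean by (rule F_mean[OF Q(2) Q'])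
      then show ?thesis using KU_orth Q(1) Q'(1) by (simp add: orth_polys_def)
    qed
    ultimately show "F \<in> orth_polys D w n" by (simp add: orth_polys_def)
  next
    fix Q assume Q_orth: "Q \<in> orth_polys D w n"
    then have Q: "Q \<in> poly_upto n" by (simp add: orth_polys_def)
    obtain Q' where Q': "Q' \<in> poly_upto n" "Q' (sqrt t, t) = Q (x, t)" "\<And>k. mean (\<lambda>q. kp k q * Q q) = U.mean (\<lambda>q. um k q * Q' q)"
      using adjoint[OF Q] by blast
    \<comment> \<open>The planar kernel reproduces elements of \<open>orth_polys\<close> only, so
      orthogonality of \<open>Q'\<close> must come first; it is inherited from \<open>Q\<close> by
      moving T onto \<open>f\<close>.\<close>
    have "U.inn Q' f = 0" if f: "m < n" "f \<in> poly_upto m" for m f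
    proof -
      obtain e where e: "f = (\<lambda>q. \<Sum>k\<in>multi_indices m. e k * um k q)"
        using f(2) unfolding poly_upto_iff um_mono by blast
      define Tf where "Tf q = (\<Sum>k\<in>multi_indices m. e k * kp k q)" for q
      have Tf: "Tf \<in> poly_upto m" unfolding Tf_def by (intro poly_upto_sum poly_upto_scale kp)
      have "U.inn Q' f = weighted_inner D w Q Tf"
        unfolding weighted_inner_commute[of _ _ Q'] weighted_inner_commute[of _ _ Q] inner_eq_mean U.inner_eq_mean e Tf_def
        by (rule sum_adjoint[OF Q Q'(1,3), symmetric])
      then show ?thesis using Q_orth f(1) Tf by (simp add: orth_polys_def)
    qed
    then have "Q' \<in> orth_polys parabolic_domain (U_weight \<gamma> \<alpha>) n" using Q'(1) by (simp add: orth_polys_def)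
    then have "U.inn KU Q' = Q' (sqrt t, t)"
      unfolding KU_def by (rule U.repro_kernel_reproduces)
    then show "weighted_inner D w F Q = Q (x, t)"
      unfolding inner_eq_mean U.inner_eq_mean Q'(2)[symmetric] using F_mean[OF Q Q'(1,3)] by simp
  qed
  then show ?thesis unfolding F_def kp_def by simp
qed

end

section \<open>The averaging integrals\<close>

lemma has_bochner_integral_prod:
  fixes f :: "'a::euclidean_space \<Rightarrow> real" and g :: "'b::euclidean_space \<Rightarrow> real"
  assumes f: "has_bochner_integral lborel f u" and g: "has_bochner_integral lborel g v"
  shows "has_bochner_integral lborel (\<lambda>q. f (fst q) * g (snd q)) (u * v)"
proof -
  have [measurable]: "f \<in> borel_measurable borel" "g \<in> borel_measurable borel"
    using f g by (auto simp: has_bochner_integral_iff dest!: borel_measurable_integrable)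
  have i: "integrable lborel f" "integrable lborel g" "integral\<^sup>L lborel f = u" "integral\<^sup>L lborel g = v"
    using f g by (auto simp: has_bochner_integral_iff)
  have int: "integrable (lborel \<Otimes>\<^sub>M lborel) (\<lambda>q. f (fst q) * g (snd q))"
    using i by (intro lborel_pair.Fubini_integrable) (auto simp: norm_mult abs_mult)
  have "(\<integral>q. f (fst q) * g (snd q) \<partial>(lborel \<Otimes>\<^sub>M lborel)) = u * v"
    using lborel_pair.integral_fst'[OF int] i by simp
  then show ?thesis using int by (simp add: has_bochner_integral_iff lborel_prod)
qed

lemma has_bochner_integral_Beta:
  fixes a b :: real
  assumes "a > 0" "b > 0"
  shows "has_bochner_integral lborel (\<lambda>t. indicator {0..1} t * (t powr (a - 1) * (1 - t) powr (b - 1))) (Beta a b)"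
proof (rule has_bochner_integral_nn_integral)
  show "(\<integral>\<^sup>+t. ennreal (indicator {0..1} t * (t powr (a - 1) * (1 - t) powr (b - 1))) \<partial>lborel) = ennreal (Beta a b)"
    using assms by (intro nn_integral_has_integral_lebesgue has_integral_Beta_real) auto
  show "Beta a b \<ge> 0"
    unfolding Beta_def using assms by (intro divide_nonneg_nonneg mult_nonneg_nonneg Gamma_real_nonneg) auto
qed (auto simp: indicator_def)

text \<open>The substitution z = 1 - 2a gives a Beta integral with both parameters shifted by
  integers, and the quotient of two such Beta values is a quotient of Pochhammer symbols.\<close>

lemma z1_integral:
  fixes \<kappa> \<beta> :: real
  assumes "\<kappa> > -1" "\<beta> > 0"
  shows "has_bochner_integral lborel
      (\<lambda>z. indicator {-1..1} z * (((1 - z) / 2) ^ k * ((1 + z) / 2) ^ l * ((1 - z) powr \<kappa> * (1 + z) powr (\<beta> - 1))))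
      (2 powr (\<kappa> + \<beta>) * Beta (\<kappa> + 1) \<beta>
        * (pochhammer (\<kappa> + 1) k * pochhammer \<beta> l / pochhammer (\<kappa> + \<beta> + 1) (k + l)))" (is "has_bochner_integral lborel ?f ?v")
proof -
  have shift: "Gamma (z + real m) = Gamma z * pochhammer z m" if "z > 0" for z m
  proof -
    have "z \<notin> \<int>\<^sub>\<le>\<^sub>0" using that by (auto simp: nonpos_Ints_def)
    from pochhammer_Gamma[OF this, of m] show ?thesis using Gamma_real_pos[OF that] by simp
  qed
  have "Beta (\<kappa> + 1 + real k) (\<beta> + real l)
      = Beta (\<kappa> + 1) \<beta> * (pochhammer (\<kappa> + 1) k * pochhammer \<beta> l / pochhammer (\<kappa> + \<beta> + 1) (k + l))"
  proof -
    have "Gamma (\<kappa> + 1 + real k) = Gamma (\<kappa> + 1) * pochhammer (\<kappa> + 1) k"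
      using shift[of "\<kappa> + 1" k] assms by simp
    moreover have "Gamma (\<beta> + real l) = Gamma \<beta> * pochhammer \<beta> l"
      using shift[of "\<beta>" l] assms by simp
    moreover have "Gamma (\<kappa> + 1 + real k + (\<beta> + real l)) = Gamma (\<kappa> + 1 + \<beta>) * pochhammer (\<kappa> + \<beta> + 1) (k + l)"
      using shift[of "\<kappa> + \<beta> + 1" "k + l"] assms by (simp add: add_ac)
    ultimately show ?thesis by (simp add: Beta_def)
  qed
  moreover have "has_bochner_integral lborel (\<lambda>a. 2 powr (\<kappa> + \<beta> - 1) * (indicator {0..1} a
       * (a powr (\<kappa> + 1 + real k - 1) * (1 - a) powr (\<beta> + real l - 1))))
      (2 powr (\<kappa> + \<beta> - 1) * Beta (\<kappa> + 1 + real k) (\<beta> + real l))"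
    using assms by (intro has_bochner_integral_mult_right has_bochner_integral_Beta) auto
  moreover have "?f (1 + (- 2) * a) = 2 powr (\<kappa> + \<beta> - 1) * (indicator {0..1} a
       * (a powr (\<kappa> + 1 + real k - 1) * (1 - a) powr (\<beta> + real l - 1)))" for a
  proof (cases "a \<in> {0..1}")
    case True
    have split: "b powr (p + real k) = b ^ k * b powr p" if "b \<ge> 0" for b p :: real and k
      using that by (cases "b = 0") (auto simp: powr_add powr_realpow)
    have "(1 - (1 + (- 2) * a)) powr \<kappa> = 2 powr \<kappa> * a powr \<kappa>"
      "(1 + (1 + (- 2) * a)) powr (\<beta> - 1) = 2 powr (\<beta> - 1) * (1 - a) powr (\<beta> - 1)"
      using True by (simp_all add: powr_mult[symmetric] algebra_simps)
    moreover have "(1 - (1 + (- 2) * a)) / 2 = a" "(1 + (1 + (- 2) * a)) / 2 = 1 - a" by simp_all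
    moreover have "indicator {-1..1} (1 + (- 2) * a) = (1::real)" using True by simp
    moreover have "a powr (\<kappa> + 1 + real k - 1) = a ^ k * a powr \<kappa>" using split[of a \<kappa> k] True by simp
    moreover have "(1 - a) powr (\<beta> + real l - 1) = (1 - a) ^ l * (1 - a) powr (\<beta> - 1)"
      using split[of "1 - a" "\<beta> - 1" l] True by (simp add: algebra_simps)
    moreover have "2 powr (\<kappa> + \<beta> - 1) = 2 powr \<kappa> * 2 powr (\<beta> - (1::real))" by (simp add: powr_add[symmetric] add_diff_eq)
    ultimately show ?thesis using True by (simp only: indicator_simps) (simp add: mult_ac)
  qed (auto simp: indicator_def)
  moreover have "2 powr (\<kappa> + \<beta> - 1) * V = (2 powr (\<kappa> + \<beta>) * V) /\<^sub>R \<bar>- 2\<bar>" for V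
    by (simp add: powr_diff)
  ultimately have "has_bochner_integral lborel (\<lambda>a. ?f (1 + (- 2) * a)) (?v /\<^sub>R \<bar>- 2\<bar>)"
    by (simp only: mult.assoc)
  then show ?thesis
    by (subst lborel_has_bochner_integral_real_affine_iff[where c = "- 2" and t = 1]) auto
qed

text \<open>The one-dimensional case of the ball integral.\<close>

lemma gegenbauer_integral:
  assumes "b > -1/2"
  shows "has_bochner_integral lborel (\<lambda>x. indicator {-1..1} x * (x ^ l * (1 - x\<^sup>2) powr (b - 1/2)))
    (sqrt pi * (Gamma (b + 1/2) / Gamma (b + 1)) * geg_moment b l)"
proof -
  have poly: "(\<lambda>x::real. x ^ l) \<in> poly_upto l" using poly_upto_inner_power[of "1::real" l] by simp
  have int: "has_bochner_integral lborel (\<lambda>x::real. x ^ l * ball_weight b 1 x)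
       (Gamma (b + 1/2) / Gamma (b + 1/2 + real (l + DIM(real)) / 2) * gauss_integral (\<lambda>x::real. x ^ l))"
    using assms poly
    by (intro has_bochner_integral_ball gauss_integrable_poly poly_upto_measurable) (auto simp: homogeneous_def power_mult_distrib)
  have bw: "ball_weight b 1 x = indicator {-1..1} x * (1 - x\<^sup>2) powr (b - 1/2)" for x :: real
  proof -
    have "x\<^sup>2 \<le> 1 \<longleftrightarrow> -1 \<le> x \<and> x \<le> 1" using abs_square_le_1[of x] by auto
    then show ?thesis by (auto simp: ball_weight_def indicator_def)
  qed
  have gi: "gauss_integral (\<lambda>x::real. x ^ l) = sqrt pi * gauss_moment l"
    using gauss_integral_monomial[of "\<lambda>_::real. l"] by (simp add: monomial_real[abs_def])
  have "Gamma (b + 1) > 0" using assms by (intro Gamma_real_pos) simp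
  have arg: "b + 1/2 + real (l + DIM(real)) / 2 = b + 1 + real l / 2" by (simp add: field_simps)
  show ?thesis
    using int \<open>Gamma (b + 1) > 0\<close> unfolding bw gi arg by (simp add: geg_moment_def mult_ac)
qed

lemma geg_moment_sqrt_power: "s \<ge> 0 \<Longrightarrow> sqrt s ^ l * geg_moment b l = s ^ (l div 2) * geg_moment b l"
  by (cases "even l") (auto simp: geg_moment_odd power_mult elim!: evenE)

text \<open>The moments of the uniform measure on -1 and 1: the exact form of the limit prescribed
  for \<mu> = 0.\<close>

lemma geg_moment_minus_half: "geg_moment (-1/2) l = (if even l then 1 else 0)"
proof (induction l rule: gauss_moment.induct)
  case (3 k)
  have "(real k + 1) / 2 * geg_moment (-1/2) (Suc (Suc k)) = (real k + 1) / 2 * geg_moment (-1/2) k"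
    using geg_moment_Suc_Suc[of "-1/2" k] by (simp add: add_divide_distrib add.commute)
  then have "geg_moment (-1/2) (Suc (Suc k)) = geg_moment (-1/2) k"
    by (subst (asm) mult_left_cancel) auto
  then show ?case using 3 by simp
qed (auto simp: geg_moment_0 geg_moment_odd)

text \<open>\<open>\<Phi> 0 = 1\<close> identifies C as the total mass, so it cancels against
  \<open>norm_const\<close>, and averaging a polynomial in \<open>g\<close> replaces each power by
  its mean; \<open>r\<close> carries the powers of the height.\<close>

lemma norm_const_integral_poly:
  fixes g wt :: "'b::euclidean_space \<Rightarrow> real"
  assumes int: "\<And>i. has_bochner_integral lborel (\<lambda>z. indicator S z * (g z ^ i * wt z)) (C * \<Phi> i)"
    and "\<Phi> 0 = 1" "C > 0"
  shows "norm_const S wt * (LINT z:S|lborel. (\<Sum>k\<in>K. c k * (g z ^ e k * r k)) * wt z) = (\<Sum>k\<in>K. c k * (\<Phi> (e k) * r k))"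
proof -
  have "(LINT z:S|lborel. wt z) = C"
    using has_bochner_integral_integral_eq[OF int[of 0]] assms(2) by (simp add: set_lebesgue_integral_def)
  moreover have "(LINT z:S|lborel. (\<Sum>k\<in>K. c k * (g z ^ e k * r k)) * wt z) = (\<Sum>k\<in>K. (c k * r k) * (C * \<Phi> (e k)))"
  proof -
    have "has_bochner_integral lborel (\<lambda>z. \<Sum>k\<in>K. (c k * r k) * (indicator S z * (g z ^ e k * wt z))) (\<Sum>k\<in>K. (c k * r k) * (C * \<Phi> (e k)))"
      by (intro has_bochner_integral_sum has_bochner_integral_mult_right int)
    moreover have "(\<Sum>k\<in>K. (c k * r k) * (indicator S z * (g z ^ e k * wt z))) = indicator S z * ((\<Sum>k\<in>K. c k * (g z ^ e k * r k)) * wt z)" for z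
      unfolding sum_distrib_left sum_distrib_right by (intro sum.cong refl) (simp only: mult_ac)
    ultimately show ?thesis
      unfolding set_lebesgue_integral_def by (simp add: has_bochner_integral_iff)
  qed
  moreover have "1 / C * (\<Sum>k\<in>K. (c k * r k) * (C * \<Phi> (e k))) = (\<Sum>k\<in>K. c k * (\<Phi> (e k) * r k))"
    unfolding sum_distrib_left using assms(3) by (intro sum.cong) auto
  ultimately show ?thesis by (simp only: norm_const_def)
qed

lemma z_transform_0: "b > -1 \<Longrightarrow> z_transform a b s 0 = s 0"
  by (simp add: z_transform_def geg_moment_0)

text \<open>At \<beta> = 0 the law of z1 degenerates to the point -1, where \<xi> equals \<xi>_0;
  algebraically, \<open>pochhammer 0 m\<close> vanishes for m > 0.\<close>

lemma z_transform_beta_0: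
  assumes "a > -1" shows "z_transform a 0 s i = s i"
proof -
  have "pochhammer (a + 1) i > 0" using assms by (intro pochhammer_pos) simp
  moreover have "z_transform a 0 s i = (\<Sum>k\<le>i. if k = i then pochhammer (a + 1) i / pochhammer (a + 1) i * s i else 0)"
    unfolding z_transform_def by (intro sum.cong refl) (auto simp: pochhammer_0_left geg_moment_0)
  ultimately show ?thesis by simp
qed

abbreviation z_expansion :: "nat \<Rightarrow> real \<Rightarrow> real \<Rightarrow> real \<Rightarrow> (nat \<Rightarrow> real) \<Rightarrow> real" where
  "z_expansion i s z1 z2 h \<equiv> (\<Sum>k\<le>i. real (i choose k) * ((1 - z1) / 2) ^ k * ((1 + z1) / 2 * (sqrt s * z2)) ^ (i - k) * h k)"

context parabolic_weight
begin

lemma ridge_poly_0: "ridge_poly X B 0 q = 1"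
  using \<mu> by (simp add: ridge_poly_def geg_moment_0)

lemma kernel_poly_0: "kernel_poly X B 0 q = 1"
  using \<beta> by (simp add: kernel_poly_def z_transform_0 ridge_poly_0)

lemma kernel_poly_beta_0:
  assumes "\<beta> = 0" shows "kernel_poly X B i q = ridge_poly X B i q"
proof -
  have "z_transform lam \<beta> f i = f i" for f
    unfolding assms using lam_gt by (intro z_transform_beta_0) simp
  then show ?thesis by (simp add: kernel_poly_def)
qed

text \<open>Two parallel expansions in which u^l stands opposite its mean, so integrating over u and
  averaging over -1, 1 become termwise replacements.\<close>

lemma ridge_power_expand:
  fixes y :: 'a
  assumes s: "(norm y)\<^sup>2 \<le> s" and q: "q = (y, s)"
  shows "(X \<bullet> y + u * (B * sqrt (s - (norm y)\<^sup>2))) ^ k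
      = (\<Sum>l\<le>k. real (k choose l) * (B ^ l * sqrt (s - (norm y)\<^sup>2) ^ l) * (X \<bullet> y) ^ (k - l) * u ^ l)"
    and "ridge_poly X B k q
      = (\<Sum>l\<le>k. real (k choose l) * (B ^ l * sqrt (s - (norm y)\<^sup>2) ^ l) * (X \<bullet> y) ^ (k - l) * geg_moment (\<mu> - 1/2) l)"
proof -
  have "(X \<bullet> y + u * (B * sqrt (s - (norm y)\<^sup>2))) ^ k = (u * (B * sqrt (s - (norm y)\<^sup>2)) + X \<bullet> y) ^ k"
    by (simp only: add.commute)
  also have "\<dots> = (\<Sum>l\<le>k. real (k choose l) * (B ^ l * sqrt (s - (norm y)\<^sup>2) ^ l) * (X \<bullet> y) ^ (k - l) * u ^ l)"
    unfolding binomial_ring power_mult_distrib by (intro sum.cong refl) (simp only: mult_ac)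
  finally show "(X \<bullet> y + u * (B * sqrt (s - (norm y)\<^sup>2))) ^ k
      = (\<Sum>l\<le>k. real (k choose l) * (B ^ l * sqrt (s - (norm y)\<^sup>2) ^ l) * (X \<bullet> y) ^ (k - l) * u ^ l)" .
  have rearrange: "C * (b * m) * (P * S) = C * (b * T) * P * m" if "T * m = S * m" for C b m P S T :: real
    using arg_cong[OF that, of "\<lambda>x. C * b * P * x"] by (simp only: mult_ac)
  show "ridge_poly X B k q
      = (\<Sum>l\<le>k. real (k choose l) * (B ^ l * sqrt (s - (norm y)\<^sup>2) ^ l) * (X \<bullet> y) ^ (k - l) * geg_moment (\<mu> - 1/2) l)"
    unfolding ridge_poly_def q fst_conv snd_conv
    by (intro sum.cong refl) (rule rearrange, rule geg_moment_sqrt_power, use s in simp)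
qed

lemma u_integral:
  assumes \<mu>: "\<mu> > 0" and s: "(norm y)\<^sup>2 \<le> s"
  shows "has_bochner_integral lborel (\<lambda>u. indicator {-1..1} u * ((X \<bullet> y + u * (B * sqrt (s - (norm y)\<^sup>2))) ^ k * u_weight \<mu> u))
     (sqrt pi * (Gamma \<mu> / Gamma (\<mu> + 1/2)) * ridge_poly X B k (y, s))"
proof -
  have geg: "has_bochner_integral lborel (\<lambda>u. indicator {-1..1} u * (u ^ l * u_weight \<mu> u))
    (sqrt pi * (Gamma \<mu> / Gamma (\<mu> + 1/2)) * geg_moment (\<mu> - 1/2) l)" for l
    using gegenbauer_integral[of "\<mu> - 1/2" l] \<mu> by (simp add: u_weight_def add.commute)
  define c where "c l = real (k choose l) * (B ^ l * sqrt (s - (norm y)\<^sup>2) ^ l) * (X \<bullet> y) ^ (k - l)" for l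
  have "has_bochner_integral lborel (\<lambda>u. \<Sum>l\<le>k. c l * (indicator {-1..1} u * (u ^ l * u_weight \<mu> u)))
     (\<Sum>l\<le>k. c l * (sqrt pi * (Gamma \<mu> / Gamma (\<mu> + 1/2)) * geg_moment (\<mu> - 1/2) l))"
    by (intro has_bochner_integral_sum has_bochner_integral_mult_right geg)
  also have "(\<lambda>u. \<Sum>l\<le>k. c l * (indicator {-1..1} u * (u ^ l * u_weight \<mu> u)))
      = (\<lambda>u. indicator {-1..1} u * ((X \<bullet> y + u * (B * sqrt (s - (norm y)\<^sup>2))) ^ k * u_weight \<mu> u))"
    unfolding ridge_power_expand(1)[OF s refl] sum_distrib_left sum_distrib_right c_def
    by (intro ext sum.cong refl) (simp only: mult_ac)
  also have "(\<Sum>l\<le>k. c l * (sqrt pi * (Gamma \<mu> / Gamma (\<mu> + 1/2)) * geg_moment (\<mu> - 1/2) l))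
      = sqrt pi * (Gamma \<mu> / Gamma (\<mu> + 1/2)) * ridge_poly X B k (y, s)"
    unfolding ridge_power_expand(2)[OF s refl] sum_distrib_left c_def by (intro sum.cong refl) (simp only: mult_ac)
  finally show ?thesis .
qed

lemma u_average:
  assumes \<mu>: "\<mu> = 0" and s: "(norm y)\<^sup>2 \<le> s"
  shows "1/2 * ((X \<bullet> y + 1 * (B * sqrt (s - (norm y)\<^sup>2))) ^ k + (X \<bullet> y + (-1) * (B * sqrt (s - (norm y)\<^sup>2))) ^ k)
     = ridge_poly X B k (y, s)"
  unfolding ridge_power_expand[OF s refl] sum.distrib[symmetric] sum_distrib_left
proof (intro sum.cong refl)
  fix l
  have "geg_moment (\<mu> - 1/2) l = 1/2 * (1 ^ l + (-1) ^ l)"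
    using geg_moment_minus_half[of l] \<mu> by simp
  then show "1/2 * (real (k choose l) * (B ^ l * sqrt (s - (norm y)\<^sup>2) ^ l) * (X \<bullet> y) ^ (k - l) * 1 ^ l
      + real (k choose l) * (B ^ l * sqrt (s - (norm y)\<^sup>2) ^ l) * (X \<bullet> y) ^ (k - l) * (-1) ^ l)
    = real (k choose l) * (B ^ l * sqrt (s - (norm y)\<^sup>2) ^ l) * (X \<bullet> y) ^ (k - l) * geg_moment (\<mu> - 1/2) l"
    by (simp only: distrib_left mult_ac)
qed

definition z_mass :: real where
  "z_mass = 2 powr (lam + \<beta>) * Beta (lam + 1) \<beta> * (sqrt pi * (Gamma (\<beta> + 1/2) / Gamma (\<beta> + 1)))"

lemma z_mass_pos:
  assumes "\<beta> > 0" shows "z_mass > 0"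
  unfolding z_mass_def Beta_def using assms lam_gt
  by (intro mult_pos_pos divide_pos_pos Gamma_real_pos) auto

text \<open>The two \<open>z\<close>-integrals, with the power \<open>W\<^sup>k\<close> of the remaining variable replaced by an
  independent factor.\<close>

lemma z_integral:
  fixes H :: "nat \<Rightarrow> 'c::euclidean_space \<Rightarrow> real"
  assumes \<beta>: "\<beta> > 0" and H: "\<And>k. has_bochner_integral lborel (H k) (v k)" and s: "s \<ge> 0"
  shows "has_bochner_integral lborel (\<lambda>(z1, z2, q). indicator {-1..1} z1 * (indicator {-1..1} z2 * z_weight lam \<beta> z1 z2 *
      z_expansion i s z1 z2 (\<lambda>k. H k q)))
    (z_mass * z_transform lam \<beta> (\<lambda>k. s ^ ((i - k) div 2) * v k) i)" (is ?triple)
    and "has_bochner_integral lborel (\<lambda>(z1, z2). indicator {-1..1} z1 * (indicator {-1..1} z2 * z_weight lam \<beta> z1 z2 *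
      z_expansion i s z1 z2 (\<lambda>k. a k)))
    (z_mass * z_transform lam \<beta> (\<lambda>k. s ^ ((i - k) div 2) * a k) i)" (is ?pair)
proof -
  define f1 where "f1 k z = indicator {-1..1} z * (((1 - z) / 2) ^ k * ((1 + z) / 2) ^ (i - k) * ((1 - z) powr lam * (1 + z) powr (\<beta> - 1)))" for k and z :: real
  define f2 where "f2 k z = indicator {-1..1} z * (z ^ (i - k) * (1 - z\<^sup>2) powr (\<beta> - 1/2))" for k and z :: real
  define C1 where "C1 = 2 powr (lam + \<beta>) * Beta (lam + 1) \<beta>"
  define C2 where "C2 = sqrt pi * (Gamma (\<beta> + 1/2) / Gamma (\<beta> + 1))"
  define \<tau> where "\<tau> k = pochhammer (lam + 1) k * pochhammer \<beta> (i - k) / pochhammer (lam + \<beta> + 1) i" for k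
  have f1: "has_bochner_integral lborel (f1 k) (C1 * \<tau> k)" if "k \<le> i" for k
    unfolding f1_def C1_def \<tau>_def using z1_integral[of lam \<beta> k "i - k"] lam_gt \<beta> that by simp
  have f2: "has_bochner_integral lborel (f2 k) (C2 * geg_moment \<beta> (i - k))" for k
    unfolding f2_def C2_def using \<beta> by (intro gegenbauer_integral) simp
  have f2a: "has_bochner_integral lborel (\<lambda>z. f2 k z * a k) (C2 * geg_moment \<beta> (i - k) * a k)" for k
    by (intro has_bochner_integral_mult_left f2)
  have mass: "z_mass = C1 * C2" by (simp add: z_mass_def C1_def C2_def)
  have total: "(\<Sum>k\<le>i. (real (i choose k) * sqrt s ^ (i - k)) * (C1 * \<tau> k * (C2 * geg_moment \<beta> (i - k) * v k)))
      = z_mass * z_transform lam \<beta> (\<lambda>k. s ^ ((i - k) div 2) * v k) i" for v :: "nat \<Rightarrow> real"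
  proof -
    have "(N * S) * (C1 * T * (C2 * m * V)) = C1 * C2 * (N * T * m * (R * V))" if "S * m = R * m" for N S T m V R :: real
      using arg_cong[OF that, of "\<lambda>x. C1 * C2 * N * T * V * x"] by (simp only: mult_ac)
    from this[OF geg_moment_sqrt_power[OF s]] show ?thesis
      unfolding z_transform_def \<tau>_def[symmetric] mass sum_distrib_left by (intro sum.cong refl)
  qed
  have pt: "(\<Sum>k\<le>i. (real (i choose k) * sqrt s ^ (i - k)) * (f1 k z1 * (f2 k z2 * h k)))
    = indicator {-1..1} z1 * (indicator {-1..1} z2 * z_weight lam \<beta> z1 z2 *
      z_expansion i s z1 z2 (\<lambda>k. h k))" for z1 z2 and h :: "nat \<Rightarrow> real"
    unfolding sum_distrib_left f1_def f2_def z_weight_def power_mult_distrib by (intro sum.cong refl) (simp only: mult_ac)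
  have "has_bochner_integral lborel (\<lambda>q. \<Sum>k\<le>i. (real (i choose k) * sqrt s ^ (i - k)) * (f1 k (fst q) * (f2 k (fst (snd q)) * H k (snd (snd q)))))
     (\<Sum>k\<le>i. (real (i choose k) * sqrt s ^ (i - k)) * (C1 * \<tau> k * (C2 * geg_moment \<beta> (i - k) * v k)))"
    by (intro has_bochner_integral_sum has_bochner_integral_mult_right)
      (rule has_bochner_integral_prod[OF f1 has_bochner_integral_prod[OF f2 H]], simp)
  then show ?triple
    unfolding total by (simp only: pt case_prod_unfold)
  have "has_bochner_integral lborel (\<lambda>q. \<Sum>k\<le>i. (real (i choose k) * sqrt s ^ (i - k)) * (f1 k (fst q) * (f2 k (snd q) * a k)))
     (\<Sum>k\<le>i. (real (i choose k) * sqrt s ^ (i - k)) * (C1 * \<tau> k * (C2 * geg_moment \<beta> (i - k) * a k)))"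
    by (intro has_bochner_integral_sum has_bochner_integral_mult_right)
      (rule has_bochner_integral_prod[OF f1 f2a], simp)
  then show ?pair
    unfolding total by (simp only: pt case_prod_unfold)
qed

end

section \<open>The four cases of the theorem\<close>

lemma parabolic_weight_W:
  assumes "\<beta> \<ge> 0" "\<gamma> > -1" "\<mu> > -1/2"
  shows "parabolic_weight (solid_paraboloid :: ((real^'d) \<times> real) set) (W_weight \<beta> \<gamma> \<mu>) \<beta> \<gamma> \<mu>"
proof
  show "(solid_paraboloid :: ((real^'d) \<times> real) set) = {(y, s). (norm y)\<^sup>2 \<le> s \<and> s \<le> 1}"
    by (auto simp: solid_paraboloid_def intro: order_trans[OF zero_le_power2])
  show "W_weight \<beta> \<gamma> \<mu> (y, s) = s powr \<beta> * (1 - s) powr \<gamma> * (s - (norm y)\<^sup>2) powr (\<mu> - 1 / 2)"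
    for y :: "real^'d" and s by (simp add: W_weight_def)
  show "(W_weight \<beta> \<gamma> \<mu> :: (real^'d) \<times> real \<Rightarrow> real) \<in> borel_measurable borel"
    unfolding W_weight_def case_prod_unfold by measurable
qed (use assms in auto)

theorem theorem4p3:
  fixes \<mu> \<gamma> \<beta> \<alpha> :: real and x y :: "real^'d" and t s :: real and n :: nat
  assumes "CARD('d) \<ge> 2" and "\<mu> \<ge> 0" and "\<gamma> > -1" and "\<beta> \<ge> 0"
    and "\<alpha> = \<beta> + \<mu> + (real CARD('d) - 1) / 2"
    and "(x, t) \<in> solid_paraboloid" and "(y, s) \<in> solid_paraboloid" and "t > 0" and "s > 0"
  shows
    "(\<beta> > 0 \<and> \<mu> > 0 \<longrightarrow>
       P_paraboloid \<beta> \<gamma> \<mu> n (x, t) (y, s) =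
         norm_const ({-1..1} \<times> {-1..1} \<times> {-1..1})
           (\<lambda>(z1, z2, u). z_weight (\<mu> + (real CARD('d) - 1) / 2) \<beta> z1 z2 * u_weight \<mu> u) *
         (LINT (z1, z2, u):{-1..1} \<times> {-1..1} \<times> {-1..1}|lborel.
            P_parabolic \<gamma> \<alpha> n (sqrt t, t) (sqrt s * xi x t y s z1 z2 u, s) *
            (z_weight (\<mu> + (real CARD('d) - 1) / 2) \<beta> z1 z2 * u_weight \<mu> u)))
   \<and> (\<beta> = 0 \<and> \<mu> > 0 \<longrightarrow>
       P_paraboloid 0 \<gamma> \<mu> n (x, t) (y, s) =
         norm_const {-1..1} (u_weight \<mu>) *
         (LINT u:{-1..1}|lborel.
            P_parabolic \<gamma> (\<mu> + (real CARD('d) - 1) / 2) n (sqrt t, t) (sqrt s * xi0 x t y s u, s) *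
            u_weight \<mu> u))
   \<and> (\<beta> > 0 \<and> \<mu> = 0 \<longrightarrow>
       P_paraboloid \<beta> \<gamma> 0 n (x, t) (y, s) =
         norm_const ({-1..1} \<times> {-1..1})
           (\<lambda>(z1, z2). z_weight ((real CARD('d) - 1) / 2) \<beta> z1 z2) *
         (LINT (z1, z2):{-1..1} \<times> {-1..1}|lborel.
            1/2 * (P_parabolic \<gamma> \<alpha> n (sqrt t, t) (sqrt s * xi x t y s z1 z2 1, s)
                 + P_parabolic \<gamma> \<alpha> n (sqrt t, t) (sqrt s * xi x t y s z1 z2 (-1), s)) *
            z_weight ((real CARD('d) - 1) / 2) \<beta> z1 z2))
   \<and> (\<beta> = 0 \<and> \<mu> = 0 \<longrightarrow>
       P_paraboloid 0 \<gamma> 0 n (x, t) (y, s) =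
         1/2 * (P_parabolic \<gamma> ((real CARD('d) - 1) / 2) n (sqrt t, t) (sqrt s * xi0 x t y s 1, s)
              + P_parabolic \<gamma> ((real CARD('d) - 1) / 2) n (sqrt t, t) (sqrt s * xi0 x t y s (-1), s)))"
proof -
  interpret W: parabolic_weight "solid_paraboloid :: ((real^'d) \<times> real) set" "W_weight \<beta> \<gamma> \<mu>" \<beta> \<gamma> \<mu>
    by (rule parabolic_weight_W) (use assms in auto)
  define lambda where "lambda = \<mu> + (real CARD('d) - 1) / 2"
  have lam: "W.lam = lambda" by (simp add: W.lam_def lambda_def)
  have la_nonneg: "lambda \<ge> 0" using assms(1,2) by (simp add: lambda_def)
  have \<alpha>: "\<alpha> = lambda + \<beta>" using assms(5) by (simp add: lambda_def)
  interpret U: parabolic_weight parabolic_domain "U_weight \<gamma> \<alpha>" 0 \<gamma> \<alpha>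
    by (rule parabolic_weight_U) (use assms(3,4) la_nonneg \<alpha> in auto)
  define KU where "KU = P_parabolic \<gamma> \<alpha> n (sqrt t, t)"
  obtain c :: "(real \<times> real \<Rightarrow> nat) \<Rightarrow> real"
    where c: "\<And>q. KU q = (\<Sum>k\<in>multi_indices n. c k * (fst q ^ k (1, 0) * snd q ^ k (0, 1)))"
  proof -
    have "KU \<in> poly_upto n"
      using U.repro_kernel_in_orth_polys[of n "(sqrt t, t)"] by (simp add: KU_def P_parabolic_def orth_polys_def)
    then obtain d where d: "KU = (\<lambda>q. \<Sum>k\<in>multi_indices n. d k * monomial k q)"
      unfolding poly_upto_iff by blast
    have "monomial k q = fst q ^ k (1, 0) * snd q ^ k (0, 1)" for k and q :: "real \<times> real"
      using monomial_Pair[of k "fst q" "snd q"] by (simp add: monomial_real)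
    then show ?thesis using that[of d] by (simp add: d)
  qed
  \<comment> \<open>The expanded planar kernel at height s, with the i-th power of its first
    variable replaced by \<open>f i\<close>.\<close>
  let ?at = "\<lambda>f. \<Sum>k\<in>multi_indices n. c k * (f (k (1, 0)) * s ^ k (0, 1))"
  define X where "X = (1 / sqrt t) *\<^sub>R x"
  \<comment> \<open>Chosen so that (X, B) is a unit vector and \<open>W u\<close> below equals sqrt
    s times \<xi>_0.\<close>
  define B where "B = sqrt (t - (norm x)\<^sup>2) / sqrt t"
  have xt: "(norm x)\<^sup>2 \<le> t" and ys: "(norm y)\<^sup>2 \<le> s"
    using assms(6,7) by (auto simp: solid_paraboloid_def)
  have x: "x = sqrt t *\<^sub>R X" using \<open>t > 0\<close> by (simp add: X_def)
  have XB: "(norm X)\<^sup>2 + B\<^sup>2 = 1"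
    using \<open>t > 0\<close> xt by (simp add: X_def B_def power_divide power_mult_distrib field_simps)
  define W where "W u = X \<bullet> y + u * (B * sqrt (s - (norm y)\<^sup>2))" for u
  have xi0: "sqrt s * xi0 x t y s u = W u" for u
    using \<open>t > 0\<close> \<open>s > 0\<close> by (simp add: xi0_def W_def X_def B_def real_sqrt_mult field_simps)
  have xi: "sqrt s * xi x t y s z1 z2 u = (1 - z1) / 2 * W u + (1 + z1) / 2 * (sqrt s * z2)" for z1 z2 u
    by (simp add: xi_def distrib_left mult.left_commute[of "sqrt s"] xi0)
  have xi_power: "(sqrt s * xi x t y s z1 z2 u) ^ i
      = z_expansion i s z1 z2 (\<lambda>k. W u ^ k)" for z1 z2 u i
    unfolding xi binomial_ring power_mult_distrib by (intro sum.cong refl) (simp only: mult_ac)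
  define \<Phi> where "\<Phi> i = W.kernel_poly X B i (y, s)" for i
  have \<Phi>0: "\<Phi> 0 = 1" by (simp add: \<Phi>_def W.kernel_poly_0)
  have kernel: "P_paraboloid \<beta> \<gamma> \<mu> n (x, t) (y, s) = ?at \<Phi>"
    unfolding P_paraboloid_def \<Phi>_def
    using W.repro_kernel_eq_kernel_poly[OF _ \<open>t > 0\<close> x XB, of n c "(y, s)"] c la_nonneg
    by (simp add: lam KU_def P_parabolic_def flip: \<alpha>)
  have u_int: "has_bochner_integral lborel (\<lambda>u. indicator {-1..1} u * (W u ^ k * u_weight \<mu> u))
     (sqrt pi * (Gamma \<mu> / Gamma (\<mu> + 1/2)) * W.ridge_poly X B k (y, s))" if "\<mu> > 0" for k
    unfolding W_def using that ys by (rule W.u_integral)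
  define Cu where "Cu = sqrt pi * (Gamma \<mu> / Gamma (\<mu> + 1/2))"
  have Cu: "Cu > 0" if "\<mu> > 0" using that by (simp add: Cu_def Gamma_real_pos)
  have u_avg: "1/2 * (W 1 ^ k + W (-1) ^ k) = W.ridge_poly X B k (y, s)" if "\<mu> = 0" for k
    unfolding W_def using that ys by (rule W.u_average)
  have "s \<ge> 0" using \<open>s > 0\<close> by simp
  have case1: "P_paraboloid \<beta> \<gamma> \<mu> n (x, t) (y, s) =
         norm_const ({-1..1} \<times> {-1..1} \<times> {-1..1}) (\<lambda>(z1, z2, u). z_weight lambda \<beta> z1 z2 * u_weight \<mu> u) *
         (LINT (z1, z2, u):{-1..1} \<times> {-1..1} \<times> {-1..1}|lborel.
            KU (sqrt s * xi x t y s z1 z2 u, s) * (z_weight lambda \<beta> z1 z2 * u_weight \<mu> u))"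
    if pos: "\<beta> > 0" "\<mu> > 0"
  proof -
    define g where "g = (\<lambda>(z1, z2, u). sqrt s * xi x t y s z1 z2 u)"
    define wt where "wt = (\<lambda>(z1, z2, u). z_weight lambda \<beta> z1 z2 * u_weight \<mu> u)"
    define S where "S = ({-1..1} \<times> {-1..1} \<times> {-1..1} :: (real \<times> real \<times> real) set)"
    have int: "has_bochner_integral lborel (\<lambda>z. indicator S z * (g z ^ i * wt z)) (W.z_mass * Cu * \<Phi> i)" for i
    proof -
      let ?L = "\<lambda>z1 z2 u. indicator {-1..1} z1 * (indicator {-1..1} z2 * z_weight lambda \<beta> z1 z2 *
         z_expansion i s z1 z2 (\<lambda>k. (indicator {-1..1} u * (W u ^ k * u_weight \<mu> u))))"
      have "has_bochner_integral lborel (\<lambda>(z1, z2, u). ?L z1 z2 u)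
        (W.z_mass * z_transform lambda \<beta> (\<lambda>k. s ^ ((i - k) div 2) * (Cu * W.ridge_poly X B k (y, s))) i)"
        using W.z_integral(1)[OF pos(1) u_int[OF pos(2)] \<open>s \<ge> 0\<close>, of i] by (simp only: lam Cu_def)
      moreover have "(\<lambda>(z1, z2, u). ?L z1 z2 u) = (\<lambda>z. indicator S z * (g z ^ i * wt z))"
      proof -
        have "?L z1 z2 u = indicator S (z1, z2, u) * (g (z1, z2, u) ^ i * wt (z1, z2, u))" for z1 z2 u
        proof -
          have "indicator S (z1, z2, u) = (indicator {-1..1} z1 * indicator {-1..1} z2 * indicator {-1..1} u :: real)"
            by (auto simp: S_def indicator_def)
          then show ?thesis
            unfolding g_def wt_def prod.case xi_power sum_distrib_left sum_distrib_right
            by (intro sum.cong refl) (simp only: mult_ac)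
        qed
        then show ?thesis by (auto simp: fun_eq_iff)
      qed
      moreover have "z_transform lambda \<beta> (\<lambda>k. s ^ ((i - k) div 2) * (Cu * W.ridge_poly X B k (y, s))) i = Cu * \<Phi> i"
        unfolding \<Phi>_def W.kernel_poly_def lam by (simp add: mult.left_commute[of _ Cu] z_transform_scale)
      ultimately show ?thesis by (simp only: mult.assoc)
    qed
    have "KU (g z, s) = (\<Sum>k\<in>multi_indices n. c k * (g z ^ k (1, 0) * s ^ k (0, 1)))" for z
      by (simp add: c)
    then have "norm_const S wt * (LINT z:S|lborel. KU (g z, s) * wt z)
        = ?at \<Phi>"
      using norm_const_integral_poly[OF int \<Phi>0, where K = "multi_indices n" and c = c and e = "\<lambda>k. k (1, 0)" and r = "\<lambda>k. s ^ k (0, 1)"]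
        W.z_mass_pos[OF pos(1)] Cu[OF pos(2)] by simp
    then show ?thesis unfolding kernel g_def wt_def S_def case_prod_unfold by simp
  qed
  have case2: "P_paraboloid \<beta> \<gamma> \<mu> n (x, t) (y, s) =
         norm_const {-1..1} (u_weight \<mu>) *
         (LINT u:{-1..1}|lborel. KU (sqrt s * xi0 x t y s u, s) * u_weight \<mu> u)"
    if z: "\<beta> = 0" "\<mu> > 0"
  proof -
    have "\<Phi> i = W.ridge_poly X B i (y, s)" for i
      unfolding \<Phi>_def by (rule W.kernel_poly_beta_0[OF z(1)])
    then have "has_bochner_integral lborel (\<lambda>u. indicator {-1..1} u * (W u ^ i * u_weight \<mu> u)) (Cu * \<Phi> i)" for i
      using u_int[OF z(2), of i] by (simp add: Cu_def)
    from norm_const_integral_poly[OF this \<Phi>0 Cu[OF z(2)], where K = "multi_indices n" and c = c and e = "\<lambda>k. k (1, 0)" and r = "\<lambda>k. s ^ k (0, 1)"]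
    show ?thesis unfolding kernel by (simp add: xi0 c)
  qed
  have case3: "P_paraboloid \<beta> \<gamma> \<mu> n (x, t) (y, s) =
         norm_const ({-1..1} \<times> {-1..1}) (\<lambda>(z1, z2). z_weight lambda \<beta> z1 z2) *
         (LINT (z1, z2):{-1..1} \<times> {-1..1}|lborel.
            1/2 * (KU (sqrt s * xi x t y s z1 z2 1, s)
                 + KU (sqrt s * xi x t y s z1 z2 (-1), s)) * z_weight lambda \<beta> z1 z2)"
    if z: "\<beta> > 0" "\<mu> = 0"
  proof -
    define g where "g u = (\<lambda>(z1, z2). sqrt s * xi x t y s z1 z2 u)" for u
    define wt where "wt = (\<lambda>(z1, z2). z_weight lambda \<beta> z1 z2)"
    define S where "S = ({-1..1} \<times> {-1..1} :: (real \<times> real) set)"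
    \<comment> \<open>The average over z alone, with u frozen at 1 or -1.\<close>
    define \<Psi> where "\<Psi> u i = z_transform lambda \<beta> (\<lambda>k. s ^ ((i - k) div 2) * W u ^ k) i" for u i
    have int: "has_bochner_integral lborel (\<lambda>z. indicator S z * (g u z ^ i * wt z)) (W.z_mass * \<Psi> u i)" for u i
    proof -
      have "has_bochner_integral lborel (\<lambda>(z1, z2). indicator {-1..1} z1 * (indicator {-1..1} z2 * z_weight lambda \<beta> z1 z2 *
         z_expansion i s z1 z2 (\<lambda>k. W u ^ k)))
        (W.z_mass * \<Psi> u i)"
        using W.z_integral(2)[OF z(1) has_bochner_integral_zero \<open>s \<ge> 0\<close>, of i "\<lambda>k. W u ^ k"] by (simp only: lam \<Psi>_def)
      moreover have "(\<lambda>(z1, z2). indicator {-1..1} z1 * (indicator {-1..1} z2 * z_weight lambda \<beta> z1 z2 *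
         z_expansion i s z1 z2 (\<lambda>k. W u ^ k)))
         = (\<lambda>z. indicator S z * (g u z ^ i * wt z))"
        unfolding xi_power[symmetric] by (auto simp: fun_eq_iff S_def g_def wt_def indicator_def)
      ultimately show ?thesis by (simp only:)
    qed
    have \<Psi>0: "\<Psi> u 0 = 1" for u using \<open>\<beta> > 0\<close> by (simp add: \<Psi>_def z_transform_0)
    \<comment> \<open>The z-average is linear in the moment sequence, so it may be taken before or
      after the mean over u = 1, -1.\<close>
    have \<Phi>_avg: "\<Phi> i = 1/2 * (\<Psi> 1 i + \<Psi> (-1) i)" for i
      unfolding \<Phi>_def W.kernel_poly_def lam \<Psi>_def u_avg[OF z(2), symmetric] z_transform_scale[symmetric] z_transform_add[symmetric]
      by (simp only: snd_conv distrib_left mult_ac)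
    have P: "KU (g u z, s) = (\<Sum>k\<in>multi_indices n. c k * (g u z ^ k (1, 0) * s ^ k (0, 1)))" for u z
      by (simp add: c)
    have val: "norm_const S wt * (LINT z:S|lborel. KU (g u z, s) * wt z)
        = ?at (\<Psi> u)" for u
      unfolding P by (rule norm_const_integral_poly[OF int \<Psi>0 W.z_mass_pos[OF z(1)]])
    have intP: "set_integrable lborel S (\<lambda>z. KU (g u z, s) * wt z)" for u
    proof -
      have "has_bochner_integral lborel (\<lambda>z. \<Sum>k\<in>multi_indices n. (c k * s ^ k (0, 1)) * (indicator S z * (g u z ^ k (1, 0) * wt z)))
         (\<Sum>k\<in>multi_indices n. (c k * s ^ k (0, 1)) * (W.z_mass * \<Psi> u (k (1, 0))))"
        by (intro has_bochner_integral_sum has_bochner_integral_mult_right int)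
      moreover have "(\<Sum>k\<in>multi_indices n. (c k * s ^ k (0, 1)) * (indicator S z * (g u z ^ k (1, 0) * wt z)))
         = indicator S z * (KU (g u z, s) * wt z)" for z
        unfolding P sum_distrib_left sum_distrib_right by (intro sum.cong refl) (simp only: mult_ac)
      ultimately show ?thesis by (simp add: set_integrable_def has_bochner_integral_iff)
    qed
    have "(LINT z:S|lborel. 1/2 * (KU (g 1 z, s) + KU (g (-1) z, s)) * wt z)
        = (LINT z:S|lborel. 1/2 * (KU (g 1 z, s) * wt z + KU (g (-1) z, s) * wt z))"
      by (simp only: distrib_left distrib_right mult.assoc)
    also have "\<dots> = 1/2 * ((LINT z:S|lborel. KU (g 1 z, s) * wt z)
         + (LINT z:S|lborel. KU (g (-1) z, s) * wt z))"
      by (simp only: set_integral_mult_right set_integral_add(2)[OF intP intP])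
    finally have "norm_const S wt * (LINT z:S|lborel. 1/2 * (KU (g 1 z, s) + KU (g (-1) z, s)) * wt z)
        = 1/2 * (?at (\<Psi> 1) + ?at (\<Psi> (-1)))"
      by (simp only: mult.left_commute[of "norm_const S wt"] distrib_left val)
    also have "\<dots> = ?at \<Phi>"
      unfolding \<Phi>_avg sum.distrib[symmetric] sum_distrib_left by (intro sum.cong refl) (simp add: algebra_simps)
    finally show ?thesis unfolding kernel g_def wt_def S_def case_prod_unfold by simp
  qed
  have case4: "P_paraboloid \<beta> \<gamma> \<mu> n (x, t) (y, s) =
         1/2 * (KU (sqrt s * xi0 x t y s 1, s)
              + KU (sqrt s * xi0 x t y s (-1), s))"
    if z: "\<beta> = 0" "\<mu> = 0"
  proof -
    have \<Phi>: "\<Phi> i = 1/2 * (W 1 ^ i + W (-1) ^ i)" for i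
      unfolding u_avg[OF z(2)] \<Phi>_def by (rule W.kernel_poly_beta_0[OF z(1)])
    show ?thesis
      unfolding kernel c xi0 \<Phi> sum.distrib[symmetric] sum_distrib_left by (intro sum.cong refl) (simp add: algebra_simps)
  qed
  show ?thesis
    using case1 case2 case3 case4 unfolding KU_def by (auto simp: lambda_def \<alpha>)
qed

end
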